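(* Let $n\in\mathbb{N}$, $0<\sigma_1^2<\sigma_2^2$ and $\mathsf{R}\ge 0$. (i) Assuming Assumption (A) stated in the context, $P_{\mathbf{X}_{\mathsf{R}}}$ is optimal (attains $C_s(\sigma_1^2,\sigma_2^2,\mathsf{R},n)$) if and only if $\Xi(\mathbf{0};P_{\mathbf{X}_{\mathsf{R}}}) \le \Xi(\mathbf{x};P_{\mathbf{X}_{\mathsf{R}}})$ for all $\mathbf{x}$ with $\|\mathbf{x}\|=\mathsf{R}$. (ii) If \[ \mathsf{R} < \sigma_1^2 \sqrt{n \left(\frac{1}{\sigma_1^2}-\frac{1}{\sigma_2^2}\right)}, \] then $P_{\mathbf{X}_{\mathsf{R}}}$ is optimal.
   Context: Vector Gaussian wiretap channel: $\mathbf{Y}_1=\mathbf{X}+\mathbf{N}_1$, $\mathbf{Y}_2=\mathbf{X}+\mathbf{N}_2$, $\mathbf{N}_1\sim\mathcal{N}(\mathbf{0}_n,\sigma_1^2\mathbf{I}_n)$, $\mathbf{N}_2\sim\mathcal{N}(\mathbf{0}_n,\sigma_2^2\mathbf{I}_n)$, mutually independent with $\mathbf{X}\in\mathbb{R}^n$. $C_s(\sigma_1^2,\sigma_2^2,\mathsf{R},n)=\max I(\mathbf{X};\mathbf{Y}_1)-I(\mathbf{X};\mathbf{Y}_2)$ over distributions of $\mathbf{X}$ supported in $\{\|\mathbf{x}\|\le\mathsf{R}\}$. $P_{\mathbf{X}_{\mathsf{R}}}$ is the uniform distribution on $\{\|\mathbf{x}\|=\mathsf{R}\}$. For an input distribution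 $P_{\mathbf{X}}$ with induced output densities $f_{\mathbf{Y}_1},f_{\mathbf{Y}_2}$, the secrecy-density is $\Xi(\mathbf{x};P_{\mathbf{X}})=\mathsf{D}(f_{\mathbf{Y}_1|\mathbf{X}}(\cdot|\mathbf{x})\|f_{\mathbf{Y}_1})-\mathsf{D}(f_{\mathbf{Y}_2|\mathbf{X}}(\cdot|\mathbf{x})\|f_{\mathbf{Y}_2})$, where $\mathsf{D}$ is relative entropy and $f_{\mathbf{Y}_i|\mathbf{X}}(\cdot|\mathbf{x})$ is the $\mathcal{N}(\mathbf{x},\sigma_i^2\mathbf{I}_n)$ density. $\mathsf{h}_v(x)=\mathsf{I}_v(x)/\mathsf{I}_{v-1}(x)$ with $\mathsf{I}_v$ the modified Bessel function of the first kind. Assumption (A): for all $\mathsf{R}\ge0$, $0\le\sigma_1\le\sigma_2$, $n\in\mathbb{N}$, the function $y\mapsto \frac{1}{\sigma_2^2}\mathbb{E}\left[\frac{\mathsf{R}}{\|y\mathbf{e}_1+\mathbf{W}\|}\mathsf{h}_{\frac{n}{2}}\left(\frac{\mathsf{R}}{\sigma_2^2}\|y\mathbf{e}_1+\mathbf{W}\|\right)-1\right]-\frac{1}{\sigma_1^2}\left(\frac{\mathsf{R}}{y}\mathsf{h}_{\frac{n}{2}}\left(\frac{\mathsf{R}}{\sigma_1^2}y\right)-1\right)$ has at most one sign change on $y>0$ (a function has at most one sign change if no sequence $y_1<\dots<y_m$ yields more than one sign change in $(\xi(y_i))$), where $\mathbf{W}\sim\mathcal{N}(\mathbf{0}_{n+2},(\sigma_2^2-\sigma_1^2)\mathbf{I}_{n+2})$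 and $\mathbf{e}_1$ is the first unit vector of $\mathbb{R}^{n+2}$. *)

theory Defs
  imports "HOL-Probability.Probability"
begin

text \<open>Vectors of \<open>R^n\<close> are represented as functions \<open>nat \<Rightarrow> real\<close>; only the
  coordinates \<open>i < n\<close> matter. The ambient measure is Lebesgue measure on \<open>R^n\<close>.\<close>

definition lborel_n :: "nat \<Rightarrow> (nat \<Rightarrow> real) measure" where
  "lborel_n n = PiM {..<n} (\<lambda>_. lborel)"

definition vnorm :: "nat \<Rightarrow> (nat \<Rightarrow> real) \<Rightarrow> real" where
  "vnorm n x = sqrt (\<Sum>i<n. (x i)\<^sup>2)"

text \<open>Density of \<open>N(m, s I_n)\<close> at \<open>y\<close> (here \<open>s\<close> is the variance \<open>\<sigma>^2\<close>).\<close>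
definition gauss :: "nat \<Rightarrow> real \<Rightarrow> (nat \<Rightarrow> real) \<Rightarrow> (nat \<Rightarrow> real) \<Rightarrow> real" where
  "gauss n s m y = (2 * pi * s) powr (- real n / 2) * exp (- (vnorm n (\<lambda>i. y i - m i))\<^sup>2 / (2 * s))"

definition out_dens :: "nat \<Rightarrow> real \<Rightarrow> (nat \<Rightarrow> real) measure \<Rightarrow> (nat \<Rightarrow> real) \<Rightarrow> real" where
  "out_dens n s P y = (\<integral>x. gauss n s x y \<partial>P)"

definition rel_ent :: "nat \<Rightarrow> ((nat \<Rightarrow> real) \<Rightarrow> real) \<Rightarrow> ((nat \<Rightarrow> real) \<Rightarrow> real) \<Rightarrow> real" where
  "rel_ent n f g = (\<integral>y. f y * ln (f y / g y) \<partial>lborel_n n)"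

text \<open>Mutual information \<open>I(X;Y)\<close>, \<open>Y = X + N\<close>, \<open>N \<sim> N(0, s I_n)\<close>, \<open>X \<sim> P\<close>:
  \<open>I(X;Y) = E_P[ D(f_{Y|X}(.|X) || f_Y) ]\<close>.\<close>
definition mutual_inf :: "nat \<Rightarrow> real \<Rightarrow> (nat \<Rightarrow> real) measure \<Rightarrow> real" where
  "mutual_inf n s P = (\<integral>x. rel_ent n (gauss n s x) (out_dens n s P) \<partial>P)"

definition secrecy_rate :: "nat \<Rightarrow> real \<Rightarrow> real \<Rightarrow> (nat \<Rightarrow> real) measure \<Rightarrow> real" where
  "secrecy_rate n s1 s2 P = mutual_inf n s1 P - mutual_inf n s2 P"

definition secrecy_density ::
  "nat \<Rightarrow> real \<Rightarrow> real \<Rightarrow> (nat \<Rightarrow> real) measure \<Rightarrow> (nat \<Rightarrow> real) \<Rightarrow> real" where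
  "secrecy_density n s1 s2 P x =
     rel_ent n (gauss n s1 x) (out_dens n s1 P) - rel_ent n (gauss n s2 x) (out_dens n s2 P)"

definition admissible :: "nat \<Rightarrow> real \<Rightarrow> (nat \<Rightarrow> real) measure \<Rightarrow> bool" where
  "admissible n R P \<longleftrightarrow> prob_space P \<and> sets P = sets (lborel_n n) \<and>
     (AE x in P. vnorm n x \<le> R)"

definition optimal :: "nat \<Rightarrow> real \<Rightarrow> real \<Rightarrow> real \<Rightarrow> (nat \<Rightarrow> real) measure \<Rightarrow> bool" where
  "optimal n s1 s2 R P \<longleftrightarrow> admissible n R P \<and>
     (\<forall>Q. admissible n R Q \<longrightarrow> secrecy_rate n s1 s2 Q \<le> secrecy_rate n s1 s2 P)"

definition secrecy_capacity :: "nat \<Rightarrow> real \<Rightarrow> real \<Rightarrow> real \<Rightarrow> real" where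
  "secrecy_capacity n s1 s2 R = (SUP P\<in>{P. admissible n R P}. secrecy_rate n s1 s2 P)"

text \<open>Uniform (rotation-invariant) distribution on the sphere of radius R: the
  radial projection of the uniform distribution on the unit ball.\<close>
definition unif_sphere :: "nat \<Rightarrow> real \<Rightarrow> (nat \<Rightarrow> real) measure" where
  "unif_sphere n R =
     distr (uniform_measure (lborel_n n) {x \<in> space (lborel_n n). vnorm n x \<le> 1})
           (lborel_n n) (\<lambda>x. restrict (\<lambda>i. R * x i / vnorm n x) {..<n})"

text \<open>Modified Bessel function of the first kind (real order v, argument x \<ge> 0).\<close>
definition rpow :: "real \<Rightarrow> real \<Rightarrow> real" where
  "rpow x a = (if a = 0 then 1 else x powr a)"

definition besselI :: "real \<Rightarrow> real \<Rightarrow> real" where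
  "besselI v x = (\<Sum>k. (x / 2) ^ (2 * k) * rpow (x / 2) v / (fact k * Gamma (real k + v + 1)))"

definition hb :: "real \<Rightarrow> real \<Rightarrow> real" where
  "hb v x = besselI v x / besselI (v - 1) x"

fun sc_aux :: "real list \<Rightarrow> nat" where
  "sc_aux (a # b # xs) = (if a * b < 0 then 1 else 0) + sc_aux (b # xs)"
| "sc_aux _ = 0"

definition sign_changes :: "real list \<Rightarrow> nat" where
  "sign_changes xs = sc_aux (filter (\<lambda>a. a \<noteq> 0) xs)"

definition at_most_one_sign_change :: "(real \<Rightarrow> real) \<Rightarrow> real set \<Rightarrow> bool" where
  "at_most_one_sign_change f S \<longleftrightarrow>
     (\<forall>ys. sorted_wrt (<) ys \<and> set ys \<subseteq> S \<longrightarrow> sign_changes (map f ys) \<le> 1)"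

text \<open>Standard Gaussian on \<open>R^m\<close>; \<open>W \<sim> N(0, t I_m)\<close> is realised as \<open>sqrt t \<cdot> Z\<close>.\<close>
definition std_gauss_n :: "nat \<Rightarrow> (nat \<Rightarrow> real) measure" where
  "std_gauss_n m = PiM {..<m} (\<lambda>_. density lborel std_normal_density)"

text \<open>The function \<open>\<xi>\<close> of Assumption (A); \<open>\<sigma>1, \<sigma>2\<close> are standard deviations.\<close>
definition xiA :: "nat \<Rightarrow> real \<Rightarrow> real \<Rightarrow> real \<Rightarrow> real \<Rightarrow> real" where
  "xiA n R \<sigma>1 \<sigma>2 y =
     1 / \<sigma>2\<^sup>2 * (\<integral>z. (let w = vnorm (n + 2) (\<lambda>i. (if i = 0 then y else 0)
                                              + sqrt (\<sigma>2\<^sup>2 - \<sigma>1\<^sup>2) * z i)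
                      in R / w * hb (real n / 2) (R / \<sigma>2\<^sup>2 * w) - 1) \<partial>std_gauss_n (n + 2))
     - 1 / \<sigma>1\<^sup>2 * (R / y * hb (real n / 2) (R / \<sigma>1\<^sup>2 * y) - 1)"

definition assumptionA :: bool where
  "assumptionA \<longleftrightarrow> (\<forall>R \<sigma>1 \<sigma>2 (n::nat). 0 \<le> R \<and> 0 < \<sigma>1 \<and> \<sigma>1 \<le> \<sigma>2 \<and> 1 \<le> n \<longrightarrow>
      at_most_one_sign_change (xiA n R \<sigma>1 \<sigma>2) {0<..})"

end

theory Submission
  imports Defs
begin

text \<open>Write \<open>P\<close> for the uniform input on the sphere of radius \<open>R\<close>. For any other input \<open>Q\<close>, the rate of \<open>Q\<close> is the
  mean of the secrecy density \<open>\<Xi>(\<cdot>; P)\<close> under \<open>Q\<close> minus \<open>D(q\<^sub>1 | p\<^sub>1) - D(q\<^sub>2 | p\<^sub>2)\<close>, where \<open>q\<^sub>i, p\<^sub>i\<close> are the output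
  densities. The latter difference is nonnegative by data processing, so \<open>P\<close> is optimal as soon as \<open>\<Xi>(\<cdot>; P)\<close> is maximal on the
  sphere; conversely, shifting mass \<open>t\<close> to the origin costs only \<open>O(t\<^sup>2)\<close> in divergence, so optimality forces
  \<open>\<Xi>(0; P) \<le> \<Xi>(x; P)\<close> for \<open>x\<close> on the sphere.

  Since \<open>P\<close> is rotation invariant, \<open>\<Xi>(x; P)\<close> depends on \<open>\<rho> = norm x\<close> only, and its derivative in \<open>\<rho>\<close> is
  \<open>\<rho> E[\<xi>(norm (\<rho> e\<^sub>1 + W))]\<close> with \<open>\<xi>\<close> the function of Assumption (A) and \<open>W\<close> Gaussian in \<open>n + 2\<close> dimensions. The noncentral chi
  densities have monotone likelihood ratio in \<open>\<rho>\<close>, so if \<open>\<xi>\<close> changes sign at most once (necessarily from \<open>-\<close> to \<open>+\<close>, as \<open>\<xi> > 0\<close>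
  near infinity), so does the derivative, and the maximum over the ball is attained at \<open>0\<close> or on the sphere.
  For small \<open>R\<close> one has \<open>\<xi> \<ge> 0\<close> outright.\<close>

section \<open>Gaussian measures on R^n\<close>

text \<open>Vectors are coordinate functions under a product measure, so rotations are awkward, and
  rotation invariance is never proved. The spherical law is only seen through means of exp(<y,u>),
  computed from moments by evaluating Gaussian integrals both in coordinates and in polar form; the
  result depends on y through its norm alone. The Bessel ratio is expressed by the entire function
  0F1 at z^2/4, which is smooth at the origin and whose derivative raises the dimension by 2. This
  is the source of the dimension n + 2 in Assumption (A). Two different vectors W occur: the one
  inside Assumption (A) has variance \<open>s2 - s1\<close>, the one in the overview has variance
  \<open>s1\<close>. Chained together they give variance \<open>s2\<close>, so the contributions of
  both channels to the slope become averages under one law, which a sign-change argument requires.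
  Slopes are used in integrated form (fundamental theorem along Gaussian paths, then Fubini), so
  nothing is differentiated under an integral sign. Integrability rests on one class of functions,
  those bounded by A + B |y|^2; it contains all logarithms of output densities because inputs live
  in a ball.\<close>

interpretation lborel_prod: product_sigma_finite "\<lambda>_::nat. lborel :: real measure"
  by standard

abbreviation scaled :: "nat \<Rightarrow> real \<Rightarrow> (nat \<Rightarrow> real) \<Rightarrow> nat \<Rightarrow> real" where
  "scaled n c x \<equiv> restrict (\<lambda>i. c * x i) {..<n}"

abbreviation projected :: "nat \<Rightarrow> real \<Rightarrow> (nat \<Rightarrow> real) \<Rightarrow> nat \<Rightarrow> real" where
  "projected n c x \<equiv> restrict (\<lambda>i. c * x i / vnorm n x) {..<n}"

abbreviation gconst :: "nat \<Rightarrow> real \<Rightarrow> real" where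
  "gconst n s \<equiv> (2 * pi * s) powr (- real n / 2)"

abbreviation usphere :: "nat \<Rightarrow> (nat \<Rightarrow> real) measure" where
  "usphere n \<equiv> unif_sphere n 1"

lemma space_lborel_n: "space (lborel_n n) = extensional {..<n}"
  by (simp add: lborel_n_def space_PiM PiE_UNIV_domain PiE_def)

lemma sigma_finite_lborel_n: "sigma_finite_measure (lborel_n n)"
  unfolding lborel_n_def by (rule lborel_prod.sigma_finite) simp

lemma sets_lborel_n [measurable_cong]: "sets (lborel_n n) = sets (PiM {..<n} (\<lambda>_. borel))"
  unfolding lborel_n_def by (intro sets_PiM_cong) auto

lemma lborel_n_component: "i < n \<Longrightarrow> (\<lambda>x. x i) \<in> borel_measurable (lborel_n n)"
  unfolding lborel_n_def
  by (rule measurable_compose[OF measurable_component_singleton]) auto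

lemma borel_measurable_vnorm [measurable]: "vnorm n \<in> borel_measurable (lborel_n n)"
  unfolding vnorm_def by measurable

lemma restrict_measurable_lborel_n:
  assumes "\<And>i. i < n \<Longrightarrow> (\<lambda>x. f x i) \<in> borel_measurable M"
  shows "(\<lambda>x. restrict (f x) {..<n}) \<in> measurable M (lborel_n n)"
  unfolding lborel_n_def by (rule measurable_restrict) (use assms in auto)

section \<open>Norm and inner product in coordinates\<close>

definition ip :: "nat \<Rightarrow> (nat \<Rightarrow> real) \<Rightarrow> (nat \<Rightarrow> real) \<Rightarrow> real" where
  "ip n x y = (\<Sum>i<n. x i * y i)"

lemma vnorm_nonneg [simp]: "0 \<le> vnorm n x"
  by (simp add: vnorm_def sum_nonneg)

lemma vnorm_power2: "(vnorm n x)\<^sup>2 = (\<Sum>i<n. (x i)\<^sup>2)"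
  by (simp add: vnorm_def sum_nonneg)

text \<open>Follows from 2 r <= 1 + r^2. It moves functions of linear growth, such as
  \<open>logF\<close>, into the class of quadratic growth for which Gaussian integrability is
  settled once.\<close>

lemma vnorm_le_quad: "vnorm n y \<le> 1 + (vnorm n y)\<^sup>2"
proof -
  have "0 \<le> (vnorm n y - 1)\<^sup>2" by simp
  then have "2 * vnorm n y \<le> 1 + (vnorm n y)\<^sup>2" unfolding power2_diff by simp
  then show ?thesis using vnorm_nonneg[of n y] by linarith
qed

lemma vnorm_restrict [simp]: "vnorm n (restrict f {..<n}) = vnorm n f"
  by (simp add: vnorm_def)

lemma vnorm_scale: "vnorm n (\<lambda>i. c * x i) = \<bar>c\<bar> * vnorm n x"
  by (simp add: vnorm_def power_mult_distrib sum_distrib_left[symmetric] real_sqrt_mult)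

lemma vnorm_diff_power2: "(vnorm n (\<lambda>i. y i - x i))\<^sup>2 = (vnorm n y)\<^sup>2 - 2 * ip n x y + (vnorm n x)\<^sup>2"
  by (simp add: vnorm_power2 ip_def power2_diff sum.distrib sum_subtractf sum_distrib_left algebra_simps)

lemma ip_bound: "\<bar>ip n x y\<bar> \<le> vnorm n x * vnorm n y"
proof -
  have "(ip n x y)\<^sup>2 \<le> (vnorm n x * vnorm n y)\<^sup>2"
    unfolding ip_def power_mult_distrib vnorm_power2 by (rule Cauchy_Schwarz_ineq_sum)
  then show ?thesis by (simp add: abs_le_square_iff[symmetric] abs_mult)
qed

lemma component_le_vnorm: "i < n \<Longrightarrow> \<bar>x i\<bar> \<le> vnorm n x"
proof -
  assume "i < n"
  then have "(x i)\<^sup>2 \<le> (vnorm n x)\<^sup>2"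
    unfolding vnorm_power2 by (intro member_le_sum) auto
  then show ?thesis by (simp add: abs_le_square_iff[symmetric])
qed

lemma ip_restrict [simp]: "ip n (restrict f {..<n}) y = ip n f y" "ip n x (restrict f {..<n}) = ip n x f"
  by (simp_all add: ip_def)

lemma vnorm_zero [simp]: "vnorm n (\<lambda>_. 0) = 0" and ip_zero [simp]: "ip n (\<lambda>_. 0) y = 0"
  by (simp_all add: vnorm_def ip_def)

section \<open>Gaussian laws as densities, products and affine images\<close>

lemma gauss_alt:
  "gauss n s x y = gconst n s
     * exp (- ((vnorm n y)\<^sup>2 - 2 * ip n x y + (vnorm n x)\<^sup>2) / (2 * s))"
  unfolding gauss_def vnorm_diff_power2 by simp

lemma gauss_eq_prod:
  assumes "0 < s"
  shows "gauss n s x y = (\<Prod>i<n. normal_density (x i) (sqrt s) (y i))"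
proof -
  have a: "gconst n s = (1 / sqrt (2 * pi * s)) ^ n"
  proof -
    have "(1 / sqrt (2 * pi * s)) ^ n = ((2 * pi * s) powr (-1/2)) ^ n"
      using assms by (simp add: powr_minus powr_half_sqrt field_simps)
    also have "\<dots> = gconst n s"
      using assms by (simp add: powr_powr powr_realpow[symmetric])
    finally show ?thesis by simp
  qed
  have "(\<Prod>i<n. exp (- (y i - x i)\<^sup>2 / (2 * s))) = exp (- (vnorm n (\<lambda>i. y i - x i))\<^sup>2 / (2 * s))"
    by (simp add: exp_sum[symmetric] vnorm_power2 sum_divide_distrib[symmetric] sum_negf)
  moreover have "(\<Prod>i<n. normal_density (x i) (sqrt s) (y i))
    = (1 / sqrt (2 * pi * s)) ^ n * (\<Prod>i<n. exp (- (y i - x i)\<^sup>2 / (2 * s)))"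
    using assms by (simp add: normal_density_def prod.distrib power_divide prod_dividef)
  ultimately show ?thesis unfolding gauss_def a by simp
qed

lemma gauss_nonneg [simp]: "0 \<le> gauss n s x y"
  by (simp add: gauss_def)

lemma gauss_pos: "0 < s \<Longrightarrow> 0 < gauss n s x y"
  by (simp add: gauss_def)

lemma gauss_le: "0 < s \<Longrightarrow> gauss n s x y \<le> gconst n s"
  by (simp add: gauss_def mult_le_cancel_left1)

lemma gauss_measurable2 [measurable]:
  assumes [measurable]: "\<And>i. i < n \<Longrightarrow> (\<lambda>w. f w i) \<in> borel_measurable M"
     "\<And>i. i < n \<Longrightarrow> (\<lambda>w. g w i) \<in> borel_measurable M"
  shows "(\<lambda>w. gauss n s (f w) (g w)) \<in> borel_measurable M"
  unfolding gauss_def vnorm_def by measurable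

lemma gauss_measurable [measurable]: "gauss n s x \<in> borel_measurable (lborel_n n)"
  by measurable

text \<open>The law \<open>N(x, s I_n)\<close>, with \<open>s\<close> the variance. It is kept as a
  density so that integrals weighted by \<open>gauss\<close> become means;
  \<open>gmeas_eq_PiM\<close> supplies the independent coordinates.\<close>

definition gmeas :: "nat \<Rightarrow> real \<Rightarrow> (nat \<Rightarrow> real) \<Rightarrow> (nat \<Rightarrow> real) measure" where
  "gmeas n s x = density (lborel_n n) (\<lambda>y. ennreal (gauss n s x y))"

lemma sets_gmeas [simp, measurable_cong]: "sets (gmeas n s x) = sets (lborel_n n)"
  and space_gmeas [simp]: "space (gmeas n s x) = space (lborel_n n)"
  by (simp_all add: gmeas_def)

lemma gmeas_eq_PiM:
  assumes "0 < s"
  shows "gmeas n s x = PiM {..<n} (\<lambda>i. density lborel (normal_density (x i) (sqrt s)))"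
proof (rule product_sigma_finite.PiM_eqI)
  show "product_sigma_finite (\<lambda>i. density lborel (\<lambda>y. ennreal (normal_density (x i) (sqrt s) y)))"
    using assms by (auto simp: product_sigma_finite_def intro!: prob_space_normal_density prob_space_imp_sigma_finite)
  show "sets (gmeas n s x) = sets (PiM {..<n} (\<lambda>i. density lborel (normal_density (x i) (sqrt s))))"
    unfolding sets_gmeas lborel_n_def by (intro sets_PiM_cong) auto
  fix A :: "nat \<Rightarrow> real set" 
  assume A: "\<And>i. i \<in> {..<n} \<Longrightarrow> A i \<in> sets (density lborel (\<lambda>y. ennreal (normal_density (x i) (sqrt s) y)))"
  then have A' [measurable]: "\<And>i. i < n \<Longrightarrow> A i \<in> sets borel" by auto
  have [measurable]: "PiE {..<n} A \<in> sets (lborel_n n)"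
    unfolding lborel_n_def using A' by (intro sets_PiM_I_finite) auto
  have "emeasure (gmeas n s x) (PiE {..<n} A)
    = (\<integral>\<^sup>+y. ennreal (gauss n s x y) * indicator (PiE {..<n} A) y \<partial>lborel_n n)"
    unfolding gmeas_def by (subst emeasure_density) auto
  also have "\<dots> = (\<integral>\<^sup>+y. (\<Prod>i<n. ennreal (normal_density (x i) (sqrt s) (y i)) * indicator (A i) (y i)) \<partial>lborel_n n)"
  proof (rule nn_integral_cong)
    fix y assume "y \<in> space (lborel_n n)"
    then have "indicator (PiE {..<n} A) y = (\<Prod>i<n. indicator (A i) (y i) :: ennreal)"
      by (auto simp: indicator_def space_lborel_n PiE_def Pi_def)
    then show "ennreal (gauss n s x y) * indicator (PiE {..<n} A) y =
      (\<Prod>i<n. ennreal (normal_density (x i) (sqrt s) (y i)) * indicator (A i) (y i))"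
      by (simp add: gauss_eq_prod[OF assms] prod.distrib prod_ennreal)
  qed
  also have "\<dots> = (\<Prod>i<n. \<integral>\<^sup>+y. ennreal (normal_density (x i) (sqrt s) y) * indicator (A i) y \<partial>lborel)"
    unfolding lborel_n_def by (rule lborel_prod.product_nn_integral_prod) auto
  also have "\<dots> = (\<Prod>i<n. emeasure (density lborel (\<lambda>y. ennreal (normal_density (x i) (sqrt s) y))) (A i))"
    by (intro prod.cong refl emeasure_density[symmetric]) auto
  finally show "emeasure (gmeas n s x) (PiE {..<n} A) =
    (\<Prod>i<n. emeasure (density lborel (\<lambda>y. ennreal (normal_density (x i) (sqrt s) y))) (A i))" .
qed simp

lemma prob_space_gmeas: "0 < s \<Longrightarrow> prob_space (gmeas n s x)"
  unfolding gmeas_eq_PiM by (intro prob_space_PiM prob_space_normal_density) auto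

lemma nn_integral_gauss: "0 < s \<Longrightarrow> (\<integral>\<^sup>+y. ennreal (gauss n s x y) \<partial>lborel_n n) = 1"
  using prob_space.emeasure_space_1[OF prob_space_gmeas[of s n x]]
  by (simp add: gmeas_def emeasure_density cong: nn_integral_cong)

lemma std_gauss_n_eq: "std_gauss_n n = gmeas n 1 (\<lambda>_. 0)"
  by (simp add: std_gauss_n_def gmeas_eq_PiM)

lemma prob_space_std_gauss_n: "prob_space (std_gauss_n n)"
  by (simp add: std_gauss_n_eq prob_space_gmeas)

lemma sets_std_gauss_n [simp, measurable_cong]: "sets (std_gauss_n n) = sets (lborel_n n)"
  by (simp add: std_gauss_n_eq)

lemma distr_std_normal_affine:
  assumes "0 < \<sigma>"
  shows "distr (density lborel std_normal_density) borel (\<lambda>z. m + \<sigma> * z) = density lborel (normal_density m \<sigma>)"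
proof -
  interpret prob_space "density lborel std_normal_density" by (rule prob_space_normal_density) simp
  have "distributed (density lborel std_normal_density) lborel (\<lambda>x. x) std_normal_density"
    unfolding distributed_def by (auto simp: distr_id2)
  from normal_density_affine[OF this, of \<sigma> m] assms
  have "distr (density lborel std_normal_density) lborel (\<lambda>z. m + \<sigma> * z) = density lborel (normal_density m \<sigma>)"
    by (simp add: distributed_def)
  moreover have "distr (density lborel std_normal_density) lborel (\<lambda>z. m + \<sigma> * z) = distr (density lborel std_normal_density) borel (\<lambda>z. m + \<sigma> * z)"
    by (rule distr_cong) auto
  ultimately show ?thesis by simp
qed

text \<open>Puts all laws \<open>N(x, s I_n)\<close> on the probability space of one standard
  Gaussian. This coupling lets the centre move along a path with the noise held fixed, and it is the
  form in which \<open>xiA\<close> is written.\<close>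

lemma gmeas_affine:
  assumes "0 < s"
  shows "distr (std_gauss_n n) (lborel_n n) (\<lambda>z. restrict (\<lambda>i. x i + sqrt s * z i) {..<n}) = gmeas n s x"
  unfolding gmeas_eq_PiM[OF assms]
proof (rule product_sigma_finite.PiM_eqI)
  let ?N = "\<lambda>i. density lborel (\<lambda>y. ennreal (normal_density (x i) (sqrt s) y))"
  let ?S = "density lborel (\<lambda>y. ennreal (std_normal_density y))"
  show "product_sigma_finite ?N"
    using assms by (auto simp: product_sigma_finite_def intro!: prob_space_normal_density prob_space_imp_sigma_finite)
  interpret S: product_sigma_finite "\<lambda>_::nat. ?S"
    by (auto simp: product_sigma_finite_def intro!: prob_space_normal_density prob_space_imp_sigma_finite)
  let ?T = "\<lambda>z. restrict (\<lambda>i. x i + sqrt s * z i) {..<n}"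
  show "sets (distr (std_gauss_n n) (lborel_n n) ?T) = sets (PiM {..<n} ?N)"
    unfolding sets_distr lborel_n_def by (intro sets_PiM_cong) auto
  have T [measurable]: "?T \<in> measurable (std_gauss_n n) (lborel_n n)"
    by (rule restrict_measurable_lborel_n) measurable
  fix A :: "nat \<Rightarrow> real set" 
  assume A: "\<And>i. i \<in> {..<n} \<Longrightarrow> A i \<in> sets (?N i)"
  then have A' [measurable]: "\<And>i. i < n \<Longrightarrow> A i \<in> sets borel" by auto
  have PA: "PiE {..<n} A \<in> sets (lborel_n n)"
    unfolding lborel_n_def using A' by (intro sets_PiM_I_finite) auto
  have *: "?T -` PiE {..<n} A \<inter> space (std_gauss_n n) = PiE {..<n} (\<lambda>i. (\<lambda>z. x i + sqrt s * z) -` A i)"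
    by (auto simp: std_gauss_n_def space_PiM PiE_def Pi_def)
  have B: "(\<lambda>z. x i + sqrt s * z) -` A i \<in> sets borel" if "i < n" for i
    using measurable_sets[OF _ A'[OF that], of "\<lambda>z. x i + sqrt s * z" borel] by simp
  have "emeasure (distr (std_gauss_n n) (lborel_n n) ?T) (PiE {..<n} A)
     = emeasure (std_gauss_n n) (PiE {..<n} (\<lambda>i. (\<lambda>z. x i + sqrt s * z) -` A i))"
    by (simp add: emeasure_distr[OF T PA] *)
  also have "\<dots> = (\<Prod>i<n. emeasure ?S ((\<lambda>z. x i + sqrt s * z) -` A i))"
    unfolding std_gauss_n_def using B by (subst S.emeasure_PiM) auto
  also have "\<dots> = (\<Prod>i<n. emeasure (?N i) (A i))"
  proof (intro prod.cong refl)
    fix i assume i: "i \<in> {..<n}"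
    have "emeasure (?N i) (A i) = emeasure (distr ?S borel (\<lambda>z. x i + sqrt s * z)) (A i)"
      using assms by (subst distr_std_normal_affine) auto
    also have "\<dots> = emeasure ?S ((\<lambda>z. x i + sqrt s * z) -` A i)"
      using A' i by (subst emeasure_distr) auto
    finally show "emeasure ?S ((\<lambda>z. x i + sqrt s * z) -` A i) = emeasure (?N i) (A i)" by simp
  qed
  finally show "emeasure (distr (std_gauss_n n) (lborel_n n) ?T) (PiE {..<n} A) = (\<Prod>i\<in>{..<n}. emeasure (?N i) (A i))" .
qed simp

text \<open>The Jacobian of a dilation, obtained on boxes from the one-dimensional substitution. It
  is the change of variables in the full space on which polar coordinates rest.\<close>

lemma lborel_n_scale:
  fixes c :: real
  assumes "0 < c"
  shows "lborel_n n = density (distr (lborel_n n) (lborel_n n) (\<lambda>z. scaled n c z)) (\<lambda>_. ennreal (c ^ n))"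
proof -
  let ?T = "\<lambda>z. scaled n c z"
  have T [measurable]: "?T \<in> measurable (lborel_n n) (lborel_n n)"
    by (rule restrict_measurable_lborel_n) measurable
  have "density (distr (lborel_n n) (lborel_n n) ?T) (\<lambda>_. ennreal (c ^ n)) = PiM {..<n} (\<lambda>_. lborel)"
  proof (rule lborel_prod.PiM_eqI)
    show "sets (density (distr (lborel_n n) (lborel_n n) ?T) (\<lambda>_. ennreal (c ^ n))) = sets (PiM {..<n} (\<lambda>_. lborel))"
      by (simp add: lborel_n_def)
    fix A :: "nat \<Rightarrow> real set" 
    assume "\<And>i. i \<in> {..<n} \<Longrightarrow> A i \<in> sets lborel"
    then have A' [measurable]: "\<And>i. i < n \<Longrightarrow> A i \<in> sets borel" by auto
    have PA: "PiE {..<n} A \<in> sets (lborel_n n)"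
      unfolding lborel_n_def using A' by (intro sets_PiM_I_finite) auto
    have *: "?T -` PiE {..<n} A \<inter> space (lborel_n n) = PiE {..<n} (\<lambda>i. (\<lambda>z. c * z) -` A i)"
      by (auto simp: lborel_n_def space_PiM PiE_def Pi_def)
    have B: "(\<lambda>z. c * z) -` A i \<in> sets borel" if "i < n" for i
      using measurable_sets[OF _ A'[OF that], of "\<lambda>z. c * z" borel] by simp
    have "emeasure (density (distr (lborel_n n) (lborel_n n) ?T) (\<lambda>_. ennreal (c ^ n))) (PiE {..<n} A)
      = ennreal (c ^ n) * emeasure (lborel_n n) (PiE {..<n} (\<lambda>i. (\<lambda>z. c * z) -` A i))"
      by (subst emeasure_density_const) (simp_all add: PA emeasure_distr[OF T PA] *)
    also have "\<dots> = (\<Prod>i<n. ennreal c * emeasure lborel ((\<lambda>z. c * z) -` A i))"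
      unfolding lborel_n_def using B assms
      by (subst lborel_prod.emeasure_PiM) (auto simp: prod.distrib ennreal_power)
    also have "\<dots> = (\<Prod>i<n. emeasure lborel (A i))"
    proof (intro prod.cong refl)
      fix i assume i: "i \<in> {..<n}"
      have "emeasure lborel (A i) = emeasure (density (distr lborel borel (\<lambda>x. 0 + c * x)) (\<lambda>_. ennreal \<bar>c\<bar>)) (A i)"
        using assms by (subst lborel_real_affine[of c 0]) auto
      also have "\<dots> = ennreal c * emeasure lborel ((\<lambda>z. c * z) -` A i)"
        using A' i assms by (subst emeasure_density_const) (auto simp: emeasure_distr)
      finally show "ennreal c * emeasure lborel ((\<lambda>z. c * z) -` A i) = emeasure lborel (A i)" by simp
    qed
    finally show "emeasure (density (distr (lborel_n n) (lborel_n n) ?T) (\<lambda>_. ennreal (c ^ n))) (PiE {..<n} A)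
      = (\<Prod>i\<in>{..<n}. emeasure lborel (A i))" .
  qed simp
  then show ?thesis by (simp add: lborel_n_def)
qed

lemma nn_integral_lborel_n_scale:
  fixes c :: real
  assumes "0 < c" and f [measurable]: "f \<in> borel_measurable (lborel_n n)"
  shows "(\<integral>\<^sup>+z. f z \<partial>lborel_n n) = ennreal (c ^ n) * (\<integral>\<^sup>+z. f (scaled n c z) \<partial>lborel_n n)"
proof -
  let ?T = "\<lambda>z. scaled n c z"
  have T [measurable]: "?T \<in> measurable (lborel_n n) (lborel_n n)"
    by (rule restrict_measurable_lborel_n) measurable
  show ?thesis
    by (subst lborel_n_scale[OF assms(1)])
       (simp add: nn_integral_density nn_integral_distr nn_integral_cmult)
qed

text \<open>Both sides factorise over coordinates, which leaves the convolution of two centred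
  one-dimensional normals. This is the degradation of the second channel with respect to the
  first.\<close>

lemma gauss_convolution:
  assumes "0 < s" "0 < t"
  shows "(\<integral>\<^sup>+z. ennreal (gauss n s x z * gauss n t z y) \<partial>lborel_n n) = ennreal (gauss n (s + t) x y)"
proof -
  have one: "(\<integral>\<^sup>+z. ennreal (normal_density a (sqrt s) z * normal_density z (sqrt t) b) \<partial>lborel)
      = ennreal (normal_density a (sqrt (s + t)) b)" for a b
  proof -
    have "(\<integral>\<^sup>+z. ennreal (normal_density a (sqrt s) z * normal_density z (sqrt t) b) \<partial>lborel)
      = (\<integral>\<^sup>+z. ennreal (normal_density a (sqrt s) (a + 1 * z) * normal_density (a + 1 * z) (sqrt t) b) \<partial>lborel)"
      by (subst nn_integral_real_affine[where c=1 and t=a]) (auto simp: normal_density_def)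
    also have "\<dots> = (\<integral>\<^sup>+z. ennreal (normal_density 0 (sqrt t) ((b - a) - z) * normal_density 0 (sqrt s) z) \<partial>lborel)"
      by (intro nn_integral_cong) (simp add: normal_density_def algebra_simps)
    also have "\<dots> = ennreal (normal_density 0 (sqrt (t + s)) (b - a))"
      using fun_cong[OF conv_normal_density_zero_mean[of "sqrt t" "sqrt s"], of "b - a"] assms by simp
    also have "\<dots> = ennreal (normal_density a (sqrt (s + t)) b)"
      by (simp add: normal_density_def algebra_simps)
    finally show ?thesis .
  qed
  have "(\<integral>\<^sup>+z. ennreal (gauss n s x z * gauss n t z y) \<partial>lborel_n n)
    = (\<integral>\<^sup>+z. (\<Prod>i<n. ennreal (normal_density (x i) (sqrt s) (z i) * normal_density (z i) (sqrt t) (y i))) \<partial>lborel_n n)"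
    using assms by (simp add: gauss_eq_prod prod_ennreal prod.distrib[symmetric])
  also have "\<dots> = (\<Prod>i<n. \<integral>\<^sup>+z. ennreal (normal_density (x i) (sqrt s) z * normal_density z (sqrt t) (y i)) \<partial>lborel)"
    unfolding lborel_n_def by (rule lborel_prod.product_nn_integral_prod) (auto simp: normal_density_def)
  also have "\<dots> = (\<Prod>i<n. ennreal (normal_density (x i) (sqrt (s + t)) (y i)))"
    by (simp add: one)
  also have "\<dots> = ennreal (gauss n (s + t) x y)"
    using assms by (simp add: gauss_eq_prod prod_ennreal)
  finally show ?thesis .
qed

section \<open>Polar coordinates\<close>

abbreviation unit_ball :: "nat \<Rightarrow> (nat \<Rightarrow> real) set" where
  "unit_ball n \<equiv> {x \<in> space (lborel_n n). vnorm n x \<le> 1}"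

definition ball_vol :: "nat \<Rightarrow> real" where
  "ball_vol n = measure (lborel_n n) (unit_ball n)"

lemma AE_vnorm_pos:
  assumes "1 \<le> n"
  shows "AE z in lborel_n n. 0 < vnorm n z"
proof (rule AE_I)
  show "{z \<in> space (lborel_n n). \<not> 0 < vnorm n z} \<subseteq> PiE {..<n} (\<lambda>_. {0})"
  proof
    fix z assume "z \<in> {z \<in> space (lborel_n n). \<not> 0 < vnorm n z}"
    then have z: "z \<in> space (lborel_n n)" "\<not> 0 < vnorm n z" by auto
    then have "z i = 0" if "i < n" for i
      using component_le_vnorm[OF that, of z] vnorm_nonneg[of n z] by linarith
    then show "z \<in> PiE {..<n} (\<lambda>_. {0})" using z by (intro PiE_I) (auto simp: space_lborel_n extensional_def)
  qed
  show "emeasure (lborel_n n) (PiE {..<n} (\<lambda>_. {0})) = 0"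
    unfolding lborel_n_def using assms by (subst lborel_prod.emeasure_PiM) (auto simp: power_0_left)
  show "PiE {..<n} (\<lambda>_. {0}) \<in> sets (lborel_n n)"
    unfolding lborel_n_def by (intro sets_PiM_I_finite) auto
qed

text \<open>The ball lies between the cubes of half-side 1/n and 1. Finite and positive volume is
  what the normalisation of \<open>unif_sphere\<close> requires.\<close>

lemma emeasure_unit_ball:
  assumes "1 \<le> n"
  shows "emeasure (lborel_n n) (unit_ball n) = ennreal (ball_vol n)" "0 < ball_vol n"
proof -
  have "emeasure (lborel_n n) (unit_ball n) \<le> emeasure (lborel_n n) (PiE {..<n} (\<lambda>_. {-1..1}))"
  proof (rule emeasure_mono)
    show "PiE {..<n} (\<lambda>_. {-1..1}) \<in> sets (lborel_n n)"
      unfolding lborel_n_def by (intro sets_PiM_I_finite) auto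
    show "unit_ball n \<subseteq> PiE {..<n} (\<lambda>_. {-1..1})"
    proof
      fix z assume "z \<in> unit_ball n"
      then have z: "z \<in> space (lborel_n n)" "vnorm n z \<le> 1" by auto
      then have "\<bar>z i\<bar> \<le> 1" if "i < n" for i
        using component_le_vnorm[OF that, of z] by linarith
      then show "z \<in> PiE {..<n} (\<lambda>_. {-1..1})" using z by (auto simp: PiE_iff space_lborel_n abs_le_iff)
    qed
  qed
  also have "\<dots> = ennreal (2 ^ n)"
    unfolding lborel_n_def by (subst lborel_prod.emeasure_PiM) (auto simp: ennreal_power[symmetric])
  finally have fin: "emeasure (lborel_n n) (unit_ball n) \<noteq> \<infinity>"
    by (auto simp: top_unique)
  then show eq: "emeasure (lborel_n n) (unit_ball n) = ennreal (ball_vol n)"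
    unfolding ball_vol_def by (intro emeasure_eq_ennreal_measure) auto
  have "0 < ennreal ((2 / n) ^ n)" using assms by simp
  also have "\<dots> = emeasure (lborel_n n) (PiE {..<n} (\<lambda>_. {- 1 / real n..1 / real n}))"
    unfolding lborel_n_def by (subst lborel_prod.emeasure_PiM) (auto simp: ennreal_power[symmetric])
  also have "\<dots> \<le> emeasure (lborel_n n) (unit_ball n)"
  proof (rule emeasure_mono)
    show "PiE {..<n} (\<lambda>_. {- 1 / real n..1 / real n}) \<subseteq> unit_ball n"
    proof
      fix z assume z: "z \<in> PiE {..<n} (\<lambda>_. {- 1 / real n..1 / real n})"
      have "(z i)\<^sup>2 \<le> 1 / real n" if "i < n" for i
      proof -
        have "\<bar>z i\<bar> \<le> 1 / real n" using z that by (auto simp: PiE_iff abs_le_iff minus_le_iff)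
        then have "(z i)\<^sup>2 \<le> (1 / real n)\<^sup>2" by (simp add: abs_le_square_iff[symmetric])
        also have "\<dots> \<le> 1 / real n" using assms by (simp add: power2_eq_square field_simps)
        finally show ?thesis .
      qed
      then have "(\<Sum>i<n. (z i)\<^sup>2) \<le> (\<Sum>i<n. 1 / real n)" by (intro sum_mono) auto
      then have "vnorm n z \<le> 1" using assms by (simp add: vnorm_def)
      moreover have "z \<in> space (lborel_n n)" using z by (auto simp: space_lborel_n PiE_iff)
      ultimately show "z \<in> unit_ball n" by simp
    qed
  qed measurable
  finally show "0 < ball_vol n" using eq by simp
qed

text \<open>A probability weight in an auxiliary scale t on the half-line from a. With a = |z| it
  can be inserted into an integral over z at no cost; after exchanging the order, z ranges over the
  ball of radius t for each fixed t.\<close>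

lemma radial_weight:
  assumes "1 \<le> n" "0 < a"
  shows "(\<integral>\<^sup>+t. ennreal (real n * a ^ n / t ^ (n + 1)) * indicator {a..} t \<partial>lborel) = 1"
proof -
  have "(\<integral>\<^sup>+t. ennreal (real n * a ^ n / t ^ (n + 1)) * indicator {a..} t \<partial>lborel)
     = ennreal (0 - (- (a ^ n / a ^ n)))"
  proof (rule nn_integral_FTC_atLeast[where F = "\<lambda>t. - (a ^ n / t ^ n)"])
    show "((\<lambda>t. - (a ^ n / t ^ n)) \<longlongrightarrow> 0) at_top"
      using assms tendsto_minus[OF real_tendsto_divide_at_top[OF tendsto_const filterlim_pow_at_top[OF _ filterlim_ident]], of n "a ^ n"]
      by simp
    fix t assume "a \<le> t"
    with assms have t: "0 < t" by simp
    show "((\<lambda>t. - (a ^ n / t ^ n)) has_real_derivative real n * a ^ n / t ^ (n + 1)) (at t)"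
      using t assms
      by (auto intro!: derivative_eq_intros simp: power_add[symmetric] divide_simps)
         (cases n; auto simp: algebra_simps power_add)
    show "0 \<le> real n * a ^ n / t ^ (n + 1)" using t assms by simp
  qed measurable
  with assms show ?thesis by simp
qed

text \<open>Polar coordinates in which the direction is carried by a point v of the unit ball, in
  agreement with the definition of \<open>unif_sphere\<close>. The weight of
  \<open>radial_weight\<close> is inserted, z = t v is substituted for fixed t, and the order is
  exchanged once more so that t can be rescaled for fixed v.\<close>

lemma nn_integral_polar_ball:
  assumes n: "1 \<le> n" and f [measurable]: "f \<in> borel_measurable (lborel_n n)"
  shows "(\<integral>\<^sup>+z. f z \<partial>lborel_n n) =
    (\<integral>\<^sup>+v. (\<integral>\<^sup>+r. ennreal (real n * r ^ (n - 1)) * indicator {0<..} r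
        * f (projected n r v) \<partial>lborel) * indicator (unit_ball n) v \<partial>lborel_n n)"
proof -
  interpret L: sigma_finite_measure "lborel_n n" by (rule sigma_finite_lborel_n)
  interpret P: pair_sigma_finite "lborel_n n" lborel ..
  let ?a = "\<lambda>v t. f (scaled n t v) * ennreal (real n * vnorm n v ^ n * t ^ (n - 1))
      * indicator {0<..} t * indicator (unit_ball n) v"
  let ?b = "\<lambda>v r. ennreal (real n * r ^ (n - 1)) * indicator {0<..} r * f (projected n r v)"
  let ?w = "\<lambda>z t. ennreal (if 0 < t \<and> vnorm n z \<le> t then real n * vnorm n z ^ n / t ^ (n + 1) else 0)"
  have [measurable]: "(\<lambda>(z, t). scaled n t z) \<in> measurable (lborel_n n \<Otimes>\<^sub>M lborel) (lborel_n n)"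
    unfolding case_prod_beta by (rule restrict_measurable_lborel_n) measurable
  have [measurable]: "(\<lambda>z. scaled n t z) \<in> measurable (lborel_n n) (lborel_n n)" for t
    by (rule restrict_measurable_lborel_n) measurable
  have [measurable]: "(\<lambda>t. scaled n t z) \<in> measurable borel (lborel_n n)" for z
    by (rule restrict_measurable_lborel_n) measurable
  have "(\<integral>\<^sup>+z. f z \<partial>lborel_n n) = (\<integral>\<^sup>+z. (\<integral>\<^sup>+t. f z * ?w z t \<partial>lborel) \<partial>lborel_n n)"
  proof (rule nn_integral_cong_AE, use AE_vnorm_pos[OF n] in eventually_elim)
    fix z assume z: "0 < vnorm n z"
    have "(\<integral>\<^sup>+t. f z * ?w z t \<partial>lborel) = f z * (\<integral>\<^sup>+t. ?w z t \<partial>lborel)"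
      by (rule nn_integral_cmult) measurable
    also have "(\<integral>\<^sup>+t. ?w z t \<partial>lborel) = (\<integral>\<^sup>+t. ennreal (real n * vnorm n z ^ n / t ^ (n + 1)) * indicator {vnorm n z..} t \<partial>lborel)"
      using z by (intro nn_integral_cong) (auto split: split_indicator)
    also have "\<dots> = 1" by (rule radial_weight[OF n z])
    finally show "f z = (\<integral>\<^sup>+t. f z * ?w z t \<partial>lborel)" by simp
  qed
  also have "\<dots> = (\<integral>\<^sup>+t. (\<integral>\<^sup>+z. f z * ?w z t \<partial>lborel_n n) \<partial>lborel)"
    by (rule P.Fubini'[symmetric]) measurable
  also have "\<dots> = (\<integral>\<^sup>+t. (\<integral>\<^sup>+v. ?a v t \<partial>lborel_n n) \<partial>lborel)"
  proof (rule nn_integral_cong)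
    fix t :: real
    show "(\<integral>\<^sup>+z. f z * ?w z t \<partial>lborel_n n) = (\<integral>\<^sup>+v. ?a v t \<partial>lborel_n n)"
    proof (cases "0 < t")
      case True
      have "(\<integral>\<^sup>+z. f z * ?w z t \<partial>lborel_n n) = ennreal (t ^ n) * (\<integral>\<^sup>+v. f (scaled n t v) * ?w (scaled n t v) t \<partial>lborel_n n)"
        by (rule nn_integral_lborel_n_scale[OF True]) measurable
      also have "\<dots> = (\<integral>\<^sup>+v. ennreal (t ^ n) * (f (scaled n t v) * ?w (scaled n t v) t) \<partial>lborel_n n)"
        by (rule nn_integral_cmult[symmetric]) measurable
      also have "\<dots> = (\<integral>\<^sup>+v. ?a v t \<partial>lborel_n n)"
      proof (rule nn_integral_cong)
        fix v assume v: "v \<in> space (lborel_n n)"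
        have "t ^ n * (real n * (\<bar>t\<bar> * vnorm n v) ^ n / t ^ (n + 1)) = real n * vnorm n v ^ n * t ^ (n - 1)"
          using True n by (cases n) (simp_all add: power_mult_distrib)
        then have "ennreal (t ^ n) * ennreal (real n * (\<bar>t\<bar> * vnorm n v) ^ n / t ^ (n + 1))
          = ennreal (real n * vnorm n v ^ n * t ^ (n - 1))"
          using True by (simp add: ennreal_mult'[symmetric])
        then show "ennreal (t ^ n) * (f (scaled n t v) * ?w (scaled n t v) t) =
          ?a v t"
          unfolding vnorm_restrict vnorm_scale using True v
          by (cases "vnorm n v \<le> 1") (simp_all add: mult.assoc mult.left_commute[of "ennreal (t ^ n)"])
      qed
      finally show ?thesis .
    qed simp
  qed
  also have "\<dots> = (\<integral>\<^sup>+v. (\<integral>\<^sup>+t. ?a v t \<partial>lborel) \<partial>lborel_n n)"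
    by (rule P.Fubini') measurable
  also have "\<dots> = (\<integral>\<^sup>+v. (\<integral>\<^sup>+r. ?b v r \<partial>lborel) * indicator (unit_ball n) v \<partial>lborel_n n)"
  proof (rule nn_integral_cong_AE, use AE_vnorm_pos[OF n] in eventually_elim)
    fix v assume v: "0 < vnorm n v"
    \<comment> \<open>Substituting t = r / |v| makes the radius of the argument equal to r; the
      Jacobian and t^(n-1) absorb |v|^n and leave r^(n-1).\<close>
    let ?c = "1 / vnorm n v"
    have "(\<integral>\<^sup>+t. ?a v t \<partial>lborel)
     = ennreal \<bar>?c\<bar> * (\<integral>\<^sup>+r. ?a v (0 + ?c * r) \<partial>lborel)"
      using v by (intro nn_integral_real_affine) auto
    also have "\<dots> = (\<integral>\<^sup>+r. ennreal \<bar>?c\<bar> * (?a v (0 + ?c * r)) \<partial>lborel)"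
      by (intro nn_integral_cmult[symmetric]) measurable
    also have "\<dots> = (\<integral>\<^sup>+r. ?b v r * indicator (unit_ball n) v \<partial>lborel)"
    proof (rule nn_integral_cong)
      fix r :: real
      have i: "indicator {0<..} (0 + ?c * r) = (indicator {0<..} r :: ennreal)"
        using v by (auto simp: indicator_def zero_less_divide_iff)
      have e: "ennreal \<bar>?c\<bar> * ennreal (real n * vnorm n v ^ n * (0 + ?c * r) ^ (n - 1)) = ennreal (real n * r ^ (n - 1))"
        using v n by (cases n) (simp_all add: ennreal_mult'[symmetric] power_divide)
      have g: "(\<lambda>i. (0 + ?c * r) * v i) = (\<lambda>i. r * v i / vnorm n v)" by (simp add: field_simps)
      have ac: "a * (g * b * j * k) = a * b * j * g * k" for a b g j k :: ennreal
        by (simp only: mult_ac)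
      show "ennreal \<bar>?c\<bar> * (?a v (0 + ?c * r)) = ?b v r * indicator (unit_ball n) v"
        unfolding ac i g e by (rule refl)
    qed
    also have "\<dots> = (\<integral>\<^sup>+r. ?b v r \<partial>lborel) * indicator (unit_ball n) v"
    proof (rule nn_integral_multc)
      have [measurable]: "(\<lambda>r. projected n r v) \<in> measurable borel (lborel_n n)"
        by (rule restrict_measurable_lborel_n) measurable
      show "(\<lambda>r. ?b v r) \<in> borel_measurable lborel" by measurable
    qed
    finally show "(\<integral>\<^sup>+t. ?a v t \<partial>lborel) = (\<integral>\<^sup>+r. ?b v r \<partial>lborel) * indicator (unit_ball n) v" .
  qed
  finally show ?thesis .
qed

section \<open>The uniform law on the sphere and polar integration\<close>

lemma sets_unif_sphere [simp, measurable_cong]: "sets (unif_sphere n R) = sets (lborel_n n)"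
  and space_unif_sphere [simp]: "space (unif_sphere n R) = space (lborel_n n)"
  by (simp_all add: unif_sphere_def)

lemma scale_measurable [measurable]:
  "(\<lambda>x. scaled n R x) \<in> measurable (lborel_n n) (lborel_n n)"
  by (rule restrict_measurable_lborel_n) measurable

lemma prob_space_unif_sphere:
  assumes "1 \<le> n"
  shows "prob_space (unif_sphere n R)"
  unfolding unif_sphere_def
proof (rule prob_space.prob_space_distr)
  show "prob_space (uniform_measure (lborel_n n) (unit_ball n))"
    using emeasure_unit_ball[OF assms] by (intro prob_space_uniform_measure) auto
qed measurable

lemma nn_integral_unif_sphere:
  assumes "1 \<le> n" and [measurable]: "g \<in> borel_measurable (lborel_n n)"
  shows "(\<integral>\<^sup>+u. g u \<partial>unif_sphere n R) =
    (\<integral>\<^sup>+v. g (projected n R v) * indicator (unit_ball n) v \<partial>lborel_n n) / ennreal (ball_vol n)"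
proof -
  have "(\<integral>\<^sup>+u. g u \<partial>unif_sphere n R) =
    (\<integral>\<^sup>+v. g (projected n R v) \<partial>uniform_measure (lborel_n n) (unit_ball n))"
    unfolding unif_sphere_def by (rule nn_integral_distr) measurable
  also have "\<dots> = (\<integral>\<^sup>+v. g (projected n R v) * indicator (unit_ball n) v \<partial>lborel_n n)
     / emeasure (lborel_n n) (unit_ball n)"
    by (rule nn_integral_uniform_measure) measurable
  finally show ?thesis by (simp add: emeasure_unit_ball[OF assms(1)])
qed

lemma unif_sphere_scale:
  assumes "1 \<le> n"
  shows "unif_sphere n R = distr (usphere n) (lborel_n n) (\<lambda>u. scaled n R u)"
  unfolding unif_sphere_def
  by (subst distr_distr) (measurable, rule distr_cong, simp_all add: comp_def fun_eq_iff)

lemma AE_unif_sphere: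
  assumes "1 \<le> n" "0 \<le> R"
  shows "AE u in unif_sphere n R. vnorm n u = R"
  unfolding unif_sphere_def
proof (subst AE_distr_iff)
  show "AE x in uniform_measure (lborel_n n) (unit_ball n). vnorm n (projected n R x) = R"
  proof (rule AE_uniform_measureI)
    show "AE x in lborel_n n. x \<in> unit_ball n \<longrightarrow> vnorm n (projected n R x) = R"
      using AE_vnorm_pos[OF assms(1)]
    proof eventually_elim
      fix x assume "0 < vnorm n x"
      then show "x \<in> unit_ball n \<longrightarrow> vnorm n (projected n R x) = R"
        using vnorm_scale[of n "R / vnorm n x" x] assms(2) by simp
    qed
  qed measurable
qed measurable

text \<open>The area of the unit sphere. Its value is not computed from the volume of the ball but
  read off a Gaussian integral in \<open>surf_eq\<close>.\<close>

definition surf :: "nat \<Rightarrow> real" where "surf n = ball_vol n * real n"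

lemma surf_pos: "1 \<le> n \<Longrightarrow> 0 < surf n"
  using emeasure_unit_ball(2)[of n] by (simp add: surf_def)

lemma nn_integral_polar:
  assumes n: "1 \<le> n" and f [measurable]: "f \<in> borel_measurable (lborel_n n)"
  shows "(\<integral>\<^sup>+z. f z \<partial>lborel_n n) =
    (\<integral>\<^sup>+r. ennreal (surf n * r ^ (n - 1)) * indicator {0<..} r
        * (\<integral>\<^sup>+u. f (scaled n r u) \<partial>usphere n) \<partial>lborel)"
proof -
  interpret L: sigma_finite_measure "lborel_n n" by (rule sigma_finite_lborel_n)
  interpret P: pair_sigma_finite "lborel_n n" lborel ..
  let ?b = "\<lambda>v r. ennreal (real n * r ^ (n - 1)) * indicator {0<..} r * f (projected n r v)"
  let ?d = "\<lambda>r. ennreal (surf n * r ^ (n - 1)) * indicator {0<..} r * (\<integral>\<^sup>+u. f (scaled n r u) \<partial>usphere n)"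
  note V = emeasure_unit_ball(2)[OF n]
  have [measurable]: "(\<lambda>(v, r). projected n r v) \<in> measurable (lborel_n n \<Otimes>\<^sub>M lborel) (lborel_n n)"
    unfolding case_prod_beta by (rule restrict_measurable_lborel_n) measurable
  have [measurable]: "(\<lambda>r. projected n r v) \<in> measurable borel (lborel_n n)" for v
    by (rule restrict_measurable_lborel_n) measurable
  have "(\<integral>\<^sup>+z. f z \<partial>lborel_n n) = (\<integral>\<^sup>+v. (\<integral>\<^sup>+r. ?b v r \<partial>lborel) * indicator (unit_ball n) v \<partial>lborel_n n)"
    by (rule nn_integral_polar_ball[OF n f])
  also have "\<dots> = (\<integral>\<^sup>+v. (\<integral>\<^sup>+r. ?b v r * indicator (unit_ball n) v \<partial>lborel) \<partial>lborel_n n)"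
    by (intro nn_integral_cong nn_integral_multc[symmetric]) measurable
  also have "\<dots> = (\<integral>\<^sup>+r. (\<integral>\<^sup>+v. ?b v r * indicator (unit_ball n) v \<partial>lborel_n n) \<partial>lborel)"
    by (rule P.Fubini'[symmetric]) measurable
  also have "\<dots> = (\<integral>\<^sup>+r. ?d r \<partial>lborel)"
  proof (rule nn_integral_cong)
    fix r :: real
    let ?I = "\<integral>\<^sup>+v. f (projected n r v) * indicator (unit_ball n) v \<partial>lborel_n n"
    have "(\<integral>\<^sup>+v. ?b v r * indicator (unit_ball n) v \<partial>lborel_n n)
      = ennreal (real n * r ^ (n - 1)) * indicator {0<..} r * ?I"
      by (simp add: mult.assoc nn_integral_cmult)
    moreover have "(\<integral>\<^sup>+u. f (scaled n r u) \<partial>usphere n) = ?I / ennreal (ball_vol n)"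
      by (subst nn_integral_unif_sphere[OF n])
         (auto intro!: arg_cong2[where f=divide] nn_integral_cong arg_cong2[where f=times] arg_cong[where f=f] simp: fun_eq_iff)
    moreover have "ennreal (surf n * r ^ (n - 1)) * indicator {0<..} r * (?I / ennreal (ball_vol n))
      = ennreal (real n * r ^ (n - 1)) * indicator {0<..} r * ?I"
    proof -
      have "ennreal (ball_vol n) * (?I / ennreal (ball_vol n)) = ?I * ennreal (ball_vol n) / ennreal (ball_vol n)"
        by (simp only: ennreal_times_divide mult.commute)
      also have "\<dots> = ?I" using V by (intro mult_divide_eq_ennreal) auto
      finally have "ennreal (ball_vol n) * (?I / ennreal (ball_vol n)) = ?I" .
      moreover have "ennreal (surf n * r ^ (n - 1)) * indicator {0<..} r = ennreal (real n * r ^ (n - 1)) * indicator {0<..} r * ennreal (ball_vol n)"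
        using V by (auto simp: surf_def ennreal_mult'[symmetric] ac_simps split: split_indicator)
      ultimately show ?thesis by (simp add: mult.assoc)
    qed
    ultimately show "(\<integral>\<^sup>+v. ?b v r * indicator (unit_ball n) v \<partial>lborel_n n)
      = ?d r" by simp
  qed
  finally show ?thesis .
qed

definition radial :: "nat \<Rightarrow> real measure" where
  "radial n = density lborel (\<lambda>r. ennreal (surf n * r ^ (n - 1)) * indicator {0<..} r)"

lemma sets_radial [simp, measurable_cong]: "sets (radial n) = sets borel"
  by (simp add: radial_def)

lemma sigma_finite_radial: "sigma_finite_measure (radial n)"
proof -
  have "radial n = density lborel (\<lambda>r. ennreal (surf n * r ^ (n - 1) * indicator {0<..} r))"
    unfolding radial_def by (intro density_cong) (auto split: split_indicator)
  also have "sigma_finite_measure \<dots>"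
    by (subst sigma_finite_measure.sigma_finite_iff_density_finite[OF sigma_finite_lborel]) auto
  finally show ?thesis .
qed

text \<open>Recasts the polar formula as the image of a product measure, so that integrals of signed
  functions follow from Fubini.\<close>

lemma lborel_n_polar:
  assumes n: "1 \<le> n"
  shows "lborel_n n = distr (radial n \<Otimes>\<^sub>M usphere n) (lborel_n n) (\<lambda>(r, u). scaled n r u)"
proof (rule measure_eqI)
  interpret U: prob_space "usphere n" by (rule prob_space_unif_sphere[OF n])
  interpret R: sigma_finite_measure "radial n" by (rule sigma_finite_radial)
  interpret P: pair_sigma_finite "radial n" "usphere n" ..
  fix A assume A [measurable]: "A \<in> sets (lborel_n n)"
  have *: "(\<lambda>(r, u). scaled n r u) \<in> measurable (radial n \<Otimes>\<^sub>M usphere n) (lborel_n n)"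
    by measurable
  have "emeasure (lborel_n n) A = (\<integral>\<^sup>+z. indicator A z \<partial>lborel_n n)"
    by simp
  also have "\<dots> = (\<integral>\<^sup>+r. (\<integral>\<^sup>+u. indicator A (scaled n r u) \<partial>usphere n) \<partial>radial n)"
    by (subst nn_integral_polar[OF n]) (simp_all add: radial_def nn_integral_density)
  also have "\<dots> = (\<integral>\<^sup>+p. indicator A (case p of (r, u) \<Rightarrow> scaled n r u) \<partial>(radial n \<Otimes>\<^sub>M usphere n))"
    by (subst U.nn_integral_fst[symmetric]) auto
  also have "\<dots> = (\<integral>\<^sup>+z. indicator A z \<partial>distr (radial n \<Otimes>\<^sub>M usphere n) (lborel_n n) (\<lambda>(r, u). scaled n r u))"
    by (rule nn_integral_distr[symmetric]) (use * in auto)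
  finally show "emeasure (lborel_n n) A = emeasure (distr (radial n \<Otimes>\<^sub>M usphere n) (lborel_n n) (\<lambda>(r, u). scaled n r u)) A"
    by simp
qed simp

section \<open>The hypergeometric series behind the Bessel ratio\<close>

text \<open>The confluent hypergeometric limit function 0F1(;a;x). Up to a power and a Gamma factor,
  the Bessel function of order v at z is 0F1(;v+1;z^2/4), so Bessel ratios become quotients of
  entire functions without a singularity at 0.\<close>

definition hyp01 :: "real \<Rightarrow> real \<Rightarrow> real" where
  "hyp01 a x = (\<Sum>k. x ^ k / (fact k * pochhammer a k))"

lemma pochhammer_ge_power:
  fixes a :: real
  assumes "0 < a"
  shows "a ^ k \<le> pochhammer a k"
proof -
  have "(\<Prod>i<k. a) \<le> (\<Prod>i<k. a + real i)" using assms by (intro prod_mono) auto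
  then show ?thesis by (simp add: pochhammer_prod lessThan_atLeast0)
qed

text \<open>Since the Pochhammer symbol dominates a^k, the exponential series of |x| / a dominates
  termwise.\<close>

lemma summable_hyp01:
  fixes a x :: real
  assumes "0 < a"
  shows "summable (\<lambda>k. x ^ k / (fact k * pochhammer a k))"
proof (rule summable_comparison_test)
  show "summable (\<lambda>k. inverse (fact k) * (\<bar>x\<bar> / a) ^ k)" by (rule summable_exp)
  have "norm (x ^ k / (fact k * pochhammer a k)) \<le> inverse (fact k) * (\<bar>x\<bar> / a) ^ k" for k
  proof -
    have "norm (x ^ k / (fact k * pochhammer a k)) = \<bar>x\<bar> ^ k / (fact k * pochhammer a k)"
      using pochhammer_pos[OF assms, of k] by (simp add: power_abs abs_mult)
    also have "\<dots> \<le> \<bar>x\<bar> ^ k / (fact k * a ^ k)"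
      using pochhammer_ge_power[OF assms, of k] pochhammer_pos[OF assms, of k] assms
      by (intro divide_left_mono mult_left_mono) auto
    finally show ?thesis by (simp add: power_divide field_simps)
  qed
  then show "\<exists>N. \<forall>k\<ge>N. norm (x ^ k / (fact k * pochhammer a k)) \<le> inverse (fact k) * (\<bar>x\<bar> / a) ^ k"
    by blast
qed

lemma hyp01_sums: "0 < a \<Longrightarrow> (\<lambda>k. x ^ k / (fact k * pochhammer a k)) sums hyp01 a x"
  unfolding hyp01_def by (rule summable_sums[OF summable_hyp01])

lemma hyp01_0 [simp]: "hyp01 a 0 = 1"
proof -
  have "hyp01 a 0 = (\<Sum>k\<in>{0}. 0 ^ k / (fact k * pochhammer a k))"
    unfolding hyp01_def by (rule suminf_finite) auto
  then show ?thesis by simp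
qed

lemma hyp01_ge_1:
  assumes "0 < a" "0 \<le> x"
  shows "1 \<le> hyp01 a x"
proof -
  have "(\<Sum>k\<in>{0}. x ^ k / (fact k * pochhammer a k)) \<le> hyp01 a x"
    unfolding hyp01_def
    by (rule sum_le_suminf[OF summable_hyp01[OF assms(1)]]) (use assms pochhammer_pos[OF assms(1)] in \<open>auto intro!: divide_nonneg_pos\<close>)
  then show ?thesis by simp
qed

lemma hyp01_antimono:
  assumes "0 < a" "a \<le> b" "0 \<le> x"
  shows "hyp01 b x \<le> hyp01 a x"
  unfolding hyp01_def
proof (intro suminf_le summable_hyp01)
  fix k
  have "pochhammer a k \<le> pochhammer b k"
    unfolding pochhammer_prod using assms by (intro prod_mono) auto
  with assms show "x ^ k / (fact k * pochhammer b k) \<le> x ^ k / (fact k * pochhammer a k)"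
    using pochhammer_pos[of a k] by (intro divide_left_mono mult_left_mono) auto
qed (use assms in auto)

text \<open>Termwise differentiation raises the parameter by 1. With a = n/2 this is the passage
  from dimension n to n + 2.\<close>

lemma DERIV_hyp01:
  assumes "0 < a"
  shows "(hyp01 a has_real_derivative hyp01 (a + 1) x / a) (at x)"
proof -
  let ?c = "\<lambda>k. 1 / (fact k * pochhammer a k)"
  have d: "diffs ?c k * x ^ k = x ^ k / (fact k * pochhammer (a + 1) k) / a" for k
  proof -
    have "m * (1 / (m * f * (a * p))) * y = y / (f * p) / a" if "m \<noteq> 0" for m f p y :: real
      using that by simp
    from this[of "of_nat (Suc k)"] show ?thesis
      unfolding diffs_def pochhammer_rec[of a k] fact_Suc by (metis nat.distinct(1) of_nat_eq_0_iff)
  qed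
  have "((\<lambda>x. \<Sum>k. ?c k * x ^ k) has_real_derivative (\<Sum>k. diffs ?c k * x ^ k)) (at x)"
    by (rule termdiffs_strong_converges_everywhere) (use summable_hyp01[OF assms] in simp)
  moreover have "(\<lambda>x. \<Sum>k. ?c k * x ^ k) = hyp01 a" by (simp add: hyp01_def fun_eq_iff)
  moreover have "(\<Sum>k. diffs ?c k * x ^ k) = hyp01 (a + 1) x / a"
    unfolding d hyp01_def using assms by (intro suminf_divide summable_hyp01) auto
  ultimately show ?thesis by simp
qed

text \<open>Any power series with nonnegative coefficients, evaluated at the product t r, is totally
  positive of order 2 in (t, r). This is the monotone likelihood ratio of the noncentral chi
  densities; it is shown for partial sums and passed to the limit.\<close>

lemma hyp01_supermodular:
  assumes a: "0 < a" and t: "0 \<le> t1" "t1 \<le> t2" and r: "0 \<le> r1" "r1 \<le> r2"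
  shows "hyp01 a (t2 * r1) * hyp01 a (t1 * r2) \<le> hyp01 a (t2 * r2) * hyp01 a (t1 * r1)"
proof -
  define c where "c = (\<lambda>k. 1 / (fact k * pochhammer a k) :: real)"
  have c: "0 \<le> c k" for k using pochhammer_pos[OF a, of k] by (simp add: c_def)
  let ?S = "\<lambda>N x. \<Sum>k<N. c k * x ^ k"
  have lim: "(\<lambda>N. ?S N x) \<longlonglongrightarrow> hyp01 a x" for x
    using hyp01_sums[OF a, of x] by (simp add: sums_def c_def)
  have l: "(\<lambda>N. ?S N (t2 * r1) * ?S N (t1 * r2)) \<longlonglongrightarrow> hyp01 a (t2 * r1) * hyp01 a (t1 * r2)"
    "(\<lambda>N. ?S N (t2 * r2) * ?S N (t1 * r1)) \<longlonglongrightarrow> hyp01 a (t2 * r2) * hyp01 a (t1 * r1)"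
    by (intro tendsto_mult lim)+
  have "0 \<le> ?S N (t2 * r2) * ?S N (t1 * r1) - ?S N (t2 * r1) * ?S N (t1 * r2)" for N
  proof -
    let ?f = "\<lambda>j k. c j * c k * (t2 ^ j * t1 ^ k) * (r2 ^ j * r1 ^ k - r1 ^ j * r2 ^ k)"
    have e: "?S N (t2 * r2) * ?S N (t1 * r1) - ?S N (t2 * r1) * ?S N (t1 * r2) = (\<Sum>j<N. \<Sum>k<N. ?f j k)"
      unfolding sum_product sum_subtractf[symmetric]
      by (intro sum.cong refl) (simp add: power_mult_distrib algebra_simps)
    \<comment> \<open>Averaging with the transposed sum turns each term into a nonnegative
      coefficient times two 2 by 2 minors of powers, one in t and one in r; both have the sign of j
      - k.\<close>
    have "(\<Sum>j<N. \<Sum>k<N. ?f j k) = (\<Sum>j<N. \<Sum>k<N. ?f k j)" by (rule sum.swap)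
    then have "2 * (\<Sum>j<N. \<Sum>k<N. ?f j k) = (\<Sum>j<N. \<Sum>k<N. ?f j k) + (\<Sum>j<N. \<Sum>k<N. ?f k j)" by linarith
    also have "\<dots> = (\<Sum>j<N. \<Sum>k<N. c j * c k * ((t2 ^ j * t1 ^ k - t2 ^ k * t1 ^ j) * (r2 ^ j * r1 ^ k - r1 ^ j * r2 ^ k)))"
      unfolding sum.distrib[symmetric] by (intro sum.cong refl) (simp add: algebra_simps)
    finally have s2: "2 * (\<Sum>j<N. \<Sum>k<N. ?f j k) = (\<Sum>j<N. \<Sum>k<N. c j * c k * ((t2 ^ j * t1 ^ k - t2 ^ k * t1 ^ j) * (r2 ^ j * r1 ^ k - r1 ^ j * r2 ^ k)))" .
    have "0 \<le> 2 * (\<Sum>j<N. \<Sum>k<N. ?f j k)"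
      unfolding s2
    proof (intro sum_nonneg)
      fix j k
      have *: "v ^ k * u ^ j \<le> v ^ j * u ^ k" if "k \<le> j" "0 \<le> u" "u \<le> v" for u v :: real and j k :: nat
      proof -
        have "v ^ k * u ^ j = v ^ k * (u ^ k * u ^ (j - k))" using that by (simp add: power_add[symmetric])
        also have "\<dots> \<le> v ^ k * (u ^ k * v ^ (j - k))" using that by (intro mult_left_mono power_mono) auto
        also have "\<dots> = v ^ j * u ^ k" using that by (simp add: power_add[symmetric] mult_ac)
        finally show ?thesis .
      qed
      have "0 \<le> (t2 ^ j * t1 ^ k - t2 ^ k * t1 ^ j) * (r2 ^ j * r1 ^ k - r1 ^ j * r2 ^ k)"
      proof (cases "k \<le> j")
        case True
        with *[OF True t] *[OF True r] show ?thesis by (intro mult_nonneg_nonneg) (auto simp: mult_ac)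
      next
        case False
        with *[of j k t1 t2] *[of j k r1 r2] t r show ?thesis by (intro mult_nonpos_nonpos) (auto simp: mult_ac)
      qed
      then show "0 \<le> c j * c k * ((t2 ^ j * t1 ^ k - t2 ^ k * t1 ^ j) * (r2 ^ j * r1 ^ k - r1 ^ j * r2 ^ k))"
        by (rule mult_nonneg_nonneg[OF mult_nonneg_nonneg[OF c c]])
    qed
    then show ?thesis unfolding e by simp
  qed
  then show ?thesis by (intro LIMSEQ_le[OF l]) auto
qed

text \<open>\<open>sphF n z\<close> will be the mean of \<open>exp (z u\<^sub>0)\<close> for \<open>u\<close> uniform on the unit sphere of \<open>R^n\<close>.\<close>

definition sphF :: "nat \<Rightarrow> real \<Rightarrow> real" where
  "sphF n z = hyp01 (real n / 2) (z\<^sup>2 / 4)"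

lemma sphF_0 [simp]: "sphF n 0 = 1"
  by (simp add: sphF_def)

lemma sphF_ge_1: "1 \<le> n \<Longrightarrow> 1 \<le> sphF n z"
  unfolding sphF_def by (rule hyp01_ge_1) auto

lemma sphF_pos: "1 \<le> n \<Longrightarrow> 0 < sphF n z"
  using sphF_ge_1[of n z] by linarith

lemma DERIV_sphF:
  assumes "1 \<le> n"
  shows "(sphF n has_real_derivative z / real n * sphF (n + 2) z) (at z)"
proof -
  have "((\<lambda>z. hyp01 (real n / 2) (z\<^sup>2 / 4)) has_real_derivative
      hyp01 (real n / 2 + 1) (z\<^sup>2 / 4) / (real n / 2) * (2 * z / 4)) (at z)"
    using assms
    by (intro DERIV_chain2[of "hyp01 (real n / 2)" _ "\<lambda>z. z\<^sup>2 / 4"] DERIV_hyp01)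
       (auto intro!: derivative_eq_intros)
  moreover have "hyp01 (real n / 2 + 1) (z\<^sup>2 / 4) / (real n / 2) * (2 * z / 4) = z / real n * sphF (n + 2) z"
  proof -
    have e: "real (n + 2) / 2 = real n / 2 + 1" by simp
    show ?thesis unfolding sphF_def e by simp
  qed
  moreover have "sphF n = (\<lambda>z. hyp01 (real n / 2) (z\<^sup>2 / 4))" by (simp add: sphF_def fun_eq_iff)
  ultimately show ?thesis by metis
qed

lemma isCont_sphF: "1 \<le> n \<Longrightarrow> isCont (sphF n) z"
  by (rule DERIV_isCont[OF DERIV_sphF])

lemma borel_measurable_sphF: "1 \<le> n \<Longrightarrow> sphF n \<in> borel_measurable borel"
  by (rule borel_measurable_continuous_onI[OF continuous_at_imp_continuous_on]) (simp add: isCont_sphF)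

lemma sphF_antimono: "1 \<le> n \<Longrightarrow> sphF (n + 2) z \<le> sphF n z"
  unfolding sphF_def by (rule hyp01_antimono) auto

lemma sphF_supermodular:
  assumes "1 \<le> n" "0 \<le> t1" "t1 \<le> t2" "0 \<le> r1" "r1 \<le> r2"
  shows "sphF n (t2 * r1) * sphF n (t1 * r2) \<le> sphF n (t2 * r2) * sphF n (t1 * r1)"
proof -
  have e: "(t * r)\<^sup>2 / 4 = t\<^sup>2 / 4 * r\<^sup>2" for t r :: real by (simp add: power_mult_distrib)
  show ?thesis unfolding sphF_def e
    by (rule hyp01_supermodular) (use assms in \<open>auto intro!: power_mono divide_right_mono\<close>)
qed

text \<open>The functional equation of Gamma extracts \<open>Gamma (v + 1)\<close> from every term
  and leaves a Pochhammer symbol. The bound on v keeps the Gamma values positive and covers the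
  smallest order that occurs, -1/2 for n = 1; for positive x, \<open>rpow\<close> agrees with
  \<open>powr\<close>.\<close>

lemma besselI_eq_hyp01:
  assumes "-1 < v" "0 < x"
  shows "besselI v x = (x / 2) powr v / Gamma (v + 1) * hyp01 (v + 1) (x\<^sup>2 / 4)"
proof -
  have G: "Gamma (v + 1) > 0" using assms by (intro Gamma_real_pos) auto
  have eq: "(x / 2) ^ (2 * k) * rpow (x / 2) v / (fact k * Gamma (real k + v + 1))
      = (x / 2) powr v / Gamma (v + 1) * ((x\<^sup>2 / 4) ^ k / (fact k * pochhammer (v + 1) k))" for k
  proof -
    have "v + 1 \<notin> \<int>\<^sub>\<le>\<^sub>0" using assms by (auto dest: nonpos_Ints_nonpos)
    then have "Gamma (real k + v + 1) = pochhammer (v + 1) k * Gamma (v + 1)"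
      using G by (simp add: pochhammer_Gamma field_simps)
    moreover have "(x / 2) ^ (2 * k) = (x\<^sup>2 / 4) ^ k" by (simp add: power_mult power_divide)
    moreover have "rpow (x / 2) v = (x / 2) powr v" using assms by (simp add: rpow_def)
    ultimately show ?thesis by (simp add: mult_ac)
  qed
  show ?thesis
    unfolding besselI_def hyp01_def eq using assms by (intro suminf_mult summable_hyp01) auto
qed

lemma hb_eq_sphF:
  assumes n: "1 \<le> n" and z: "0 \<le> z"
  shows "hb (real n / 2) z = z / real n * (sphF (n + 2) z / sphF n z)"
proof (cases "z = 0")
  \<comment> \<open>A Bessel function of positive order vanishes at 0, so the numerator is 0 and
    both sides are 0; division by a vanishing denominator also yields 0.\<close>
  case True
  with n show ?thesis by (simp add: hb_def besselI_def rpow_def)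
next
  case False
  with z have z: "0 < z" by simp
  have G: "Gamma (real n / 2 + 1) = real n / 2 * Gamma (real n / 2)"
    using Gamma_plus1[of "real n / 2"] n nonpos_Ints_nonpos[of "real n / 2"] by auto
  have Gp: "0 < Gamma (real n / 2)" using n by (intro Gamma_real_pos) auto
  have p: "(z / 2) powr (real n / 2) = (z / 2) powr (real n / 2 - 1) * (z / 2)"
    using z by (simp add: powr_diff)
  have "hyp01 (real n / 2 + 1) (z\<^sup>2 / 4) = sphF (n + 2) z" by (simp add: sphF_def add_divide_distrib add.commute)
  then have b1: "besselI (real n / 2) z = (z / 2) powr (real n / 2 - 1) * (z / 2) / (real n / 2 * Gamma (real n / 2)) * sphF (n + 2) z"
    using besselI_eq_hyp01[of "real n / 2" z] z n by (simp add: G p)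
  have b2: "besselI (real n / 2 - 1) z = (z / 2) powr (real n / 2 - 1) / Gamma (real n / 2) * sphF n z"
    using besselI_eq_hyp01[of "real n / 2 - 1" z] z n by (simp add: sphF_def)
  have "(z / 2) powr (real n / 2 - 1) > 0" using z by simp
  then show ?thesis
    unfolding hb_def b1 b2 using n z sphF_pos[OF n, of z] less_imp_neq[OF Gp, symmetric]
    by (simp add: divide_simps)
    
qed

section \<open>Moments of the uniform distribution on the sphere\<close>

lemma borel_measurable_ip [measurable]: "ip n y \<in> borel_measurable (lborel_n n)"
  unfolding ip_def by measurable

text \<open>A sum of independent centred normals is normal, and its variance involves y only through
  its norm. This is the substitute for invariance under rotations.\<close>

lemma distributed_ip_gmeas:
  assumes s: "0 < s" and y: "0 < vnorm n y"
  shows "distributed (gmeas n s (\<lambda>_. 0)) lborel (ip n y) (normal_density 0 (vnorm n y * sqrt s))"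
proof -
  interpret G: prob_space "gmeas n s (\<lambda>_. 0)" by (rule prob_space_gmeas[OF s])
  let ?N = "density lborel (\<lambda>x. ennreal (normal_density 0 (sqrt s) x))"
  \<comment> \<open>Coordinates with \<open>y i = 0\<close> would contribute normals of variance 0,
    which have no density, so the sum runs over the others.\<close>
  let ?I = "{i \<in> {..<n}. y i \<noteq> 0}"
  have N: "prob_space ?N" using s by (intro prob_space_normal_density) auto
  have M: "gmeas n s (\<lambda>_. 0) = PiM {..<n} (\<lambda>_. ?N)" by (rule gmeas_eq_PiM[OF s])
  have D: "distr (gmeas n s (\<lambda>_. 0)) borel (\<lambda>z. z i) = ?N" if "i < n" for i
  proof -
    have "distr (PiM {..<n} (\<lambda>_. ?N)) ?N (\<lambda>z. z i) = ?N"
      by (rule distr_PiM_component) (use N that in auto)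
    then show ?thesis unfolding M by (metis (no_types, lifting) distr_cong sets_density sets_lborel)
  qed
  have I: "?I \<noteq> {}"
  proof
    assume "?I = {}"
    then have "vnorm n y = 0" by (auto simp: vnorm_def)
    with y show False by simp
  qed
  have n: "{..<n} \<noteq> {}" using I by auto
  have ind: "G.indep_vars (\<lambda>_. borel) (\<lambda>i z. z i) {..<n}"
  proof (subst G.indep_vars_iff_distr_eq_PiM'[OF n])
    show "(\<lambda>z. z i) \<in> measurable (gmeas n s (\<lambda>_. 0)) borel" if "i \<in> {..<n}" for i
      unfolding measurable_cong_sets[OF sets_gmeas refl] by (rule lborel_n_component) (use that in simp)
    have "distr (gmeas n s (\<lambda>_. 0)) (PiM {..<n} (\<lambda>_. borel)) (\<lambda>x. restrict x {..<n})
       = distr (gmeas n s (\<lambda>_. 0)) (gmeas n s (\<lambda>_. 0)) (\<lambda>x. x)"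
      by (rule distr_cong) (auto simp: sets_lborel_n space_lborel_n extensional_restrict)
    also have "\<dots> = PiM {..<n} (\<lambda>_. ?N)" unfolding distr_id2[OF refl] by (rule M)
    also have "\<dots> = PiM {..<n} (\<lambda>i. distr (gmeas n s (\<lambda>_. 0)) borel (\<lambda>z. z i))"
      using D by (intro PiM_cong) auto
    finally show "distr (gmeas n s (\<lambda>_. 0)) (PiM {..<n} (\<lambda>_. borel)) (\<lambda>x. restrict x {..<n})
      = PiM {..<n} (\<lambda>i. distr (gmeas n s (\<lambda>_. 0)) borel (\<lambda>z. z i))" .
  qed
  have ind': "G.indep_vars (\<lambda>_. borel) (\<lambda>i z. 0 + y i * z i) ?I"
    by (rule G.indep_vars_compose2[OF G.indep_vars_subset[OF ind], where Y="\<lambda>i t. 0 + y i * t"]) auto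
  have "distributed (gmeas n s (\<lambda>_. 0)) lborel (\<lambda>z. \<Sum>i\<in>?I. 0 + y i * z i)
      (normal_density (\<Sum>i\<in>?I. 0 + y i * 0) (sqrt (\<Sum>i\<in>?I. (\<bar>y i\<bar> * sqrt s)\<^sup>2)))"
  proof (rule G.sum_indep_normal[OF _ I ind'])
    fix i assume i: "i \<in> ?I"
    have "distr (gmeas n s (\<lambda>_. 0)) lborel (\<lambda>z. z i) = ?N"
      using D[of i] i by (metis (no_types, lifting) distr_cong mem_Collect_eq lessThan_iff sets_lborel)
    then have "distributed (gmeas n s (\<lambda>_. 0)) lborel (\<lambda>z. z i) (normal_density 0 (sqrt s))"
      using i by (simp add: distributed_def)
    then show "distributed (gmeas n s (\<lambda>_. 0)) lborel (\<lambda>z. 0 + y i * z i) (normal_density (0 + y i * 0) (\<bar>y i\<bar> * sqrt s))"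
      by (rule G.normal_density_affine) (use i s in auto)
    show "0 < \<bar>y i\<bar> * sqrt s" using i s by auto
  qed auto
  moreover have "(\<lambda>z. \<Sum>i\<in>?I. 0 + y i * z i) = ip n y"
    unfolding ip_def by (auto intro!: sum.mono_neutral_left simp: fun_eq_iff)
  moreover have "sqrt (\<Sum>i\<in>?I. (\<bar>y i\<bar> * sqrt s)\<^sup>2) = vnorm n y * sqrt s"
  proof -
    have "(\<Sum>i\<in>?I. (\<bar>y i\<bar> * sqrt s)\<^sup>2) = (\<Sum>i<n. (y i)\<^sup>2 * s)"
      using s by (intro sum.mono_neutral_cong_left) (auto simp: power_mult_distrib)
    then show ?thesis by (simp add: vnorm_def sum_distrib_right[symmetric] real_sqrt_mult)
  qed
  ultimately show ?thesis by simp
qed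

text \<open>The integral of exp(-r^2) r^i over r >= 0, that is Gamma((i+1)/2) / 2, in the closed
  forms for even and odd i.\<close>

definition half_moment :: "nat \<Rightarrow> real" where
  "half_moment i = (if even i then sqrt pi / 2 * (fact i / (2 ^ i * fact (i div 2))) else fact (i div 2) / 2)"

lemma half_moment_integral:
  "has_bochner_integral lborel (\<lambda>r::real. indicator {0..} r *\<^sub>R (exp (- r\<^sup>2) * r ^ i)) (half_moment i)"
proof (cases "even i")
  case True
  then show ?thesis using gaussian_moment_even_pos[of "i div 2"] by (simp add: half_moment_def)
next
  case False
  then have i: "2 * (i div 2) + 1 = i" by simp
  show ?thesis using gaussian_moment_odd_pos[of "i div 2"] False unfolding i by (simp add: half_moment_def)
qed

lemma half_moment_rec: "half_moment (i + 2) = real (i + 1) / 2 * half_moment i"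
proof (cases "even i")
  case True
  then obtain k where i: "i = 2 * k" by (elim evenE)
  have gen: "p * ((2 * c * d * X) / (4 * W * (c * Y))) = d / 2 * (p * (X / (W * Y)))" if "c \<noteq> 0" for p c d X W Y :: real
    using that by (simp add: field_simps)
  have f1: "fact (i + 2) = 2 * (real k + 1) * real (i + 1) * fact i" unfolding i by (simp add: algebra_simps)
  have f2: "fact ((i + 2) div 2) = (real k + 1) * fact (i div 2)" unfolding i by simp
  have f3: "(2::real) ^ (i + 2) = 4 * 2 ^ i" by simp
  have ev: "even (i + 2)" using True by simp
  show ?thesis unfolding half_moment_def if_P[OF True] if_P[OF ev] f1 f2 f3 by (rule gen) linarith
next
  case False
  then obtain k where "i = 2 * k + 1" by (elim oddE)
  then show ?thesis by (simp add: half_moment_def field_simps)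
qed

lemma half_moment_pos: "0 < half_moment i"
  by (simp add: half_moment_def)

text \<open>The Pochhammer symbol produced here by the radial moments is the one in the coefficients
  of \<open>hyp01\<close>.\<close>

lemma half_moment_shift:
  "half_moment (n - 1 + 2 * k) = pochhammer (real n / 2) k * half_moment (n - 1)" if "1 \<le> n"
proof (induction k)
  case (Suc k)
  have "half_moment (n - 1 + 2 * Suc k) = half_moment ((n - 1 + 2 * k) + 2)" by simp
  also have "\<dots> = real (n - 1 + 2 * k + 1) / 2 * half_moment (n - 1 + 2 * k)" by (rule half_moment_rec)
  also have "real (n - 1 + 2 * k + 1) / 2 = real n / 2 + real k" using that by (simp add: of_nat_diff)
  finally show ?case using Suc by (simp add: pochhammer_rec')
qed simp

text \<open>Variance 1/2 makes the exponent -|z|^2, so that the radial integrals are exactly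
  \<open>half_moment\<close>.\<close>

lemma gauss_half: "gauss n (1 / 2) (\<lambda>_. 0) z = pi powr (- real n / 2) * exp (- (vnorm n z)\<^sup>2)"
  by (simp add: gauss_alt)

lemma sphere_integrable:
  fixes g :: "(nat \<Rightarrow> real) \<Rightarrow> real"
  assumes n: "1 \<le> n" and [measurable]: "g \<in> borel_measurable (lborel_n n)"
    and b: "\<And>u. vnorm n u = 1 \<Longrightarrow> \<bar>g u\<bar> \<le> B"
  shows "integrable (usphere n) g"
proof -
  interpret U: prob_space "usphere n" by (rule prob_space_unif_sphere[OF n])
  show ?thesis
    by (rule U.integrable_const_bound[of _ B]) (use AE_unif_sphere[OF n, of 1] b in auto)
qed

lemma ip_sphere_bound: "vnorm n u = 1 \<Longrightarrow> \<bar>ip n y u\<bar> \<le> vnorm n y"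
  using ip_bound[of n y u] by simp

lemma gauss_ip_moment:
  assumes y: "0 < vnorm n y"
  shows "has_bochner_integral (lborel_n n) (\<lambda>z. exp (- (vnorm n z)\<^sup>2) * ip n y z ^ j)
    (if even j then pi powr (real n / 2) * (vnorm n y ^ j * fact j / (2 ^ j * fact (j div 2))) else 0)"
proof -
  let ?\<sigma> = "vnorm n y * sqrt (1 / 2)"
  let ?G = "gmeas n (1 / 2) (\<lambda>_. 0)"
  let ?m = "if even j then vnorm n y ^ j * fact j / (2 ^ j * fact (j div 2)) else 0"
  have \<sigma>: "0 < ?\<sigma>" using y by simp
  have s2: "?\<sigma>\<^sup>2 = (vnorm n y)\<^sup>2 / 2" by (simp add: power_mult_distrib power_divide)
  have m: "has_bochner_integral lborel (\<lambda>x. normal_density 0 ?\<sigma> x * x ^ j) ?m"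
  proof (cases "even j")
    case True
    then obtain k where j: "j = 2 * k" by (elim evenE)
    have "fact (2 * k) / ((2 / ?\<sigma>\<^sup>2) ^ k * fact k) = vnorm n y ^ j * fact j / (2 ^ j * fact (j div 2))"
    proof -
      have e1: "(2 / ((vnorm n y)\<^sup>2 / 2)) ^ k = 4 ^ k / vnorm n y ^ (2 * k)" by (simp add: power_divide power_mult)
      have e2: "(2::real) ^ (2 * k) = 4 ^ k" by (simp add: power_mult)
      show ?thesis unfolding s2 j e1 e2 by simp
    qed
    then show ?thesis using normal_moment_even[OF \<sigma>, of 0 k] j by simp
  next
    case False
    then obtain k where j: "j = 2 * k + 1" by (elim oddE)
    then show ?thesis using normal_moment_odd[OF \<sigma>, of 0 k] by simp
  qed
  have D: "distr ?G lborel (ip n y) = density lborel (\<lambda>x. ennreal (normal_density 0 ?\<sigma> x))"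
    using distributed_ip_gmeas[OF _ y, of "1 / 2"] by (simp add: distributed_def)
  have "has_bochner_integral (density lborel (\<lambda>x. ennreal (normal_density 0 ?\<sigma> x))) (\<lambda>x. x ^ j) ?m"
    using m by (intro has_bochner_integral_density) auto
  then have h: "has_bochner_integral (distr ?G lborel (ip n y)) (\<lambda>x. x ^ j) ?m" unfolding D .
  have "has_bochner_integral ?G (\<lambda>z. ip n y z ^ j) ?m"
    using h integrable_distr_eq[of "ip n y" ?G lborel "\<lambda>x. x ^ j"] integral_distr[of "ip n y" ?G lborel "\<lambda>x. x ^ j"]
    unfolding has_bochner_integral_iff by simp
  then have "integrable (lborel_n n) (\<lambda>z. gauss n (1 / 2) (\<lambda>_. 0) z * ip n y z ^ j)"
    "(\<integral>z. gauss n (1 / 2) (\<lambda>_. 0) z * ip n y z ^ j \<partial>lborel_n n) = ?m"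
    unfolding gmeas_def has_bochner_integral_iff by (simp_all add: integrable_density integral_density)
  then have "has_bochner_integral (lborel_n n) (\<lambda>z. gauss n (1 / 2) (\<lambda>_. 0) z * ip n y z ^ j) ?m"
    by (simp add: has_bochner_integral_iff)
  from has_bochner_integral_mult_right[OF this, of "pi powr (real n / 2)"]
  show ?thesis unfolding gauss_half by (simp add: mult.assoc[symmetric] powr_add[symmetric] if_distrib cong: if_cong)
qed

lemma integral_polar:
  fixes f :: "(nat \<Rightarrow> real) \<Rightarrow> real"
  assumes n: "1 \<le> n" and f: "integrable (lborel_n n) f"
  shows "integrable lborel (\<lambda>r. indicator {0<..} r * (surf n * r ^ (n - 1)) * (\<integral>u. f (scaled n r u) \<partial>usphere n))"
    and "(\<integral>z. f z \<partial>lborel_n n) =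
      (\<integral>r. indicator {0<..} r * (surf n * r ^ (n - 1)) * (\<integral>u. f (scaled n r u) \<partial>usphere n) \<partial>lborel)"
proof -
  interpret U: prob_space "usphere n" by (rule prob_space_unif_sphere[OF n])
  interpret R: sigma_finite_measure "radial n" by (rule sigma_finite_radial)
  interpret P: pair_sigma_finite "radial n" "usphere n" ..
  let ?T = "\<lambda>(r, u). scaled n r u"
  have T [measurable]: "?T \<in> measurable (radial n \<Otimes>\<^sub>M usphere n) (lborel_n n)" by measurable
  have fm [measurable]: "f \<in> borel_measurable (lborel_n n)" using f by auto
  have "integrable (distr (radial n \<Otimes>\<^sub>M usphere n) (lborel_n n) ?T) f"
    using f lborel_n_polar[OF n] by simp
  then have i: "integrable (radial n \<Otimes>\<^sub>M usphere n) (\<lambda>p. f (?T p))"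
    by (subst (asm) integrable_distr_eq) auto
  have d: "radial n = density lborel (\<lambda>r. ennreal (indicator {0<..} r * (surf n * r ^ (n - 1))))"
    unfolding radial_def using surf_pos[OF n] by (intro density_cong) (auto split: split_indicator)
  have nn: "0 \<le> indicator {0<..} r * (surf n * r ^ (n - 1))" for r :: real
    using surf_pos[OF n] by (auto split: split_indicator)
  let ?g = "\<lambda>r. \<integral>u. f (scaled n r u) \<partial>usphere n"
  have gm [measurable]: "?g \<in> borel_measurable borel"
    by (rule U.borel_measurable_lebesgue_integral) measurable
  have "integrable (radial n) ?g" using P.integrable_fst'[OF i] by simp
  then show "integrable lborel (\<lambda>r. indicator {0<..} r * (surf n * r ^ (n - 1)) * ?g r)"
    unfolding d by (subst (asm) integrable_density) (use nn in auto)
  have "(\<integral>z. f z \<partial>lborel_n n) = (\<integral>z. f z \<partial>distr (radial n \<Otimes>\<^sub>M usphere n) (lborel_n n) ?T)"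
    using lborel_n_polar[OF n] by simp
  also have "\<dots> = (\<integral>p. f (?T p) \<partial>(radial n \<Otimes>\<^sub>M usphere n))"
    by (rule integral_distr) measurable
  also have "\<dots> = (\<integral>r. ?g r \<partial>radial n)" using P.integral_fst'[OF i] by simp
  also have "\<dots> = (\<integral>r. indicator {0<..} r * (surf n * r ^ (n - 1)) * ?g r \<partial>lborel)"
    unfolding d by (subst integral_density) (use nn in auto)
  finally show "(\<integral>z. f z \<partial>lborel_n n) = (\<integral>r. indicator {0<..} r * (surf n * r ^ (n - 1)) * ?g r \<partial>lborel)" .
qed

text \<open>The Gaussian integral in two ways: the product form gives a power of pi, the polar form
  gives the area times a radial moment.\<close>

lemma surf_eq: 
  assumes n: "1 \<le> n"
  shows "surf n * half_moment (n - 1) = pi powr (real n / 2)"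
proof -
  interpret U: prob_space "usphere n" by (rule prob_space_unif_sphere[OF n])
  \<comment> \<open>Only the moment of order 0 is taken, so any nonzero vector can serve; the
    all-ones vector is one.\<close>
  have y: "0 < vnorm n (\<lambda>_. 1)" using n by (simp add: vnorm_def)
  have h: "has_bochner_integral (lborel_n n) (\<lambda>z. exp (- (vnorm n z)\<^sup>2)) (pi powr (real n / 2))"
    using gauss_ip_moment[OF y, of 0] by simp
  then have I: "integrable (lborel_n n) (\<lambda>z. exp (- (vnorm n z)\<^sup>2))" and
    E: "(\<integral>z. exp (- (vnorm n z)\<^sup>2) \<partial>lborel_n n) = pi powr (real n / 2)"
    by (simp_all add: has_bochner_integral_iff)
  have "(\<integral>u. exp (- (vnorm n (scaled n r u))\<^sup>2) \<partial>usphere n) = exp (- r\<^sup>2)" for r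
  proof -
    have "(\<integral>u. exp (- (vnorm n (scaled n r u))\<^sup>2) \<partial>usphere n) = (\<integral>u. exp (- r\<^sup>2) \<partial>usphere n)"
    proof (rule integral_cong_AE)
      show "AE u in usphere n. exp (- (vnorm n (scaled n r u))\<^sup>2) = exp (- r\<^sup>2)"
        using AE_unif_sphere[OF n, of 1] by (auto simp: vnorm_scale)
    qed measurable
    then show ?thesis using U.prob_space by simp
  qed
  with integral_polar(2)[OF n I] E
  have "pi powr (real n / 2) = (\<integral>r. indicator {0<..} r * (surf n * r ^ (n - 1)) * exp (- r\<^sup>2) \<partial>lborel)"
    by simp
  also have "\<dots> = (\<integral>r. surf n * (indicator {0..} r *\<^sub>R (exp (- r\<^sup>2) * r ^ (n - 1))) \<partial>lborel)"
    by (intro integral_cong_AE) (auto intro!: AE_I[where N="{0}"] split: split_indicator)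
  also have "\<dots> = surf n * half_moment (n - 1)"
    using half_moment_integral[of "n - 1"] by (simp add: has_bochner_integral_iff)
  finally show ?thesis by simp
qed

text \<open>In polar coordinates <y,z>^j splits into r^j and the value on the unit sphere. The
  spherical moment is therefore the Gaussian moment of a one-dimensional normal divided by a radial
  moment.\<close>

lemma sphere_moment:
  assumes n: "1 \<le> n" and y: "0 < vnorm n y"
  shows "(\<integral>u. ip n y u ^ j \<partial>usphere n) =
    (if even j then (vnorm n y) ^ j * fact j / (2 ^ j * (fact (j div 2) * pochhammer (real n / 2) (j div 2))) else 0)"
proof -
  interpret U: prob_space "usphere n" by (rule prob_space_unif_sphere[OF n])
  let ?A = "\<integral>u. ip n y u ^ j \<partial>usphere n"
  let ?f = "\<lambda>z. exp (- (vnorm n z)\<^sup>2) * ip n y z ^ j"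
  let ?m = "if even j then pi powr (real n / 2) * (vnorm n y ^ j * fact j / (2 ^ j * fact (j div 2))) else 0"
  have I: "integrable (lborel_n n) ?f" and E: "(\<integral>z. ?f z \<partial>lborel_n n) = ?m"
    using gauss_ip_moment[OF y, of j] by (simp_all add: has_bochner_integral_iff)
  have "(\<integral>u. ?f (scaled n r u) \<partial>usphere n) = exp (- r\<^sup>2) * r ^ j * ?A" for r
  proof -
    have "(\<integral>u. ?f (scaled n r u) \<partial>usphere n) = (\<integral>u. exp (- r\<^sup>2) * r ^ j * ip n y u ^ j \<partial>usphere n)"
    proof (rule integral_cong_AE)
      have sc: "ip n y (\<lambda>i. r * u i) = r * ip n y u" for u by (simp add: ip_def sum_distrib_left mult_ac)
      show "AE u in usphere n. ?f (scaled n r u) = exp (- r\<^sup>2) * r ^ j * ip n y u ^ j"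
        by (rule eventually_mono[OF AE_unif_sphere[OF n, of 1]]) (simp_all add: sc vnorm_scale power_mult_distrib)
    qed measurable
    then show ?thesis by simp
  qed
  with integral_polar(2)[OF n I] E
  have "?m = (\<integral>r. indicator {0<..} r * (surf n * r ^ (n - 1)) * (exp (- r\<^sup>2) * r ^ j * ?A) \<partial>lborel)"
    by simp
  also have "\<dots> = (\<integral>r. (surf n * ?A) * (indicator {0..} r *\<^sub>R (exp (- r\<^sup>2) * r ^ (n - 1 + j))) \<partial>lborel)"
    by (intro integral_cong_AE) (auto intro!: AE_I[where N="{0}"] simp: power_add split: split_indicator)
  also have "\<dots> = surf n * ?A * half_moment (n - 1 + j)"
    using half_moment_integral[of "n - 1 + j"] by (simp add: has_bochner_integral_iff)
  finally have eq: "?m = surf n * ?A * half_moment (n - 1 + j)" .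
  show ?thesis
  proof (cases "even j")
    case False
    with eq surf_pos[OF n] half_moment_pos[of "n - 1 + j"] show ?thesis by simp
  next
    case True
    then obtain k where j: "j = 2 * k" by (elim evenE)
    let ?p = "pi powr (real n / 2)"
    have P: "pochhammer (real n / 2) k > 0" using n by (intro pochhammer_pos) auto
    have "surf n * ?A * half_moment (n - 1 + j) = ?p * (pochhammer (real n / 2) k * ?A)"
      unfolding j half_moment_shift[OF n] surf_eq[OF n, symmetric] by simp
    with eq True have "?p * (vnorm n y ^ j * fact j / (2 ^ j * fact (j div 2))) = ?p * (pochhammer (real n / 2) k * ?A)" by simp
    moreover have "?p \<noteq> 0" by simp
    ultimately have "vnorm n y ^ j * fact j / (2 ^ j * fact (j div 2)) = pochhammer (real n / 2) k * ?A"
      by (metis mult_left_cancel)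
    then have "?A = vnorm n y ^ j * fact j / (2 ^ j * fact (j div 2)) / pochhammer (real n / 2) k" using P by simp
    with True j show ?thesis by simp
  qed
qed

text \<open>Integrating the exponential series termwise, the odd moments vanish and the even ones
  are the terms of 0F1 at |y|^2/4. The factorials of the exponential cancel those of the normal
  moments.\<close>

lemma sphere_mean_exp:
  assumes n: "1 \<le> n"
  shows "(\<integral>u. exp (ip n y u) \<partial>usphere n) = sphF n (vnorm n y)"
proof (cases "vnorm n y = 0")
  case True
  interpret U: prob_space "usphere n" by (rule prob_space_unif_sphere[OF n])
  have "ip n y u = 0" for u using ip_bound[of n y u] True by simp
  then show ?thesis using U.prob_space True by simp
next
  case False
  interpret U: prob_space "usphere n" by (rule prob_space_unif_sphere[OF n])
  have y: "0 < vnorm n y" using False vnorm_nonneg[of n y] by linarith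
  let ?f = "\<lambda>j u. ip n y u ^ j / fact j"
  have b: "\<bar>?f j u\<bar> \<le> vnorm n y ^ j / fact j" if "vnorm n u = 1" for j u
    using ip_sphere_bound[OF that, of y] by (simp add: power_abs divide_right_mono power_mono)
  have int: "integrable (usphere n) (?f j)" for j
    by (rule sphere_integrable[OF n _ b]) measurable
  have "(\<lambda>j. \<integral>u. ?f j u \<partial>usphere n) sums (\<integral>u. (\<Sum>j. ?f j u) \<partial>usphere n)"
  proof (rule sums_integral[OF int])
    have "summable (\<lambda>j. norm (t ^ j / fact j))" for t :: real
      using summable_norm_exp[of t] by (simp add: divide_inverse mult.commute)
    then show "AE u in usphere n. summable (\<lambda>j. norm (?f j u))" by simp
    show "summable (\<lambda>j. \<integral>u. norm (?f j u) \<partial>usphere n)"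
    proof (rule summable_comparison_test)
      show "summable (\<lambda>j. vnorm n y ^ j / fact j)"
        using summable_exp[of "vnorm n y"] by (simp add: divide_inverse mult.commute)
      have "norm (\<integral>u. norm (?f j u) \<partial>usphere n) \<le> vnorm n y ^ j / fact j" for j
      proof -
        have "(\<integral>u. norm (?f j u) \<partial>usphere n) \<le> (\<integral>u. vnorm n y ^ j / fact j \<partial>usphere n)"
        proof (rule integral_mono_AE)
          show "AE u in usphere n. norm (?f j u) \<le> vnorm n y ^ j / fact j"
            using AE_unif_sphere[OF n, of 1] b by auto
        qed (use int integrable_norm[OF int] in auto)
        then show ?thesis using U.prob_space by simp
      qed
      then show "\<exists>N. \<forall>j\<ge>N. norm (\<integral>u. norm (?f j u) \<partial>usphere n) \<le> vnorm n y ^ j / fact j" by blast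
    qed
  qed
  moreover have "(\<Sum>j. ?f j u) = exp (ip n y u)" for u
    by (simp add: exp_def divide_inverse mult.commute)
  ultimately have S: "(\<lambda>j. \<integral>u. ?f j u \<partial>usphere n) sums (\<integral>u. exp (ip n y u) \<partial>usphere n)" by simp
  have A: "(\<integral>u. ?f j u \<partial>usphere n) =
     (if even j then (vnorm n y) ^ j / (2 ^ j * (fact (j div 2) * pochhammer (real n / 2) (j div 2))) else 0)" for j
    using sphere_moment[OF n y, of j] by simp
  have "(\<lambda>k. \<integral>u. ?f (2 * k) u \<partial>usphere n) sums (\<integral>u. exp (ip n y u) \<partial>usphere n)"
  proof (subst sums_mono_reindex[of "\<lambda>k. 2 * k" "\<lambda>j. \<integral>u. ?f j u \<partial>usphere n"])
    show "strict_mono (\<lambda>k::nat. 2 * k)" by (rule strict_monoI) simp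
    show "(\<integral>u. ?f j u \<partial>usphere n) = 0" if "j \<notin> range (\<lambda>k. 2 * k)" for j
    proof -
      have "odd j" using that by (auto elim!: evenE)
      then show ?thesis unfolding A by simp
    qed
  qed (rule S)
  moreover have "(\<integral>u. ?f (2 * k) u \<partial>usphere n) = ((vnorm n y)\<^sup>2 / 4) ^ k / (fact k * pochhammer (real n / 2) k)" for k
    unfolding A by (simp add: power_mult power_divide)
  ultimately have "(\<lambda>k. ((vnorm n y)\<^sup>2 / 4) ^ k / (fact k * pochhammer (real n / 2) k)) sums (\<integral>u. exp (ip n y u) \<partial>usphere n)"
    by simp
  moreover have "(\<lambda>k. ((vnorm n y)\<^sup>2 / 4) ^ k / (fact k * pochhammer (real n / 2) k)) sums sphF n (vnorm n y)"
    unfolding sphF_def using n by (intro hyp01_sums) auto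
  ultimately show ?thesis by (rule sums_unique2)
qed

section \<open>The norm of a Gaussian vector and the dimension shift\<close>

lemma distr_gmeas_component:
  assumes "0 < s" "i < n"
  shows "distr (gmeas n s x) borel (\<lambda>y. y i) = density lborel (normal_density (x i) (sqrt s))"
proof -
  let ?N = "\<lambda>i. density lborel (\<lambda>t. ennreal (normal_density (x i) (sqrt s) t))"
  have "distr (PiM {..<n} ?N) (?N i) (\<lambda>z. z i) = ?N i"
    by (rule distr_PiM_component) (use assms in \<open>auto intro!: prob_space_normal_density\<close>)
  then show ?thesis unfolding gmeas_eq_PiM[OF assms(1)] by (metis (no_types, lifting) distr_cong sets_density sets_lborel)
qed

lemma gmeas_component_moments:
  assumes s: "0 < s" and i: "i < n"
  shows "integrable (gmeas n s x) (\<lambda>y. y i)" "(\<integral>y. y i \<partial>gmeas n s x) = x i"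
    and "integrable (gmeas n s x) (\<lambda>y. (y i)\<^sup>2)"
proof -
  have m: "(\<lambda>y. y i) \<in> measurable (gmeas n s x) borel"
    unfolding measurable_cong_sets[OF sets_gmeas refl] by (rule lborel_n_component[OF i])
  have \<sigma>: "0 < sqrt s" using s by simp
  have 1: "has_bochner_integral (density lborel (normal_density (x i) (sqrt s))) (\<lambda>t. t) (x i)"
    by (intro has_bochner_integral_density) (use normal_moment_nz_1[OF \<sigma>] in auto)
  \<comment> \<open>Writes t^2 as (t - x)^2 + 2 x t - x^2, so that the central second moment and the
    first moment suffice.\<close>
  have "integrable lborel (\<lambda>t. normal_density (x i) (sqrt s) t * (t - x i) ^ 2 + 2 * x i * (normal_density (x i) (sqrt s) t * t)
     - (x i)\<^sup>2 * normal_density (x i) (sqrt s) t)"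
    using \<sigma> by (intro Bochner_Integration.integrable_add Bochner_Integration.integrable_diff integrable_normal_moment
       integrable_mult_right integrable_normal_moment_nz_1 integrable_normal_density)
  then have "integrable lborel (\<lambda>t. normal_density (x i) (sqrt s) t * t\<^sup>2)"
    by (rule Bochner_Integration.integrable_cong[THEN iffD1, rotated 2]) (auto simp: power2_eq_square algebra_simps)
  then have 2: "integrable (density lborel (normal_density (x i) (sqrt s))) (\<lambda>t. t\<^sup>2)"
    by (subst integrable_density) auto
  note D = distr_gmeas_component[OF s i, of x]
  show "integrable (gmeas n s x) (\<lambda>y. y i)"
    using 1 integrable_distr_eq[OF m, of "\<lambda>t. t"] unfolding has_bochner_integral_iff D by simp
  show "(\<integral>y. y i \<partial>gmeas n s x) = x i"
    using 1 integral_distr[OF m, of "\<lambda>t. t"] unfolding has_bochner_integral_iff D by simp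
  show "integrable (gmeas n s x) (\<lambda>y. (y i)\<^sup>2)"
    using 2 integrable_distr_eq[OF m, of "\<lambda>t. t\<^sup>2"] unfolding D by simp
qed

lemma integrable_gmeas_vnorm2: "0 < s \<Longrightarrow> integrable (gmeas n s x) (\<lambda>y. (vnorm n y)\<^sup>2)"
  unfolding vnorm_power2 by (intro Bochner_Integration.integrable_sum gmeas_component_moments) auto

lemma integrable_gmeas_quad:
  fixes h :: "(nat \<Rightarrow> real) \<Rightarrow> real"
  assumes s: "0 < s" and [measurable]: "h \<in> borel_measurable (lborel_n n)"
    and b: "\<And>y. \<bar>h y\<bar> \<le> A + B * (vnorm n y)\<^sup>2"
  shows "integrable (gmeas n s x) h"
proof (rule Bochner_Integration.integrable_bound)
  interpret prob_space "gmeas n s x" by (rule prob_space_gmeas[OF s])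
  show "integrable (gmeas n s x) (\<lambda>y. A + B * (vnorm n y)\<^sup>2)"
    using integrable_gmeas_vnorm2[OF s, of n x] by simp
  have "norm (h y) \<le> norm (A + B * (vnorm n y)\<^sup>2)" for y using b[of y] by simp
  then show "AE y in gmeas n s x. norm (h y) \<le> norm (A + B * (vnorm n y)\<^sup>2)" by simp
qed measurable

lemma gmeas_ip_mean:
  assumes "0 < s"
  shows "integrable (gmeas n s x) (ip n a)" "(\<integral>y. ip n a y \<partial>gmeas n s x) = ip n a x"
  unfolding ip_def[abs_def] using gmeas_component_moments[OF assms]
  by (auto intro!: Bochner_Integration.integrable_sum simp: Bochner_Integration.integral_sum)

text \<open>The density of the norm of a vector \<open>N(x, s I_n)\<close> with
  \<open>vnorm n x = \<rho>\<close>: the noncentral chi density scaled by \<open>sqrt s\<close>,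
  with its Bessel factor written as \<open>sphF\<close>.\<close>

definition chi :: "nat \<Rightarrow> real \<Rightarrow> real \<Rightarrow> real \<Rightarrow> real" where
  "chi n s \<rho> r = indicator {0<..} r * (surf n * gconst n s * r ^ (n - 1)
     * exp (- (r\<^sup>2 + \<rho>\<^sup>2) / (2 * s)) * sphF n (r * \<rho> / s))"

definition chi_meas :: "nat \<Rightarrow> real \<Rightarrow> real \<Rightarrow> real measure" where
  "chi_meas n s \<rho> = density lborel (\<lambda>r. ennreal (chi n s \<rho> r))"

lemma sets_chi_meas [simp, measurable_cong]: "sets (chi_meas n s \<rho>) = sets borel"
  and space_chi_meas [simp]: "space (chi_meas n s \<rho>) = UNIV"
  by (simp_all add: chi_meas_def)

lemma chi_nonneg: "1 \<le> n \<Longrightarrow> 0 \<le> chi n s \<rho> r"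
  using surf_pos[of n] sphF_pos[of n "r * \<rho> / s"] by (auto simp: chi_def split: split_indicator)

lemma borel_measurable_chi: "1 \<le> n \<Longrightarrow> chi n s \<rho> \<in> borel_measurable borel"
proof -
  assume "1 \<le> n"
  note [measurable] = borel_measurable_sphF[OF this]
  show ?thesis unfolding chi_def[abs_def] by measurable
qed

lemma gauss_polar:
  assumes "vnorm n u = 1"
  shows "gauss n s x (scaled n r u) =
    gconst n s * exp (- (r\<^sup>2 + (vnorm n x)\<^sup>2) / (2 * s)) * exp (r / s * ip n x u)"
proof -
  have "ip n x (\<lambda>i. r * u i) = r * ip n x u" by (simp add: ip_def sum_distrib_left mult_ac)
  then have "- ((vnorm n (scaled n r u))\<^sup>2 - 2 * ip n x (scaled n r u) + (vnorm n x)\<^sup>2) / (2 * s)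
      = - (r\<^sup>2 + (vnorm n x)\<^sup>2) / (2 * s) + r / s * ip n x u"
    using assms by (simp add: vnorm_scale diff_divide_distrib add_divide_distrib minus_divide_left[symmetric])
  then show ?thesis unfolding gauss_alt by (simp add: exp_add)
qed

lemma ip_scale_left: "ip n (\<lambda>i. c * x i) y = c * ip n x y"
  by (simp add: ip_def sum_distrib_left mult_ac)

lemma sphere_exp_integrable: "1 \<le> n \<Longrightarrow> integrable (usphere n) (\<lambda>u. exp (ip n y u))"
  by (rule sphere_integrable[where B = "exp (vnorm n y)"]) (use ip_sphere_bound in \<open>force simp: abs_le_iff\<close>)+

lemma nn_sphere_mean_exp:
  assumes n: "1 \<le> n"
  shows "(\<integral>\<^sup>+u. ennreal (exp (c * ip n y u)) \<partial>usphere n) = ennreal (sphF n (\<bar>c\<bar> * vnorm n y))"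
  using sphere_mean_exp[OF n, of "\<lambda>i. c * y i"] nn_integral_eq_integral[OF sphere_exp_integrable[OF n, of "\<lambda>i. c * y i"]]
  by (simp add: vnorm_scale ip_scale_left)

text \<open>At radius r the Gaussian density splits into a radial factor and exp(<x,u> r / s). Its
  spherical mean is \<open>sphF\<close>, so the law of the norm depends on the centre only through
  \<open>vnorm n x\<close>.\<close>

lemma norm_law:
  assumes n: "1 \<le> n" and s: "0 < s"
  shows "distr (gmeas n s x) borel (vnorm n) = chi_meas n s (vnorm n x)"
proof (rule measure_eqI)
  fix A assume "A \<in> sets (distr (gmeas n s x) borel (vnorm n))"
  then have A [measurable]: "A \<in> sets borel" by simp
  note [measurable] = borel_measurable_chi[OF n]
  let ?\<rho> = "vnorm n x"
  let ?N = "\<lambda>r. \<integral>\<^sup>+u. ennreal (gauss n s x (scaled n r u)) * indicator A (vnorm n (scaled n r u)) \<partial>usphere n"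
  have [measurable]: "vnorm n -` A \<inter> space (lborel_n n) \<in> sets (lborel_n n)"
    by (rule measurable_sets[OF borel_measurable_vnorm A])
  have "emeasure (distr (gmeas n s x) borel (vnorm n)) A = emeasure (gmeas n s x) (vnorm n -` A \<inter> space (lborel_n n))"
    by (subst emeasure_distr) auto
  also have "\<dots> = (\<integral>\<^sup>+y. ennreal (gauss n s x y) * indicator A (vnorm n y) \<partial>lborel_n n)"
    unfolding gmeas_def by (subst emeasure_density) (auto intro!: nn_integral_cong split: split_indicator)
  also have "\<dots> = (\<integral>\<^sup>+r. ennreal (surf n * r ^ (n - 1)) * indicator {0<..} r
        * ?N r \<partial>lborel)"
    by (rule nn_integral_polar[OF n]) measurable
  also have "\<dots> = (\<integral>\<^sup>+r. ennreal (chi n s ?\<rho> r) * indicator A r \<partial>lborel)"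
  proof (rule nn_integral_cong)
    fix r :: real
    let ?C = "gconst n s * exp (- (r\<^sup>2 + ?\<rho>\<^sup>2) / (2 * s))"
    show "ennreal (surf n * r ^ (n - 1)) * indicator {0<..} r
        * ?N r
      = ennreal (chi n s ?\<rho> r) * indicator A r"
    proof (cases "0 < r")
      case True
      have "?N r
        = (\<integral>\<^sup>+u. ennreal ?C * indicator A r * ennreal (exp (r / s * ip n x u)) \<partial>usphere n)"
      proof (rule nn_integral_cong_AE, rule eventually_mono[OF AE_unif_sphere[OF n, of 1]])
        fix u assume u: "vnorm n u = 1"
        show "ennreal (gauss n s x (scaled n r u)) * indicator A (vnorm n (scaled n r u))
          = ennreal ?C * indicator A r * ennreal (exp (r / s * ip n x u))"
          unfolding gauss_polar[OF u] using True u
          by (auto simp: vnorm_scale ennreal_mult' split: split_indicator)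
      qed simp
      also have "\<dots> = ennreal ?C * indicator A r * ennreal (sphF n (r * ?\<rho> / s))"
        using True s nn_sphere_mean_exp[OF n, of "r / s" x] by (subst nn_integral_cmult) auto
      finally have eq: "?N r
        = ennreal ?C * indicator A r * ennreal (sphF n (r * ?\<rho> / s))" .
      have c: "chi n s ?\<rho> r = (surf n * r ^ (n - 1)) * ?C * sphF n (r * ?\<rho> / s)"
        using True by (simp add: chi_def)
      have "ennreal (chi n s ?\<rho> r) = ennreal (surf n * r ^ (n - 1)) * ennreal ?C * ennreal (sphF n (r * ?\<rho> / s))"
        unfolding c using True surf_pos[OF n] sphF_pos[OF n, of "r * ?\<rho> / s"]
        by (subst ennreal_mult, simp, simp, subst ennreal_mult) auto
      with True show ?thesis unfolding eq by (simp add: mult_ac)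
    qed (simp add: chi_def)
  qed
  also have "\<dots> = emeasure (chi_meas n s ?\<rho>) A"
    unfolding chi_meas_def by (rule emeasure_density[symmetric]) auto
  finally show "emeasure (distr (gmeas n s x) borel (vnorm n)) A = emeasure (chi_meas n s ?\<rho>) A" .
qed simp

lemma norm_law_integral:
  fixes g :: "real \<Rightarrow> real"
  assumes "1 \<le> n" "0 < s" and [measurable]: "g \<in> borel_measurable borel"
  shows "(\<integral>y. g (vnorm n y) \<partial>gmeas n s x) = (\<integral>r. g r \<partial>chi_meas n s (vnorm n x))"
    and "integrable (gmeas n s x) (\<lambda>y. g (vnorm n y)) \<longleftrightarrow> integrable (chi_meas n s (vnorm n x)) g"
proof -
  have [measurable]: "vnorm n \<in> measurable (gmeas n s x) borel" by measurable
  show "(\<integral>y. g (vnorm n y) \<partial>gmeas n s x) = (\<integral>r. g r \<partial>chi_meas n s (vnorm n x))"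
    unfolding norm_law[OF assms(1,2), symmetric] by (rule integral_distr[symmetric]) measurable
  show "integrable (gmeas n s x) (\<lambda>y. g (vnorm n y)) \<longleftrightarrow> integrable (chi_meas n s (vnorm n x)) g"
    unfolding norm_law[OF assms(1,2), symmetric] by (rule integrable_distr_eq[symmetric]) measurable
qed

definition e0 :: "real \<Rightarrow> nat \<Rightarrow> real" where
  "e0 \<tau> = (\<lambda>i. if i = 0 then \<tau> else 0)"

lemma vnorm_e0: "1 \<le> n \<Longrightarrow> vnorm n (e0 \<tau>) = \<bar>\<tau>\<bar>"
  and ip_e0: "1 \<le> n \<Longrightarrow> ip n (e0 \<tau>) y = \<tau> * y 0"
  by (simp_all add: vnorm_def e0_def ip_def if_distrib[of "\<lambda>c. c\<^sup>2"] if_distrib[of "\<lambda>c. c * _"] sum.delta cong: if_cong)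

lemma prob_space_chi_meas:
  assumes n: "1 \<le> n" and s: "0 < s" and "0 \<le> \<rho>"
  shows "prob_space (chi_meas n s \<rho>)"
proof -
  interpret prob_space "gmeas n s (e0 \<rho>)" by (rule prob_space_gmeas[OF s])
  have "prob_space (distr (gmeas n s (e0 \<rho>)) borel (vnorm n))"
    by (rule prob_space_distr) measurable
  then show ?thesis unfolding norm_law[OF n s] using assms by (simp add: vnorm_e0)
qed

text \<open>Serves to match the normalising constants of the chi densities in dimensions n and n +
  2.\<close>

lemma surf_rec:
  assumes n: "1 \<le> n"
  shows "surf (n + 2) = 2 * pi / real n * surf n"
proof -
  have "surf (n + 2) * half_moment (n + 2 - 1) = pi powr (real (n + 2) / 2)" by (rule surf_eq) simp
  also have "\<dots> = pi powr (real n / 2 + 1)" by (simp add: add_divide_distrib add.commute)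
  also have "\<dots> = pi * pi powr (real n / 2)" by (simp add: powr_add)
  also have "pi powr (real n / 2) = surf n * half_moment (n - 1)" by (rule surf_eq[OF n, symmetric])
  also have "half_moment (n + 2 - 1) = real n / 2 * half_moment (n - 1)"
    using half_moment_rec[of "n - 1"] n by simp
  finally show ?thesis using half_moment_pos[of "n - 1"] n by (simp add: field_simps)
qed

text \<open>The convex function \<open>h \<mapsto> E exp ((z + h) X) - h E (X exp (z X))\<close> is minimal at \<open>h = 0\<close>,
  which identifies \<open>E (X exp (z X))\<close> with a derivative without differentiating under the integral.\<close>

lemma sphere_mean_ip_exp:
  assumes n: "1 \<le> n" and z: "0 \<le> z"
  shows "integrable (usphere n) (\<lambda>u. ip n x u * exp (z * ip n x u))" (is "integrable _ ?g")
    and "(\<integral>u. ip n x u * exp (z * ip n x u) \<partial>usphere n) = (vnorm n x)\<^sup>2 * z / real n * sphF (n + 2) (z * vnorm n x)"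
proof -
  interpret U: prob_space "usphere n" by (rule prob_space_unif_sphere[OF n])
  let ?\<rho> = "vnorm n x"
  show I: "integrable (usphere n) ?g"
  proof (rule sphere_integrable[OF n])
    fix u assume "vnorm n u = 1"
    note b = ip_sphere_bound[OF this, of x]
    have "z * ip n x u \<le> z * ?\<rho>" using b z by (intro mult_left_mono) auto
    then show "\<bar>?g u\<bar> \<le> ?\<rho> * exp (z * ?\<rho>)"
      unfolding abs_mult using b by (intro mult_mono) auto
  qed measurable
  let ?E = "\<integral>u. ?g u \<partial>usphere n"
  let ?\<phi> = "\<lambda>w. sphF n (w * ?\<rho>)"
  have sph: "sphF n (\<bar>c\<bar>) = sphF n c" for c by (simp add: sphF_def)
  have \<phi>: "(\<integral>u. exp (w * ip n x u) \<partial>usphere n) = ?\<phi> w"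
    and Ie: "integrable (usphere n) (\<lambda>u. exp (w * ip n x u))" for w
    using sphere_mean_exp[OF n, of "\<lambda>i. w * x i"] sph[of "w * ?\<rho>"] sphere_exp_integrable[OF n, of "\<lambda>i. w * x i"]
    by (simp_all add: vnorm_scale ip_scale_left abs_mult)
  have min: "?\<phi> z - (z - z) * ?E \<le> ?\<phi> w - (w - z) * ?E" for w
  proof -
    have "(\<integral>u. exp (z * ip n x u) + (w - z) * ?g u \<partial>usphere n) \<le> (\<integral>u. exp (w * ip n x u) \<partial>usphere n)"
    proof (rule integral_mono)
      fix u
      have "exp (z * ip n x u) * (1 + (w - z) * ip n x u) \<le> exp (z * ip n x u) * exp ((w - z) * ip n x u)"
        by (intro mult_left_mono exp_ge_add_one_self) auto
      also have "\<dots> = exp (w * ip n x u)" by (simp add: exp_add[symmetric] algebra_simps)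
      finally show "exp (z * ip n x u) + (w - z) * ?g u \<le> exp (w * ip n x u)" by (simp add: algebra_simps)
    qed (use I Ie in auto)
    moreover have "(\<integral>u. exp (z * ip n x u) + (w - z) * ?g u \<partial>usphere n) = ?\<phi> z + (w - z) * ?E"
      using I Ie by (subst Bochner_Integration.integral_add) (auto simp: \<phi>)
    ultimately show ?thesis unfolding \<phi> by simp
  qed
  have D: "((\<lambda>w. ?\<phi> w - (w - z) * ?E) has_real_derivative (z * ?\<rho> / real n * sphF (n + 2) (z * ?\<rho>) * ?\<rho> - ?E)) (at z)"
    by (intro DERIV_diff DERIV_chain2[OF DERIV_sphF[OF n]]) (auto intro!: derivative_eq_intros)
  have "z * ?\<rho> / real n * sphF (n + 2) (z * ?\<rho>) * ?\<rho> - ?E = 0"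
    by (rule DERIV_local_min[OF D, of 1]) (use min in auto)
  then show "?E = ?\<rho>\<^sup>2 * z / real n * sphF (n + 2) (z * ?\<rho>)" by (simp add: power2_eq_square mult_ac)
qed

text \<open>The factor <x,y> turns the spherical mean of the exponential into its derivative:
  \<open>sphF\<close> moves from n to n + 2 and two further powers of r appear. Together they form
  the chi density in dimension n + 2. Applied to the gradient of \<open>logF\<close>, this produces
  the n + 2 of Assumption (A).\<close>

lemma dimension_shift:
  fixes g :: "real \<Rightarrow> real"
  assumes n: "1 \<le> n" and s: "0 < s" and [measurable]: "g \<in> borel_measurable borel" and b: "\<And>r. \<bar>g r\<bar> \<le> K"
  shows "(\<integral>y. g (vnorm n y) * ip n x y \<partial>gmeas n s x) = (vnorm n x)\<^sup>2 * (\<integral>r. g r \<partial>chi_meas (n + 2) s (vnorm n x))"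
proof -
  let ?\<rho> = "vnorm n x" and ?U = "usphere n"
  let ?h = "\<lambda>y. g (vnorm n y) * ip n x y"
  let ?f = "\<lambda>r u. gauss n s x (scaled n r u) * ?h (scaled n r u)"
  have K: "0 \<le> K" using b[of 0] by simp
  have n2: "1 \<le> n + 2" by simp
  note [measurable] = borel_measurable_chi[OF n2]
  have "integrable (gmeas n s x) ?h"
  proof (rule integrable_gmeas_quad[OF s])
    fix y
    have "\<bar>?h y\<bar> \<le> K * (?\<rho> * vnorm n y)"
      unfolding abs_mult using b ip_bound K by (intro mult_mono) auto
    also have "\<dots> = K * ?\<rho> * vnorm n y" by simp
    also have "\<dots> \<le> K * ?\<rho> * (1 + (vnorm n y)\<^sup>2)"
      by (rule mult_left_mono[OF vnorm_le_quad]) (use K in simp)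
    finally show "\<bar>?h y\<bar> \<le> K * ?\<rho> + K * ?\<rho> * (vnorm n y)\<^sup>2" by (simp add: algebra_simps)
  qed measurable
  then have I: "integrable (lborel_n n) (\<lambda>y. gauss n s x y * ?h y)"
    unfolding gmeas_def by (subst (asm) integrable_density) auto
  let ?C = "\<lambda>r. gconst n s * exp (- (r\<^sup>2 + ?\<rho>\<^sup>2) / (2 * s))"
  have inner: "(\<integral>u. ?f r u \<partial>?U)
    = ?C r * g r * r * (?\<rho>\<^sup>2 * (r / s) / real n * sphF (n + 2) (r / s * ?\<rho>))" if r: "0 < r" for r
  proof -
    have m: "(\<lambda>u. gauss n s x (scaled n r u)) \<in> borel_measurable ?U"
      "(\<lambda>u. g (vnorm n (scaled n r u))) \<in> borel_measurable ?U"
      "(\<lambda>u. ip n x (scaled n r u)) \<in> borel_measurable ?U"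
      by (rule measurable_compose[OF scale_measurable gauss_measurable, folded measurable_cong_sets[OF sets_unif_sphere[of n 1] refl]]
          measurable_compose[OF scale_measurable, of _ n, folded measurable_cong_sets[OF sets_unif_sphere[of n 1] refl]], measurable)+
    have "(\<integral>u. ?f r u \<partial>?U)
      = (\<integral>u. ?C r * g r * r * (ip n x u * exp (r / s * ip n x u)) \<partial>?U)"
    proof (rule integral_cong_AE)
      show "(\<lambda>u. ?f r u) \<in> borel_measurable ?U"
        by (rule borel_measurable_times[OF m(1) borel_measurable_times[OF m(2,3)]])
      show "AE u in ?U. ?f r u
        = ?C r * g r * r * (ip n x u * exp (r / s * ip n x u))"
      proof (rule eventually_mono[OF AE_unif_sphere[OF n, of 1]])
        fix u assume u: "vnorm n u = 1"
        have "ip n x (\<lambda>i. r * u i) = r * ip n x u" by (simp add: ip_def sum_distrib_left mult_ac)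
        then show "?f r u
          = ?C r * g r * r * (ip n x u * exp (r / s * ip n x u))"
          unfolding gauss_polar[OF u] using r u by (simp add: vnorm_scale)
      qed simp
    qed measurable
    also have "\<dots> = ?C r * g r * r * (\<integral>u. ip n x u * exp (r / s * ip n x u) \<partial>?U)"
      by simp
    also have "\<dots> = ?C r * g r * r * (?\<rho>\<^sup>2 * (r / s) / real n * sphF (n + 2) (r / s * ?\<rho>))"
      using r s by (subst sphere_mean_ip_exp(2)[OF n]) auto
    finally show ?thesis .
  qed
  have "(\<integral>y. ?h y \<partial>gmeas n s x) = (\<integral>y. gauss n s x y * ?h y \<partial>lborel_n n)"
    unfolding gmeas_def by (subst integral_density) auto
  also have "\<dots> = (\<integral>r. indicator {0<..} r * (surf n * r ^ (n - 1)) *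
     (\<integral>u. ?f r u \<partial>?U) \<partial>lborel)"
    by (rule integral_polar(2)[OF n I])
  also have "\<dots> = (\<integral>r. ?\<rho>\<^sup>2 * (chi (n + 2) s ?\<rho> r * g r) \<partial>lborel)"
  proof (rule Bochner_Integration.integral_cong[OF refl])
    fix r :: real
    show "indicator {0<..} r * (surf n * r ^ (n - 1)) *
     (\<integral>u. ?f r u \<partial>?U)
     = ?\<rho>\<^sup>2 * (chi (n + 2) s ?\<rho> r * g r)"
    proof (cases "0 < r")
      case True
      \<comment> \<open>The additional 1/(2 pi s) and the 2 pi / n of \<open>surf_rec\<close>
        combine to 1/(n s), the constant delivered by \<open>inner\<close>.\<close>
      have p: "(2 * pi * s) powr (- real (n + 2) / 2) = gconst n s / (2 * pi * s)"
      proof -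
        have "- real (n + 2) / 2 = - real n / 2 - 1" by simp
        then show ?thesis using s by (simp only: powr_diff) simp
      qed
      have rn: "r ^ (n + 2 - 1) = r ^ (n - 1) * (r * r)" using n by (cases n) auto
      have arg: "r * ?\<rho> / s = r / s * ?\<rho>" by simp
      show ?thesis
        unfolding inner[OF True] chi_def surf_rec[OF n] p rn arg using True s n by (simp add: field_simps)
    qed (simp add: chi_def)
  qed
  also have "\<dots> = ?\<rho>\<^sup>2 * (\<integral>r. g r \<partial>chi_meas (n + 2) s ?\<rho>)"
    unfolding chi_meas_def using borel_measurable_chi[OF n2] chi_nonneg[OF n2] by (subst integral_density) auto
  finally show ?thesis .
qed

section \<open>The divergence profile along a ray\<close>

lemma integral_gmeas_affine:
  fixes f :: "(nat \<Rightarrow> real) \<Rightarrow> real"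
  assumes s: "0 < s" and [measurable]: "f \<in> borel_measurable (lborel_n n)"
  shows "(\<integral>y. f y \<partial>gmeas n s x) = (\<integral>z. f (restrict (\<lambda>i. x i + sqrt s * z i) {..<n}) \<partial>std_gauss_n n)"
    and "integrable (gmeas n s x) f \<longleftrightarrow> integrable (std_gauss_n n) (\<lambda>z. f (restrict (\<lambda>i. x i + sqrt s * z i) {..<n}))"
proof -
  have [measurable]: "(\<lambda>z. restrict (\<lambda>i. x i + sqrt s * z i) {..<n}) \<in> measurable (std_gauss_n n) (lborel_n n)"
    by (rule restrict_measurable_lborel_n) measurable
  show "(\<integral>y. f y \<partial>gmeas n s x) = (\<integral>z. f (restrict (\<lambda>i. x i + sqrt s * z i) {..<n}) \<partial>std_gauss_n n)"
    unfolding gmeas_affine[OF s, symmetric] by (rule integral_distr) measurable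
  show "integrable (gmeas n s x) f \<longleftrightarrow> integrable (std_gauss_n n) (\<lambda>z. f (restrict (\<lambda>i. x i + sqrt s * z i) {..<n}))"
    unfolding gmeas_affine[OF s, symmetric] by (rule integrable_distr_eq) measurable
qed

text \<open>Two independent noise stages by Fubini. By \<open>gauss_convolution\<close> the absolute
  double integral collapses to an integral under the total variance, so integrability there is
  enough.\<close>

lemma gmeas_convolution:
  fixes \<phi> :: "(nat \<Rightarrow> real) \<Rightarrow> real"
  assumes s: "0 < s" and t: "0 < t" and I: "integrable (gmeas n (s + t) x) \<phi>"
  shows "integrable (lborel_n n \<Otimes>\<^sub>M lborel_n n) (\<lambda>(z, y). gauss n s x z * gauss n t z y * \<phi> y)"
    and "(\<integral>y. \<phi> y \<partial>gmeas n (s + t) x) = (\<integral>z. (\<integral>y. \<phi> y \<partial>gmeas n t z) \<partial>gmeas n s x)"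
proof -
  interpret L: sigma_finite_measure "lborel_n n" by (rule sigma_finite_lborel_n)
  interpret P: pair_sigma_finite "lborel_n n" "lborel_n n" ..
  have \<phi> [measurable]: "\<phi> \<in> borel_measurable (lborel_n n)" using I by auto
  have m [measurable]: "(\<lambda>(z, y). gauss n t z y) \<in> borel_measurable (lborel_n n \<Otimes>\<^sub>M lborel_n n)"
    unfolding case_prod_beta by measurable
  let ?f = "\<lambda>(z, y). gauss n s x z * gauss n t z y * \<phi> y"
  have I': "integrable (lborel_n n) (\<lambda>y. gauss n (s + t) x y * \<phi> y)"
    using I unfolding gmeas_def by (subst (asm) integrable_density) auto
  show int: "integrable (lborel_n n \<Otimes>\<^sub>M lborel_n n) ?f"
  proof (rule integrableI_bounded)
    show "?f \<in> borel_measurable (lborel_n n \<Otimes>\<^sub>M lborel_n n)" by measurable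
    have "(\<integral>\<^sup>+p. ennreal (norm (?f p)) \<partial>(lborel_n n \<Otimes>\<^sub>M lborel_n n))
      = (\<integral>\<^sup>+y. (\<integral>\<^sup>+z. ennreal (norm (?f (z, y))) \<partial>lborel_n n) \<partial>lborel_n n)"
      by (rule P.nn_integral_snd[symmetric]) measurable
    also have "\<dots> = (\<integral>\<^sup>+y. ennreal (norm (gauss n (s + t) x y * \<phi> y)) \<partial>lborel_n n)"
    proof (rule nn_integral_cong)
      fix y
      have "(\<integral>\<^sup>+z. ennreal (norm (?f (z, y))) \<partial>lborel_n n) = (\<integral>\<^sup>+z. ennreal (gauss n s x z * gauss n t z y) * ennreal (norm (\<phi> y)) \<partial>lborel_n n)"
        by (intro nn_integral_cong) (simp add: abs_mult ennreal_mult'[symmetric])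
      also have "\<dots> = ennreal (gauss n (s + t) x y) * ennreal (norm (\<phi> y))"
        by (subst nn_integral_multc) (auto simp: gauss_convolution[OF s t])
      finally show "(\<integral>\<^sup>+z. ennreal (norm (?f (z, y))) \<partial>lborel_n n) = ennreal (norm (gauss n (s + t) x y * \<phi> y))"
        by (simp add: abs_mult ennreal_mult')
    qed
    also have "\<dots> < \<infinity>" using I' by (simp add: integrable_iff_bounded)
    finally show "(\<integral>\<^sup>+p. ennreal (norm (?f p)) \<partial>(lborel_n n \<Otimes>\<^sub>M lborel_n n)) < \<infinity>" .
  qed
  have conv: "(\<integral>z. gauss n s x z * gauss n t z y \<partial>lborel_n n) = gauss n (s + t) x y" for y
    using gauss_convolution[OF s t, of n x y]
    by (intro integral_eq_nn_integral[THEN trans]) (auto)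
  have "(\<integral>y. \<phi> y \<partial>gmeas n (s + t) x) = (\<integral>y. gauss n (s + t) x y * \<phi> y \<partial>lborel_n n)"
    unfolding gmeas_def by (subst integral_density) auto
  also have "\<dots> = (\<integral>y. (\<integral>z. gauss n s x z * gauss n t z y * \<phi> y \<partial>lborel_n n) \<partial>lborel_n n)"
    by (simp add: conv)
  also have "\<dots> = (\<integral>z. (\<integral>y. gauss n s x z * gauss n t z y * \<phi> y \<partial>lborel_n n) \<partial>lborel_n n)"
    by (rule P.Fubini_integral[of "\<lambda>z y. gauss n s x z * gauss n t z y * \<phi> y", OF int])
  also have "\<dots> = (\<integral>z. gauss n s x z * (\<integral>y. gauss n t z y * \<phi> y \<partial>lborel_n n) \<partial>lborel_n n)"
    by (simp add: mult.assoc)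
  also have "\<dots> = (\<integral>z. gauss n s x z * (\<integral>y. \<phi> y \<partial>gmeas n t z) \<partial>lborel_n n)"
    unfolding gmeas_def by (subst integral_density) auto
  also have "\<dots> = (\<integral>z. (\<integral>y. \<phi> y \<partial>gmeas n t z) \<partial>gmeas n s x)"
  proof -
    have "(\<lambda>z. \<integral>y. \<phi> y \<partial>gmeas n t z) \<in> borel_measurable (lborel_n n)"
    proof -
      have "(\<lambda>z. \<integral>y. gauss n t z y * \<phi> y \<partial>lborel_n n) \<in> borel_measurable (lborel_n n)" 
        by (rule L.borel_measurable_lebesgue_integral) measurable
      then show ?thesis unfolding gmeas_def by (subst integral_density) auto
    qed
    then show ?thesis unfolding gmeas_def[of n s] by (subst integral_density) auto
  qed
  finally show "(\<integral>y. \<phi> y \<partial>gmeas n (s + t) x) = (\<integral>z. (\<integral>y. \<phi> y \<partial>gmeas n t z) \<partial>gmeas n s x)" .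
qed

lemma sphF_even: "sphF n \<bar>z\<bar> = sphF n z" by (simp add: sphF_def)

lemma sphF_le_exp:
  assumes n: "1 \<le> n"
  shows "sphF n z \<le> exp \<bar>z\<bar>"
proof -
  interpret U: prob_space "usphere n" by (rule prob_space_unif_sphere[OF n])
  have "sphF n z = (\<integral>u. exp (ip n (e0 z) u) \<partial>usphere n)"
    using sphere_mean_exp[OF n, of "e0 z"] n by (simp add: vnorm_e0 sphF_even)
  also have "\<dots> \<le> (\<integral>u. exp \<bar>z\<bar> \<partial>usphere n)"
  proof (rule integral_mono_AE)
    show "AE u in usphere n. exp (ip n (e0 z) u) \<le> exp \<bar>z\<bar>"
    proof (rule eventually_mono[OF AE_unif_sphere[OF n, of 1]])
      fix u assume "vnorm n u = 1"
      from ip_sphere_bound[OF this, of "e0 z"] n show "exp (ip n (e0 z) u) \<le> exp \<bar>z\<bar>" by (simp add: vnorm_e0)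
    qed simp
  qed (use sphere_exp_integrable[OF n] in auto)
  also have "\<dots> = exp \<bar>z\<bar>" using U.prob_space by simp
  finally show ?thesis .
qed

text \<open>The left side is the spherical mean of a coordinate times its exponential, and that
  coordinate is at most 1. In Bessel terms the ratio \<open>hb (real n / 2) z\<close> is at most
  1.\<close>

lemma sphF_ratio_le:
  assumes n: "1 \<le> n" and z: "0 \<le> z"
  shows "z / real n * sphF (n + 2) z \<le> sphF n z"
proof -
  have "z / real n * sphF (n + 2) z = (\<integral>u. ip n (e0 1) u * exp (z * ip n (e0 1) u) \<partial>usphere n)"
    using sphere_mean_ip_exp(2)[OF n z, of "e0 1"] n by (simp add: vnorm_e0)
  also have "\<dots> \<le> (\<integral>u. exp (z * ip n (e0 1) u) \<partial>usphere n)"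
  proof (rule integral_mono_AE)
    show "AE u in usphere n. ip n (e0 1) u * exp (z * ip n (e0 1) u) \<le> exp (z * ip n (e0 1) u)"
    proof (rule eventually_mono[OF AE_unif_sphere[OF n, of 1]])
      fix u assume "vnorm n u = 1"
      from ip_sphere_bound[OF this, of "e0 1"] n have "ip n (e0 1) u \<le> 1" by (simp add: vnorm_e0)
      then show "ip n (e0 1) u * exp (z * ip n (e0 1) u) \<le> exp (z * ip n (e0 1) u)" by simp
    qed simp
  qed (use sphere_mean_ip_exp(1)[OF n z, of "e0 1"] sphere_exp_integrable[OF n, of "\<lambda>i. z * e0 1 i"] in \<open>auto simp: ip_scale_left\<close>)
  also have "\<dots> = sphF n z"
    using sphere_mean_exp[OF n, of "\<lambda>i. z * e0 1 i"] z n by (simp add: ip_scale_left vnorm_scale vnorm_e0)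
  finally show ?thesis .
qed

text \<open>The part of the logarithm of the spherical output density that is not quadratic in the
  radius.\<close>

definition logF :: "nat \<Rightarrow> real \<Rightarrow> real \<Rightarrow> real \<Rightarrow> real" where
  "logF n R s r = ln (sphF n (R * r / s))"

text \<open>The radial derivative of \<open>logF\<close> divided by r, which equals R / (s r) times
  the Bessel ratio at R r / s. In this form it has no singularity at r = 0.\<close>

definition score :: "nat \<Rightarrow> real \<Rightarrow> real \<Rightarrow> real \<Rightarrow> real" where
  "score n R s r = R\<^sup>2 / (s\<^sup>2 * real n) * (sphF (n + 2) (R * r / s) / sphF n (R * r / s))"

lemma borel_measurable_logF [measurable]: "1 \<le> n \<Longrightarrow> logF n R s \<in> borel_measurable borel"
  and borel_measurable_score [measurable]: "1 \<le> n \<Longrightarrow> score n R s \<in> borel_measurable borel"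
proof -
  assume n: "1 \<le> n"
  have n2: "1 \<le> n + 2" by simp
  note [measurable] = borel_measurable_sphF[OF n] borel_measurable_sphF[OF n2]
  show "logF n R s \<in> borel_measurable borel" "score n R s \<in> borel_measurable borel"
    unfolding logF_def[abs_def] score_def[abs_def] by measurable
qed

lemma logF_bounds:
  assumes "1 \<le> n" "0 < s" "0 \<le> R"
  shows "0 \<le> logF n R s r" "logF n R s r \<le> R / s * \<bar>r\<bar>"
proof -
  show "0 \<le> logF n R s r" using sphF_ge_1[OF assms(1)] by (simp add: logF_def)
  have "ln (sphF n (R * r / s)) \<le> \<bar>R * r / s\<bar>"
    using sphF_le_exp[OF assms(1), of "R * r / s"] sphF_pos[OF assms(1), of "R * r / s"]
    by (metis exp_le_cancel_iff exp_ln)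
  then show "logF n R s r \<le> R / s * \<bar>r\<bar>" using assms by (simp add: logF_def abs_mult)
qed

text \<open>0F1 decreases in its parameter, so the quotient is at most 1. The upper bound is
  attained at r = 0 and is the origin of the radius condition in part (ii).\<close>

lemma score_bounds:
  assumes "1 \<le> n" "0 < s"
  shows "0 \<le> score n R s r" "score n R s r \<le> R\<^sup>2 / (s\<^sup>2 * real n)"
proof -
  have p: "0 < sphF n (R * r / s)" "0 < sphF (n + 2) (R * r / s)" using assms sphF_pos by auto
  then show "0 \<le> score n R s r" using assms by (simp add: score_def)
  have "sphF (n + 2) (R * r / s) / sphF n (R * r / s) \<le> 1" using p sphF_antimono[OF assms(1)] by simp
  then have "R\<^sup>2 / (s\<^sup>2 * real n) * (sphF (n + 2) (R * r / s) / sphF n (R * r / s)) \<le> R\<^sup>2 / (s\<^sup>2 * real n) * 1"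
    using assms by (intro mult_left_mono) auto
  then show "score n R s r \<le> R\<^sup>2 / (s\<^sup>2 * real n)" unfolding score_def by simp
qed

lemma score_abs_bound: "1 \<le> n \<Longrightarrow> 0 < s \<Longrightarrow> \<bar>score n R s r\<bar> \<le> R\<^sup>2 / (s\<^sup>2 * real n)"
  using score_bounds[of n s R r] by simp

lemma score_hb:
  assumes n: "1 \<le> n" and s: "0 < s" and R: "0 \<le> R" and r: "0 < r"
  shows "R / r * hb (real n / 2) (R / s * r) = s * score n R s r"
proof -
  have "hb (real n / 2) (R / s * r) = R / s * r / real n * (sphF (n + 2) (R / s * r) / sphF n (R / s * r))"
    using assms by (intro hb_eq_sphF) auto
  then show ?thesis unfolding score_def using assms by (simp add: power2_eq_square)
qed

text \<open>Restates that the Bessel ratio is at most 1. It makes the negative term of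
  \<open>xi\<close> vanish at infinity.\<close>

lemma score_decay:
  assumes n: "1 \<le> n" and s: "0 < s" and R: "0 \<le> R" and r: "0 < r"
  shows "score n R s r \<le> R / (s * r)"
proof -
  let ?z = "R * r / s"
  have "?z / real n * sphF (n + 2) ?z / sphF n ?z \<le> 1"
  proof -
    have "?z / real n * sphF (n + 2) ?z \<le> sphF n ?z" using assms by (intro sphF_ratio_le[OF n]) auto
    then show ?thesis using sphF_pos[OF n, of ?z] by (metis divide_le_eq_1_pos)
  qed
  then have "R / (s * r) * (?z / real n * sphF (n + 2) ?z / sphF n ?z) \<le> R / (s * r) * 1"
    using assms by (intro mult_left_mono) auto
  moreover have "R / (s * r) * (?z / real n * sphF (n + 2) ?z / sphF n ?z) = score n R s r"
    unfolding score_def using r by (simp add: power2_eq_square)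
  ultimately show ?thesis by simp
qed

text \<open>The norm is not differentiable at the origin, but \<open>logF\<close> depends on its
  square only, which is a polynomial in \<open>\<tau>\<close> along the path. The chain rule through
  \<open>q\<close> thus holds at every point, and continuity is recorded for the fundamental
  theorem.\<close>

lemma logF_path_derivative:
  assumes n: "1 \<le> n" and s: "0 < s"
  defines "w \<equiv> \<lambda>\<tau> z. vnorm n (\<lambda>i. e0 \<tau> i + sqrt s * z i)"
  shows "((\<lambda>\<tau>. logF n R s (w \<tau> z)) has_real_derivative score n R s (w \<tau> z) * (\<tau> + sqrt s * z 0)) (at \<tau>)"
    and "isCont (\<lambda>\<tau>. score n R s (w \<tau> z) * (\<tau> + sqrt s * z 0)) \<tau>"
proof -
  let ?a = "real n / 2"
  define c where "c = (\<Sum>i\<in>{1..<n}. (sqrt s * z i)\<^sup>2)"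
  define q where "q = (\<lambda>\<tau>. R\<^sup>2 / (4 * s\<^sup>2) * ((\<tau> + sqrt s * z 0)\<^sup>2 + c))"
  have set: "{..<n} = insert 0 {1..<n}" using n by auto
  have w2: "(w \<tau> z)\<^sup>2 = (\<tau> + sqrt s * z 0)\<^sup>2 + c" for \<tau>
    unfolding w_def vnorm_power2 set c_def by (simp add: e0_def)
  have q: "(R * w \<tau> z / s)\<^sup>2 / 4 = q \<tau>" for \<tau>
    unfolding q_def w2[symmetric] by (simp add: power_mult_distrib power_divide)
  have a2: "real (n + 2) / 2 = ?a + 1" by simp
  have a: "0 < ?a" "0 < ?a + 1" using n by auto
  have L: "(\<lambda>\<tau>. logF n R s (w \<tau> z)) = (\<lambda>\<tau>. ln (hyp01 ?a (q \<tau>)))"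
    by (simp add: logF_def sphF_def q)
  have S: "score n R s (w \<tau> z) = R\<^sup>2 / (s\<^sup>2 * real n) * (hyp01 (?a + 1) (q \<tau>) / hyp01 ?a (q \<tau>))" for \<tau>
    unfolding score_def sphF_def q a2 ..
  have c0: "0 \<le> c" by (simp add: c_def sum_nonneg)
  have q0: "0 \<le> q \<tau>" for \<tau> using c0 s by (simp add: q_def)
  have h0: "0 < hyp01 ?a (q \<tau>)" for \<tau> using hyp01_ge_1[OF a(1) q0, of \<tau>] by linarith
  have dq: "(q has_real_derivative R\<^sup>2 / (4 * s\<^sup>2) * (2 * (\<tau> + sqrt s * z 0))) (at \<tau>)"
    unfolding q_def by (rule DERIV_cmult) (auto intro!: derivative_eq_intros)
  have dh: "((\<lambda>\<tau>. hyp01 ?a (q \<tau>)) has_real_derivative hyp01 (?a + 1) (q \<tau>) / ?a * (R\<^sup>2 / (4 * s\<^sup>2) * (2 * (\<tau> + sqrt s * z 0)))) (at \<tau>)"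
    by (rule DERIV_chain2[OF DERIV_hyp01[OF a(1)] dq])
  have "((\<lambda>\<tau>. ln (hyp01 ?a (q \<tau>))) has_real_derivative inverse (hyp01 ?a (q \<tau>)) * (hyp01 (?a + 1) (q \<tau>) / ?a * (R\<^sup>2 / (4 * s\<^sup>2) * (2 * (\<tau> + sqrt s * z 0))))) (at \<tau>)"
    by (rule DERIV_chain2[OF DERIV_ln[OF h0] dh])
  moreover have "inverse (hyp01 ?a (q \<tau>)) * (hyp01 (?a + 1) (q \<tau>) / ?a * (R\<^sup>2 / (4 * s\<^sup>2) * (2 * (\<tau> + sqrt s * z 0))))
     = score n R s (w \<tau> z) * (\<tau> + sqrt s * z 0)"
  proof -
    have "inverse h * (g / (m / 2) * (k / (4 * e) * (2 * t))) = k / (e * m) * (g / h) * t" for g h k e m t :: real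
      by (cases "h = 0 \<or> m = 0 \<or> e = 0") (auto simp: field_simps)
    then show ?thesis unfolding S .
  qed
  ultimately show "((\<lambda>\<tau>. logF n R s (w \<tau> z)) has_real_derivative score n R s (w \<tau> z) * (\<tau> + sqrt s * z 0)) (at \<tau>)"
    unfolding L by simp
  have cq: "isCont q \<tau>" by (rule DERIV_isCont[OF dq])
  have ch: "isCont (\<lambda>\<tau>. hyp01 b (q \<tau>)) \<tau>" if "0 < b" for b
    by (rule isCont_o2[OF cq DERIV_isCont[OF DERIV_hyp01[OF that]]])
  show "isCont (\<lambda>\<tau>. score n R s (w \<tau> z) * (\<tau> + sqrt s * z 0)) \<tau>"
    unfolding S by (intro continuous_intros ch a) (use h0[of \<tau>] in simp)
qed

definition mean_logF :: "nat \<Rightarrow> real \<Rightarrow> real \<Rightarrow> real \<Rightarrow> real" where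
  "mean_logF n R s \<rho> = (\<integral>r. logF n R s r \<partial>chi_meas n s \<rho>)"

lemma logF_gmeas_integrable:
  assumes "1 \<le> n" "0 < s" "0 \<le> R" "0 < t"
  shows "integrable (gmeas n t x) (\<lambda>y. logF n R s (vnorm n y))"
proof (rule integrable_gmeas_quad[OF assms(4)])
  show "(\<lambda>y. logF n R s (vnorm n y)) \<in> borel_measurable (lborel_n n)" using assms by measurable
  fix y
  have "R / s * vnorm n y \<le> R / s * (1 + (vnorm n y)\<^sup>2)"
    using assms by (intro mult_left_mono vnorm_le_quad) auto
  then show "\<bar>logF n R s (vnorm n y)\<bar> \<le> R / s + R / s * (vnorm n y)\<^sup>2"
    using logF_bounds[OF assms(1-3), of "vnorm n y"] by (simp add: algebra_simps)
qed

text \<open>With the noise z fixed, \<open>logF\<close> is integrated along the path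
  \<open>\<tau>\<close> e_1 + sqrt(s) z; averaging over z and exchanging integrals gives the
  increment of the mean. \<open>dimension_shift\<close> then evaluates the inner mean of the
  score.\<close>

lemma mean_logF_diff:
  assumes n: "1 \<le> n" and s: "0 < s" and R: "0 \<le> R" and ab: "0 \<le> a" "a \<le> b"
  shows "has_bochner_integral lborel (\<lambda>\<tau>. indicator {a..b} \<tau> * (\<tau> * (\<integral>r. score n R s r \<partial>chi_meas (n + 2) s \<tau>)))
    (mean_logF n R s b - mean_logF n R s a)"
proof -
  let ?S = "std_gauss_n n"
  interpret S: prob_space ?S by (rule prob_space_std_gauss_n)
  interpret P: pair_sigma_finite lborel ?S ..
  note [measurable] = borel_measurable_logF[OF n] borel_measurable_score[OF n]
  let ?T = "\<lambda>\<tau> z. restrict (\<lambda>i. e0 \<tau> i + sqrt s * z i) {..<n}"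
  let ?K = "R\<^sup>2 / (s\<^sup>2 * real n)"
  have K: "0 \<le> ?K" by simp
  have n0: "0 < n" using n by simp
  have T [measurable]: "(\<lambda>(\<tau>, z). ?T \<tau> z) \<in> measurable (lborel \<Otimes>\<^sub>M ?S) (lborel_n n)"
    unfolding case_prod_beta e0_def by (rule restrict_measurable_lborel_n) measurable
  have z0 [measurable]: "(\<lambda>z. z 0) \<in> borel_measurable ?S"
    unfolding measurable_cong_sets[OF sets_std_gauss_n refl] by (rule lborel_n_component[OF n0])
  have y0 [measurable]: "(\<lambda>y. y 0) \<in> borel_measurable (lborel_n n)" by (rule lborel_n_component[OF n0])
  \<comment> \<open>The directional derivative from \<open>logF_path_derivative\<close>, cut off to
    the interval. The score is bounded, so \<open>f\<close> grows at most linearly in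
    \<open>z 0\<close>, which gives integrability on the product.\<close>
  define f where "f = (\<lambda>\<tau> z. indicator {a..b} \<tau> * (score n R s (vnorm n (?T \<tau> z)) * (\<tau> + sqrt s * z 0)))"
  have fm [measurable]: "(\<lambda>(\<tau>, z). f \<tau> z) \<in> borel_measurable (lborel \<Otimes>\<^sub>M ?S)"
    unfolding f_def by measurable
  have z0i: "integrable ?S (\<lambda>z. \<bar>z 0\<bar>)"
    using gmeas_component_moments(1)[of 1 0 n "\<lambda>_. 0"] n0 by (simp add: std_gauss_n_eq)
  have fb: "\<bar>f \<tau> z\<bar> \<le> indicator {a..b} \<tau> * (?K * (b + sqrt s * \<bar>z 0\<bar>))" for \<tau> z
  proof (cases "\<tau> \<in> {a..b}")
    case True
    have "\<bar>score n R s (vnorm n (?T \<tau> z))\<bar> * \<bar>\<tau> + sqrt s * z 0\<bar> \<le> ?K * (b + sqrt s * \<bar>z 0\<bar>)"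
    proof (rule mult_mono[OF score_abs_bound[OF n s]])
      have "\<bar>\<tau> + sqrt s * z 0\<bar> \<le> \<bar>\<tau>\<bar> + \<bar>sqrt s * z 0\<bar>" by (rule abs_triangle_ineq)
      also have "\<dots> \<le> b + sqrt s * \<bar>z 0\<bar>" using True ab s by (simp add: abs_mult)
      finally show "\<bar>\<tau> + sqrt s * z 0\<bar> \<le> b + sqrt s * \<bar>z 0\<bar>" .
    qed auto
    then show ?thesis using True by (simp add: f_def abs_mult)
  qed (simp add: f_def)
  let ?b = "\<lambda>z. ?K * (b + sqrt s * \<bar>z 0\<bar>)"
  have bi: "integrable ?S ?b" using z0i by auto
  have fi: "integrable ?S (f \<tau>)" for \<tau>
  proof (rule Bochner_Integration.integrable_bound[OF integrable_mult_right[OF bi, of "indicator {a..b} \<tau>"]])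
    show "f \<tau> \<in> borel_measurable ?S" using measurable_Pair2[OF fm] by simp
    show "AE z in ?S. norm (f \<tau> z) \<le> norm (indicator {a..b} \<tau> * ?b z)"
      unfolding real_norm_def by (intro AE_I2 order_trans[OF fb abs_ge_self])
  qed
  have int: "integrable (lborel \<Otimes>\<^sub>M ?S) (\<lambda>(\<tau>, z). f \<tau> z)"
  proof (rule P.Fubini_integrable[OF fm])
    show "AE \<tau> in lborel. integrable ?S (\<lambda>z. case (\<tau>, z) of (\<tau>, z) \<Rightarrow> f \<tau> z)" using fi by simp
    have "integrable lborel (\<lambda>\<tau>. \<integral>z. \<bar>f \<tau> z\<bar> \<partial>?S)"
    proof (rule Bochner_Integration.integrable_bound)
      show "integrable lborel (\<lambda>\<tau>. indicator {a..b} \<tau> * (\<integral>z. ?b z \<partial>?S))"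
        by (intro integrable_mult_left integrable_real_indicator) (auto simp: emeasure_lborel_Icc_eq)
      show "(\<lambda>\<tau>. \<integral>z. \<bar>f \<tau> z\<bar> \<partial>?S) \<in> borel_measurable lborel"
        by (rule S.borel_measurable_lebesgue_integral) measurable
      have "\<bar>\<integral>z. \<bar>f \<tau> z\<bar> \<partial>?S\<bar> \<le> \<bar>indicator {a..b} \<tau> * (\<integral>z. ?b z \<partial>?S)\<bar>" for \<tau>
      proof -
        have "(\<integral>z. \<bar>f \<tau> z\<bar> \<partial>?S) \<le> indicator {a..b} \<tau> * (\<integral>z. ?b z \<partial>?S)"
          unfolding integral_mult_right_zero[symmetric]
          by (rule integral_mono[OF integrable_abs[OF fi] integrable_mult_right[OF bi]]) (rule fb)
        moreover have "0 \<le> (\<integral>z. \<bar>f \<tau> z\<bar> \<partial>?S)" by (rule Bochner_Integration.integral_nonneg) simp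
        ultimately show ?thesis by linarith
      qed
      then show "AE \<tau> in lborel. norm (\<integral>z. \<bar>f \<tau> z\<bar> \<partial>?S) \<le> norm (indicator {a..b} \<tau> * (\<integral>z. ?b z \<partial>?S))"
        unfolding real_norm_def by (rule AE_I2)
    qed
    then show "integrable lborel (\<lambda>\<tau>. \<integral>z. norm (case (\<tau>, z) of (\<tau>, z) \<Rightarrow> f \<tau> z) \<partial>?S)"
      unfolding prod.case real_norm_def .
  qed
  \<comment> \<open>\<open>dimension_shift\<close> yields this identity multiplied by
    \<open>\<tau>\<close>, hence the exception at 0, which is a null set.\<close>
  have inner: "(\<integral>z. f \<tau> z \<partial>?S) = indicator {a..b} \<tau> * (\<tau> * (\<integral>r. score n R s r \<partial>chi_meas (n + 2) s \<tau>))" if \<tau>: "\<tau> \<noteq> 0" for \<tau>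
  proof (cases "\<tau> \<in> {a..b}")
    case True
    with ab \<tau> have t: "0 < \<tau>" by auto
    have "(\<integral>y. score n R s (vnorm n y) * ip n (e0 \<tau>) y \<partial>gmeas n s (e0 \<tau>)) = \<tau>\<^sup>2 * (\<integral>r. score n R s r \<partial>chi_meas (n + 2) s \<tau>)"
      using dimension_shift[OF n s borel_measurable_score[OF n, of R s] score_abs_bound[OF n s, of R], of "e0 \<tau>"] t n by (simp add: vnorm_e0)
    moreover have "(\<integral>y. score n R s (vnorm n y) * ip n (e0 \<tau>) y \<partial>gmeas n s (e0 \<tau>)) = \<tau> * (\<integral>z. f \<tau> z \<partial>?S)"
    proof -
      have "(\<integral>y. score n R s (vnorm n y) * ip n (e0 \<tau>) y \<partial>gmeas n s (e0 \<tau>))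
        = (\<integral>z. score n R s (vnorm n (?T \<tau> z)) * ip n (e0 \<tau>) (?T \<tau> z) \<partial>?S)"
        by (rule integral_gmeas_affine(1)[OF s]) measurable
      also have "\<dots> = (\<integral>z. \<tau> * f \<tau> z \<partial>?S)"
        using True n0 by (intro Bochner_Integration.integral_cong) (simp_all add: ip_e0[OF n] f_def e0_def[of \<tau> , THEN fun_cong, of 0] mult_ac)
      finally show ?thesis by simp
    qed
    ultimately show ?thesis using t True by (simp add: power2_eq_square)
  qed (simp add: f_def)
  have FTC: "(\<integral>\<tau>. f \<tau> z \<partial>lborel) = logF n R s (vnorm n (?T b z)) - logF n R s (vnorm n (?T a z))" for z
  proof -
    have "(\<integral>\<tau>. (score n R s (vnorm n (\<lambda>i. e0 \<tau> i + sqrt s * z i)) * (\<tau> + sqrt s * z 0)) * indicator {a..b} \<tau> \<partial>lborel)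
      = logF n R s (vnorm n (\<lambda>i. e0 b i + sqrt s * z i)) - logF n R s (vnorm n (\<lambda>i. e0 a i + sqrt s * z i))"
      by (rule integral_FTC_Icc_real[OF ab(2)]) (use logF_path_derivative[OF n s] in auto)
    then show ?thesis by (simp add: f_def mult.commute)
  qed
  have E: "mean_logF n R s \<tau> = (\<integral>z. logF n R s (vnorm n (?T \<tau> z)) \<partial>?S)"
    and Ei: "integrable ?S (\<lambda>z. logF n R s (vnorm n (?T \<tau> z)))" if "0 \<le> \<tau>" for \<tau>
  proof -
    have "mean_logF n R s \<tau> = (\<integral>y. logF n R s (vnorm n y) \<partial>gmeas n s (e0 \<tau>))"
      unfolding mean_logF_def using norm_law_integral(1)[OF n s borel_measurable_logF[OF n, of R s], of "e0 \<tau>"] n that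
      by (simp add: vnorm_e0)
    also have "\<dots> = (\<integral>z. logF n R s (vnorm n (?T \<tau> z)) \<partial>?S)"
      by (rule integral_gmeas_affine(1)[OF s]) measurable
    finally show "mean_logF n R s \<tau> = (\<integral>z. logF n R s (vnorm n (?T \<tau> z)) \<partial>?S)" .
    show "integrable ?S (\<lambda>z. logF n R s (vnorm n (?T \<tau> z)))"
      by (rule integral_gmeas_affine(2)[OF s, THEN iffD1]) (use logF_gmeas_integrable[OF n s R s] in auto)
  qed
  let ?h = "\<lambda>\<tau>. indicator {a..b} \<tau> * (\<tau> * (\<integral>r. score n R s r \<partial>chi_meas (n + 2) s \<tau>))"
  have AE0: "AE \<tau> in lborel. (\<integral>z. f \<tau> z \<partial>?S) = ?h \<tau>"
    by (rule eventually_mono[OF AE_lborel_singleton[of 0]]) (rule inner)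
  have I1: "integrable lborel (\<lambda>\<tau>. \<integral>z. f \<tau> z \<partial>?S)" using P.integrable_fst'[OF int] by simp
  have hm: "?h \<in> borel_measurable lborel"
  proof -
    have "?h = (\<lambda>\<tau>. (\<integral>z. f \<tau> z \<partial>?S) * indicator (-{0}) \<tau>)"
      using inner by (auto simp: fun_eq_iff split: split_indicator)
    moreover have "(\<lambda>\<tau>. (\<integral>z. f \<tau> z \<partial>?S) * indicator (-{0}) \<tau>) \<in> borel_measurable lborel"
      using I1 by measurable
    ultimately show ?thesis by simp
  qed
  have "integrable lborel ?h"
    by (rule integrable_cong_AE_imp[OF I1 hm]) (use AE0 in auto)
  moreover have "(\<integral>\<tau>. ?h \<tau> \<partial>lborel) = mean_logF n R s b - mean_logF n R s a"
  proof -
    have "(\<integral>\<tau>. ?h \<tau> \<partial>lborel) = (\<integral>\<tau>. (\<integral>z. f \<tau> z \<partial>?S) \<partial>lborel)"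
      by (rule integral_cong_AE[OF hm]) (use I1 AE0 in auto)
    also have "\<dots> = (\<integral>z. (\<integral>\<tau>. f \<tau> z \<partial>lborel) \<partial>?S)"
      by (rule P.Fubini_integral[OF int, symmetric])
    also have "\<dots> = mean_logF n R s b - mean_logF n R s a"
      unfolding FTC using E[of a] E[of b] Ei[of a] Ei[of b] ab by (subst Bochner_Integration.integral_diff) auto
    finally show ?thesis .
  qed
  ultimately show ?thesis by (simp add: has_bochner_integral_iff)
qed

section \<open>The radial secrecy density\<close>

lemma chi_meas_abs: "chi_meas n s \<bar>\<rho>\<bar> = chi_meas n s \<rho>"
proof -
  have "chi n s \<bar>\<rho>\<bar> r = chi n s \<rho> r" for r
    by (simp add: chi_def sphF_def power_mult_distrib power_divide)
  then show ?thesis by (simp add: chi_meas_def)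
qed

lemma prob_space_chi_meas': "1 \<le> n \<Longrightarrow> 0 < s \<Longrightarrow> prob_space (chi_meas n s \<rho>)"
  using prob_space_chi_meas[of n s "\<bar>\<rho>\<bar>"] by (simp add: chi_meas_abs)

lemma chi_meas_integrable_bounded:
  fixes g :: "real \<Rightarrow> real"
  assumes "1 \<le> n" "0 < s" and [measurable]: "g \<in> borel_measurable borel" and b: "\<And>r. \<bar>g r\<bar> \<le> K"
  shows "integrable (chi_meas n s \<rho>) g" "\<bar>\<integral>r. g r \<partial>chi_meas n s \<rho>\<bar> \<le> K"
proof -
  interpret prob_space "chi_meas n s \<rho>" by (rule prob_space_chi_meas'[OF assms(1,2)])
  show i: "integrable (chi_meas n s \<rho>) g"
    by (rule integrable_const_bound[of _ K]) (use b in auto)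
  have "\<bar>\<integral>r. g r \<partial>chi_meas n s \<rho>\<bar> \<le> (\<integral>r. \<bar>g r\<bar> \<partial>chi_meas n s \<rho>)" by (rule integral_abs_bound)
  also have "\<dots> \<le> (\<integral>r. K \<partial>chi_meas n s \<rho>)" using i b by (intro integral_mono) auto
  also have "\<dots> = K" using prob_space by simp
  finally show "\<bar>\<integral>r. g r \<partial>chi_meas n s \<rho>\<bar> \<le> K" .
qed

lemma integral_chi_meas:
  fixes g :: "real \<Rightarrow> real"
  assumes "1 \<le> n" and [measurable]: "g \<in> borel_measurable borel"
  shows "(\<integral>r. g r \<partial>chi_meas n s \<rho>) = (\<integral>r. chi n s \<rho> r * g r \<partial>lborel)"
    and "integrable (chi_meas n s \<rho>) g \<longleftrightarrow> integrable lborel (\<lambda>r. chi n s \<rho> r * g r)"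
  unfolding chi_meas_def using borel_measurable_chi[OF assms(1)] chi_nonneg[OF assms(1)]
  by (subst integral_density, auto) (subst (asm) integrable_density, auto, subst integrable_density, auto)

lemma borel_measurable_chi_mean:
  fixes g :: "real \<Rightarrow> real"
  assumes n: "1 \<le> n" and [measurable]: "g \<in> borel_measurable borel"
  shows "(\<lambda>\<rho>. \<integral>r. g r \<partial>chi_meas n s \<rho>) \<in> borel_measurable borel"
proof -
  note [measurable] = borel_measurable_sphF[OF n]
  have "(\<lambda>(\<rho>, r). chi n s \<rho> r * g r) \<in> borel_measurable (borel \<Otimes>\<^sub>M lborel)"
    unfolding chi_def by measurable
  then show ?thesis
    unfolding integral_chi_meas(1)[OF n assms(2)] by (rule lborel.borel_measurable_lebesgue_integral)
qed

text \<open>Two noise stages seen through norms only: the mean of the second stage depends on its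
  centre through the norm, so the first stage can be replaced by the law of its norm as
  well.\<close>

lemma chi_convolution:
  fixes g :: "real \<Rightarrow> real"
  assumes n: "1 \<le> n" and s: "0 < s" and t: "0 < t" and gm [measurable]: "g \<in> borel_measurable borel"
    and b: "\<And>r. \<bar>g r\<bar> \<le> K"
  shows "(\<integral>r. g r \<partial>chi_meas n (s + t) \<tau>) = (\<integral>r. (\<integral>v. g v \<partial>chi_meas n t r) \<partial>chi_meas n s \<tau>)"
proof -
  have st: "0 < s + t" using s t by simp
  have e: "vnorm n (e0 \<tau>) = \<bar>\<tau>\<bar>" by (rule vnorm_e0[OF n])
  have i: "integrable (gmeas n (s + t) (e0 \<tau>)) (\<lambda>y. g (vnorm n y))"
    using norm_law_integral(2)[OF n st gm] chi_meas_integrable_bounded(1)[OF n st gm b] by auto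
  have "(\<integral>r. g r \<partial>chi_meas n (s + t) \<tau>) = (\<integral>y. g (vnorm n y) \<partial>gmeas n (s + t) (e0 \<tau>))"
    using norm_law_integral(1)[OF n st gm, of "e0 \<tau>"] by (simp add: e chi_meas_abs)
  also have "\<dots> = (\<integral>z. (\<integral>y. g (vnorm n y) \<partial>gmeas n t z) \<partial>gmeas n s (e0 \<tau>))"
    by (rule gmeas_convolution(2)[OF s t i])
  also have "\<dots> = (\<integral>z. (\<integral>v. g v \<partial>chi_meas n t (vnorm n z)) \<partial>gmeas n s (e0 \<tau>))"
    by (simp add: norm_law_integral(1)[OF n t gm])
  also have "\<dots> = (\<integral>r. (\<integral>v. g v \<partial>chi_meas n t r) \<partial>chi_meas n s \<tau>)"
    using norm_law_integral(1)[OF n s borel_measurable_chi_mean[OF n gm, of t], of "e0 \<tau>"] by (simp add: e chi_meas_abs)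
  finally show ?thesis .
qed

text \<open>Assumption (A)'s function with the constants -1 collected into
  \<open>1 / s1 - 1 / s2\<close>, the Bessel ratios written as scores, and the vector W replaced by
  the law of the norm. Here \<open>s1\<close>, \<open>s2\<close> are variances.\<close>

definition xi :: "nat \<Rightarrow> real \<Rightarrow> real \<Rightarrow> real \<Rightarrow> real \<Rightarrow> real" where
  "xi n R s1 s2 r = (1 / s1 - 1 / s2) - score n R s1 r + (\<integral>v. score n R s2 v \<partial>chi_meas (n + 2) (s2 - s1) r)"

lemma xiA_eq_xi:
  assumes n: "1 \<le> n" and s: "0 < s1" "s1 < s2" and R: "0 \<le> R" and y: "0 < y"
  shows "xiA n R (sqrt s1) (sqrt s2) y = xi n R s1 s2 y"
proof -
  let ?m = "n + 2"
  let ?t = "s2 - s1"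
  have m: "1 \<le> ?m" and t: "0 < ?t" and s2: "0 < s2" using s by auto
  interpret G: prob_space "gmeas ?m ?t (e0 y)" by (rule prob_space_gmeas[OF t])
  note sm [measurable] = borel_measurable_score[OF n, of R s2]
  have q: "(sqrt s1)\<^sup>2 = s1" using s by simp
  have q2: "(sqrt s2)\<^sup>2 = s2" using s2 by simp
  let ?\<phi> = "\<lambda>w. R / w * hb (real n / 2) (R / s2 * w) - 1"
  \<comment> \<open>At w = 0 the quotient R / w is 0, so the integrand of \<open>xiA\<close> is -1
    there and differs from the score formula. The difference is removed later, because the event w =
    0 is null.\<close>
  let ?\<psi> = "\<lambda>w::real. if w = 0 then -1 else s2 * score n R s2 w - 1"
  have eq: "?\<phi> w = ?\<psi> w" if "0 \<le> w" for w
    using score_hb[OF n s2 R, of w] that by auto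
  have Is: "integrable (gmeas ?m ?t (e0 y)) (\<lambda>v. score n R s2 (vnorm ?m v))"
    using norm_law_integral(2)[OF m t sm] chi_meas_integrable_bounded(1)[OF m t sm score_abs_bound[OF n s2]] by auto
  have "(\<integral>z. (let w = vnorm ?m (\<lambda>i. (if i = 0 then y else 0) + sqrt ((sqrt s2)\<^sup>2 - (sqrt s1)\<^sup>2) * z i)
      in R / w * hb (real n / 2) (R / (sqrt s2)\<^sup>2 * w) - 1) \<partial>std_gauss_n ?m)
    = (\<integral>z. ?\<psi> (vnorm ?m (restrict (\<lambda>i. e0 y i + sqrt ?t * z i) {..<?m})) \<partial>std_gauss_n ?m)"
  proof (rule Bochner_Integration.integral_cong[OF refl])
    fix z
    let ?w = "vnorm ?m (\<lambda>i. (if i = 0 then y else 0) + sqrt ?t * z i)"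
    have "?\<phi> ?w = ?\<psi> ?w" by (rule eq) simp
    then show "(let w = vnorm ?m (\<lambda>i. (if i = 0 then y else 0) + sqrt ((sqrt s2)\<^sup>2 - (sqrt s1)\<^sup>2) * z i)
      in R / w * hb (real n / 2) (R / (sqrt s2)\<^sup>2 * w) - 1) = ?\<psi> (vnorm ?m (restrict (\<lambda>i. e0 y i + sqrt ?t * z i) {..<?m}))"
      unfolding vnorm_restrict e0_def q q2 Let_def .
  qed
  also have "\<dots> = (\<integral>v. ?\<psi> (vnorm ?m v) \<partial>gmeas ?m ?t (e0 y))"
    by (rule integral_gmeas_affine(1)[OF t, symmetric]) measurable
  also have "\<dots> = (\<integral>v. s2 * score n R s2 (vnorm ?m v) - 1 \<partial>gmeas ?m ?t (e0 y))"
  proof (rule integral_cong_AE)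
    show "AE v in gmeas ?m ?t (e0 y). ?\<psi> (vnorm ?m v) = s2 * score n R s2 (vnorm ?m v) - 1"
      unfolding gmeas_def by (subst AE_density) (use AE_vnorm_pos[OF m] in \<open>auto elim!: eventually_mono\<close>)
  qed measurable
  also have "\<dots> = s2 * (\<integral>v. score n R s2 (vnorm ?m v) \<partial>gmeas ?m ?t (e0 y)) - 1"
    using Is G.prob_space G.integrable_const[of "1::real"] by (subst Bochner_Integration.integral_diff) auto
  also have "(\<integral>v. score n R s2 (vnorm ?m v) \<partial>gmeas ?m ?t (e0 y)) = (\<integral>v. score n R s2 v \<partial>chi_meas ?m ?t y)"
    using norm_law_integral(1)[OF m t sm, of "e0 y"] unfolding vnorm_e0[OF m] chi_meas_abs .
  finally have A: "(\<integral>z. (let w = vnorm ?m (\<lambda>i. (if i = 0 then y else 0) + sqrt ((sqrt s2)\<^sup>2 - (sqrt s1)\<^sup>2) * z i)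
      in R / w * hb (real n / 2) (R / (sqrt s2)\<^sup>2 * w) - 1) \<partial>std_gauss_n ?m)
    = s2 * (\<integral>v. score n R s2 v \<partial>chi_meas ?m ?t y) - 1" .
  show ?thesis
    unfolding xiA_def A unfolding q q2 score_hb[OF n s(1) R y] xi_def using s s2 by (simp add: field_simps)
qed

lemma xi_measurable_bounded:
  assumes n: "1 \<le> n" and s: "0 < s1" "s1 < s2"
  shows "xi n R s1 s2 \<in> borel_measurable borel"
    and "\<bar>xi n R s1 s2 r\<bar> \<le> \<bar>1 / s1 - 1 / s2\<bar> + R\<^sup>2 / (s1\<^sup>2 * real n) + R\<^sup>2 / (s2\<^sup>2 * real n)"
proof -
  have m: "1 \<le> n + 2" and t: "0 < s2 - s1" and s2: "0 < s2" using s by auto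
  have [measurable]: "(\<lambda>r. \<integral>v. score n R s2 v \<partial>chi_meas (n + 2) (s2 - s1) r) \<in> borel_measurable borel"
    by (rule borel_measurable_chi_mean[OF m borel_measurable_score[OF n]])
  note [measurable] = borel_measurable_score[OF n]
  show "xi n R s1 s2 \<in> borel_measurable borel" unfolding xi_def[abs_def] by measurable
  show "\<bar>xi n R s1 s2 r\<bar> \<le> \<bar>1 / s1 - 1 / s2\<bar> + R\<^sup>2 / (s1\<^sup>2 * real n) + R\<^sup>2 / (s2\<^sup>2 * real n)"
    using score_abs_bound[OF n s(1), of R r]
      chi_meas_integrable_bounded(2)[OF m t borel_measurable_score[OF n, of R s2] score_abs_bound[OF n s2, of R], of r]
    unfolding xi_def by linarith
qed

text \<open>The slope of \<open>radial_secrecy\<close> at \<open>\<tau>\<close> divided by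
  \<open>\<tau>\<close>, as \<open>radial_secrecy_diff\<close> shows in integrated form.\<close>

definition mean_xi :: "nat \<Rightarrow> real \<Rightarrow> real \<Rightarrow> real \<Rightarrow> real \<Rightarrow> real" where
  "mean_xi n R s1 s2 \<tau> = (\<integral>r. xi n R s1 s2 r \<partial>chi_meas (n + 2) s1 \<tau>)"

text \<open>Noise of variance \<open>s1\<close> followed by noise of variance \<open>s2 - s1\<close>
  is noise of variance \<open>s2\<close>. Hence the slopes of both channels are averages under the
  single law \<open>chi_meas (n + 2) s1\<close>, and their difference is the average of one
  function, \<open>xi\<close>.\<close>

lemma mean_xi_eq:
  assumes n: "1 \<le> n" and s: "0 < s1" "s1 < s2"
  shows "mean_xi n R s1 s2 \<tau> = (1 / s1 - 1 / s2) - (\<integral>r. score n R s1 r \<partial>chi_meas (n + 2) s1 \<tau>)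
    + (\<integral>r. score n R s2 r \<partial>chi_meas (n + 2) s2 \<tau>)"
proof -
  have m: "1 \<le> n + 2" and t: "0 < s2 - s1" and s2: "0 < s2" using s by auto
  interpret C: prob_space "chi_meas (n + 2) s1 \<tau>" by (rule prob_space_chi_meas'[OF m s(1)])
  let ?H = "\<lambda>r. \<integral>v. score n R s2 v \<partial>chi_meas (n + 2) (s2 - s1) r"
  have Hm: "?H \<in> borel_measurable borel"
    by (rule borel_measurable_chi_mean[OF m borel_measurable_score[OF n]])
  have Hb: "\<bar>?H r\<bar> \<le> R\<^sup>2 / (s2\<^sup>2 * real n)" for r
    by (rule chi_meas_integrable_bounded(2)[OF m t borel_measurable_score[OF n] score_abs_bound[OF n s2]])
  have i: "integrable (chi_meas (n + 2) s1 \<tau>) ?H" "integrable (chi_meas (n + 2) s1 \<tau>) (score n R s1)"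
    by (rule chi_meas_integrable_bounded(1)[OF m s(1) Hm Hb])
       (rule chi_meas_integrable_bounded(1)[OF m s(1) borel_measurable_score[OF n] score_abs_bound[OF n s(1)]])
  have "(\<integral>r. score n R s2 r \<partial>chi_meas (n + 2) (s1 + (s2 - s1)) \<tau>) = (\<integral>r. ?H r \<partial>chi_meas (n + 2) s1 \<tau>)"
    by (rule chi_convolution[OF m s(1) t borel_measurable_score[OF n] score_abs_bound[OF n s2]])
  moreover have "mean_xi n R s1 s2 \<tau> = (\<integral>r. (1 / s1 - 1 / s2) - score n R s1 r \<partial>chi_meas (n + 2) s1 \<tau>) + (\<integral>r. ?H r \<partial>chi_meas (n + 2) s1 \<tau>)"
    unfolding mean_xi_def xi_def using i C.integrable_const[of "1 / s1 :: real"] C.integrable_const[of "1 / s2 :: real"] by (intro Bochner_Integration.integral_add Bochner_Integration.integrable_diff) auto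
  moreover have "(\<integral>r. (1 / s1 - 1 / s2) - score n R s1 r \<partial>chi_meas (n + 2) s1 \<tau>)
    = (\<integral>r. (1 / s1 - 1 / s2) \<partial>chi_meas (n + 2) s1 \<tau>) - (\<integral>r. score n R s1 r \<partial>chi_meas (n + 2) s1 \<tau>)"
    using i C.integrable_const[of "1 / s1 - 1 / s2 :: real"] by (intro Bochner_Integration.integral_diff) auto
  moreover have "(\<integral>r. (1 / s1 - 1 / s2) \<partial>chi_meas (n + 2) s1 \<tau>) = 1 / s1 - 1 / s2"
    using C.prob_space by simp
  ultimately show ?thesis by simp
qed

text \<open>The secrecy density of the spherical input at a point of norm \<open>\<rho>\<close>.\<close>

definition radial_secrecy :: "nat \<Rightarrow> real \<Rightarrow> real \<Rightarrow> real \<Rightarrow> real \<Rightarrow> real" where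
  "radial_secrecy n R s1 s2 \<rho> = ((\<rho>\<^sup>2 + R\<^sup>2) / (2 * s1) - mean_logF n R s1 \<rho>) - ((\<rho>\<^sup>2 + R\<^sup>2) / (2 * s2) - mean_logF n R s2 \<rho>)"

lemma radial_secrecy_diff:
  assumes n: "1 \<le> n" and s: "0 < s1" "s1 < s2" and R: "0 \<le> R" and ab: "0 \<le> a" "a \<le> b"
  shows "has_bochner_integral lborel (\<lambda>\<tau>. indicator {a..b} \<tau> * (\<tau> * mean_xi n R s1 s2 \<tau>))
    (radial_secrecy n R s1 s2 b - radial_secrecy n R s1 s2 a)"
proof -
  have s2: "0 < s2" using s by simp
  let ?c = "1 / s1 - 1 / s2"
  have q: "has_bochner_integral lborel (\<lambda>\<tau>. (?c * \<tau>) * indicator {a..b} \<tau>) (?c * b\<^sup>2 / 2 - ?c * a\<^sup>2 / 2)"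
    by (rule has_bochner_integral_FTC_Icc_real[OF ab(2)]) (auto intro!: derivative_eq_intros)
  have "has_bochner_integral lborel (\<lambda>\<tau>. (?c * \<tau>) * indicator {a..b} \<tau>
     - indicator {a..b} \<tau> * (\<tau> * (\<integral>r. score n R s1 r \<partial>chi_meas (n + 2) s1 \<tau>))
     + indicator {a..b} \<tau> * (\<tau> * (\<integral>r. score n R s2 r \<partial>chi_meas (n + 2) s2 \<tau>)))
    ((?c * b\<^sup>2 / 2 - ?c * a\<^sup>2 / 2) - (mean_logF n R s1 b - mean_logF n R s1 a) + (mean_logF n R s2 b - mean_logF n R s2 a))"
    by (intro has_bochner_integral_add has_bochner_integral_diff q mean_logF_diff n s s2 R ab)
  moreover have "(\<lambda>\<tau>. (?c * \<tau>) * indicator {a..b} \<tau>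
     - indicator {a..b} \<tau> * (\<tau> * (\<integral>r. score n R s1 r \<partial>chi_meas (n + 2) s1 \<tau>))
     + indicator {a..b} \<tau> * (\<tau> * (\<integral>r. score n R s2 r \<partial>chi_meas (n + 2) s2 \<tau>)))
    = (\<lambda>\<tau>. indicator {a..b} \<tau> * (\<tau> * mean_xi n R s1 s2 \<tau>))"
    unfolding mean_xi_eq[OF n s] by (simp add: fun_eq_iff algebra_simps)
  moreover have "(?c * b\<^sup>2 / 2 - ?c * a\<^sup>2 / 2) - (mean_logF n R s1 b - mean_logF n R s1 a) + (mean_logF n R s2 b - mean_logF n R s2 a)
    = radial_secrecy n R s1 s2 b - radial_secrecy n R s1 s2 a"
    unfolding radial_secrecy_def using s s2 by (simp add: field_simps)
  ultimately show ?thesis by simp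
qed

lemma radial_secrecy_mono:
  assumes "1 \<le> n" "0 < s1" "s1 < s2" "0 \<le> R" and ab: "0 \<le> a" "a \<le> b"
    and J: "\<And>\<tau>. a \<le> \<tau> \<Longrightarrow> \<tau> \<le> b \<Longrightarrow> 0 < \<tau> \<Longrightarrow> 0 \<le> mean_xi n R s1 s2 \<tau>"
  shows "radial_secrecy n R s1 s2 a \<le> radial_secrecy n R s1 s2 b"
proof -
  have "0 \<le> \<tau> * mean_xi n R s1 s2 \<tau>" if "\<tau> \<in> {a..b}" for \<tau>
    using that J[of \<tau>] ab by (cases "\<tau> = 0") auto
  then have "0 \<le> (\<integral>\<tau>. indicator {a..b} \<tau> * (\<tau> * mean_xi n R s1 s2 \<tau>) \<partial>lborel)"
    by (intro Bochner_Integration.integral_nonneg) (auto simp: indicator_def)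
  then show ?thesis using radial_secrecy_diff[OF assms(1-6)] by (simp add: has_bochner_integral_iff)
qed

lemma radial_secrecy_antimono:
  assumes "1 \<le> n" "0 < s1" "s1 < s2" "0 \<le> R" and ab: "0 \<le> a" "a \<le> b"
    and J: "\<And>\<tau>. a \<le> \<tau> \<Longrightarrow> \<tau> \<le> b \<Longrightarrow> 0 < \<tau> \<Longrightarrow> mean_xi n R s1 s2 \<tau> \<le> 0"
  shows "radial_secrecy n R s1 s2 b \<le> radial_secrecy n R s1 s2 a"
proof -
  have "0 \<le> - (\<tau> * mean_xi n R s1 s2 \<tau>)" if "\<tau> \<in> {a..b}" for \<tau>
    using that J[of \<tau>] ab by (cases "\<tau> = 0") (auto simp: mult_nonneg_nonpos)
  then have "0 \<le> (\<integral>\<tau>. - (indicator {a..b} \<tau> * (\<tau> * mean_xi n R s1 s2 \<tau>)) \<partial>lborel)"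
    by (intro Bochner_Integration.integral_nonneg) (auto simp: indicator_def)
  then show ?thesis using radial_secrecy_diff[OF assms(1-6)] by (simp add: has_bochner_integral_iff)
qed

text \<open>Variation diminishing in its simplest instance: the densities \<open>chi n s \<tau>\<close> have a monotone
  likelihood ratio in \<open>\<tau>\<close>, so weighting by the ratio frozen at the crossing point only increases the integral.\<close>

lemma single_crossing_chi:
  fixes f :: "real \<Rightarrow> real"
  assumes n: "1 \<le> n" and s: "0 < s" and fm [measurable]: "f \<in> borel_measurable borel" and b: "\<And>r. \<bar>f r\<bar> \<le> K"
    and r0: "0 \<le> r0" and neg: "\<And>r. 0 < r \<Longrightarrow> r < r0 \<Longrightarrow> f r \<le> 0" and pos: "\<And>r. r0 < r \<Longrightarrow> 0 \<le> f r"
    and \<tau>: "0 \<le> \<tau>1" "\<tau>1 \<le> \<tau>2" and J: "0 \<le> (\<integral>r. f r \<partial>chi_meas n s \<tau>1)"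
  shows "0 \<le> (\<integral>r. f r \<partial>chi_meas n s \<tau>2)"
proof -
  let ?F = "\<lambda>\<tau> r. sphF n (r * \<tau> / s)"
  define E where "E = exp (- (\<tau>2\<^sup>2 - \<tau>1\<^sup>2) / (2 * s))"
  define k where "k = ?F \<tau>2 r0 / ?F \<tau>1 r0"
  have E: "0 < E" by (simp add: E_def)
  have F: "0 < ?F \<tau> r" for \<tau> r by (rule sphF_pos[OF n])
  have k: "0 < k" using F by (simp add: k_def)
  have sup: "?F \<tau>2 r * ?F \<tau>1 r' \<le> ?F \<tau>2 r' * ?F \<tau>1 r" if "0 \<le> r" "r \<le> r'" for r r'
    using sphF_supermodular[OF n, of "\<tau>1 / s" "\<tau>2 / s" r r'] that \<tau> s by (simp add: divide_right_mono mult.commute)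
  have pt: "E * k * (chi n s \<tau>1 r * f r) \<le> chi n s \<tau>2 r * f r" for r
  proof (cases "0 < r")
    case True
    define B where "B = surf n * gconst n s * r ^ (n - 1) * exp (- (r\<^sup>2 + \<tau>1\<^sup>2) / (2 * s))"
    have B: "0 \<le> B" using surf_pos[OF n] True by (simp add: B_def)
    have c1: "chi n s \<tau>1 r = B * ?F \<tau>1 r" using True by (simp add: chi_def B_def)
    have "- (r\<^sup>2 + \<tau>2\<^sup>2) / (2 * s) = - (\<tau>2\<^sup>2 - \<tau>1\<^sup>2) / (2 * s) + - (r\<^sup>2 + \<tau>1\<^sup>2) / (2 * s)"
      unfolding add_divide_distrib[symmetric] by simp
    then have "exp (- (r\<^sup>2 + \<tau>2\<^sup>2) / (2 * s)) = E * exp (- (r\<^sup>2 + \<tau>1\<^sup>2) / (2 * s))"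
      unfolding E_def by (simp only: exp_add)
    then have c2: "chi n s \<tau>2 r = E * B * ?F \<tau>2 r" using True by (simp add: chi_def B_def)
    \<comment> \<open>Left of \<open>r0\<close> the ratio is at most \<open>k\<close> while
      \<open>f\<close> is nonpositive; right of it the ratio is at least \<open>k\<close> while
      \<open>f\<close> is nonnegative. Both cases give the same direction, and at \<open>r0\<close>
      there is equality.\<close>
    have "k * ?F \<tau>1 r * f r \<le> ?F \<tau>2 r * f r"
    proof (cases r r0 rule: linorder_cases)
      case less
      have "?F \<tau>2 r \<le> k * ?F \<tau>1 r"
        using sup[of r r0] less True F[of r0 \<tau>1] by (simp add: k_def field_simps)
      then show ?thesis using neg[OF True less] by (rule mult_right_mono_neg)
    next
      case equal
      then show ?thesis using F[of r0 \<tau>1] by (simp add: k_def)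
    next
      case greater
      have "k * ?F \<tau>1 r \<le> ?F \<tau>2 r"
        using sup[of r0 r] greater r0 F[of r0 \<tau>1] by (simp add: k_def field_simps)
      then show ?thesis using pos[OF greater] by (rule mult_right_mono)
    qed
    then have "E * B * (k * ?F \<tau>1 r * f r) \<le> E * B * (?F \<tau>2 r * f r)"
      using E B by (intro mult_left_mono) auto
    then show ?thesis unfolding c1 c2 by (simp only: mult_ac)
  qed (simp add: chi_def)
  have i: "integrable lborel (\<lambda>r. chi n s \<tau> r * f r)" for \<tau>
    using chi_meas_integrable_bounded(1)[OF n s fm b] integral_chi_meas(2)[OF n fm] by blast
  have "0 \<le> E * k * (\<integral>r. chi n s \<tau>1 r * f r \<partial>lborel)"
    using J E k unfolding integral_chi_meas(1)[OF n fm] by simp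
  also have "\<dots> = (\<integral>r. E * k * (chi n s \<tau>1 r * f r) \<partial>lborel)" by simp
  also have "\<dots> \<le> (\<integral>r. chi n s \<tau>2 r * f r \<partial>lborel)"
    by (rule integral_mono) (use i pt in auto)
  finally show ?thesis unfolding integral_chi_meas(1)[OF n fm] .
qed

text \<open>Positivity near infinity fixes the direction of the change: a positive value followed by
  a negative one, together with a point far out, would give two changes. The crossing point is the
  supremum of the set of negative values, or 0 if that set is empty.\<close>

lemma one_sign_change_crossing:
  assumes A: "at_most_one_sign_change f {0<..}" and M: "\<And>y. M \<le> y \<Longrightarrow> 0 < f y"
  shows "\<exists>r0\<ge>0. (\<forall>r. 0 < r \<and> r < r0 \<longrightarrow> f r \<le> 0) \<and> (\<forall>r>r0. 0 \<le> f r)"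
proof -
  let ?N = "{y. 0 < y \<and> f y < 0}"
  have key: "0 \<le> f y1" if "0 < y0" "y0 < y1" "0 < f y0" for y0 y1
  proof (rule ccontr)
    assume "\<not> 0 \<le> f y1"
    then have f1: "f y1 < 0" by simp
    define y2 where "y2 = max M (y1 + 1)"
    have f2: "0 < f y2" by (rule M) (simp add: y2_def)
    have "y1 < y2" by (simp add: y2_def)
    then have "sorted_wrt (<) [y0, y1, y2] \<and> set [y0, y1, y2] \<subseteq> {0<..}" using that by auto
    then have "sign_changes (map f [y0, y1, y2]) \<le> 1"
      using A unfolding at_most_one_sign_change_def by blast
    moreover have "sign_changes (map f [y0, y1, y2]) = 2"
      using that f1 f2 by (simp add: sign_changes_def mult_neg_pos mult_pos_neg)
    ultimately show False by simp
  qed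
  show ?thesis
  proof (cases "?N = {}")
    case True
    then have "0 \<le> f r" if "0 < r" for r using that by force
    then show ?thesis by (intro exI[of _ 0]) auto
  next
    case False
    have bdd: "bdd_above ?N"
    proof (rule bdd_aboveI)
      fix y assume "y \<in> ?N"
      then have "\<not> M \<le> y" using M[of y] by auto
      then show "y \<le> M" by simp
    qed
    obtain y where y: "y \<in> ?N" using False by auto
    have "y \<le> Sup ?N" by (rule cSup_upper[OF y bdd])
    then have S: "0 \<le> Sup ?N" using y by simp
    have neg: "f r \<le> 0" if r: "0 < r" "r < Sup ?N" for r
    proof -
      obtain y' where "0 < y'" "f y' < 0" "r < y'" using r(2) less_cSup_iff[OF False bdd] by blast
      then show ?thesis using key[of r y'] r(1) by linarith
    qed
    have pos: "0 \<le> f r" if r: "Sup ?N < r" for r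
    proof (rule ccontr)
      assume "\<not> 0 \<le> f r"
      then have "r \<in> ?N" using S r by simp
      then have "r \<le> Sup ?N" by (rule cSup_upper[OF _ bdd])
      with r show False by simp
    qed
    show ?thesis using S neg pos by blast
  qed
qed

text \<open>The score of the first channel is at most R / (s1 y), and the threshold is where this
  equals the constant \<open>1 / s1 - 1 / s2\<close>; the added 1 makes the inequality strict and y
  positive. The mean of the second score only helps.\<close>

lemma xi_eventually_pos:
  assumes n: "1 \<le> n" and s: "0 < s1" "s1 < s2" and R: "0 \<le> R"
    and y: "1 + R / (s1 * (1 / s1 - 1 / s2)) \<le> y"
  shows "0 < xi n R s1 s2 y"
proof -
  let ?c = "1 / s1 - 1 / s2"
  have s2: "0 < s2" using s by simp
  have c: "0 < ?c" using s by (simp add: field_simps)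
  have "0 \<le> R / (s1 * ?c)" using R s c by (intro divide_nonneg_nonneg mult_nonneg_nonneg) auto
  then have y0: "0 < y" "R / (s1 * ?c) < y" using y by linarith+
  have "score n R s1 y \<le> R / (s1 * y)" by (rule score_decay[OF n s(1) R y0(1)])
  also have "\<dots> < ?c" using y0 s c by (simp only: pos_divide_less_eq mult_pos_pos mult_ac)
  finally have "score n R s1 y < ?c" .
  moreover have "0 \<le> (\<integral>v. score n R s2 v \<partial>chi_meas (n + 2) (s2 - s1) y)"
    by (intro Bochner_Integration.integral_nonneg score_bounds n s2)
  ultimately show ?thesis unfolding xi_def by linarith
qed

lemma radial_secrecy_max_A:
  assumes n: "1 \<le> n" and s: "0 < s1" "s1 < s2" and R: "0 \<le> R" and A: assumptionA
    and le: "radial_secrecy n R s1 s2 0 \<le> radial_secrecy n R s1 s2 R" and \<rho>: "0 \<le> \<rho>" "\<rho> \<le> R"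
  shows "radial_secrecy n R s1 s2 \<rho> \<le> radial_secrecy n R s1 s2 R"
proof -
  have m: "1 \<le> n + 2" by simp
  have "at_most_one_sign_change (xiA n R (sqrt s1) (sqrt s2)) {0<..}"
    using A n s R unfolding assumptionA_def by simp
  moreover have "map (xiA n R (sqrt s1) (sqrt s2)) ys = map (xi n R s1 s2) ys" if "set ys \<subseteq> {0<..}" for ys
    using that by (intro map_cong refl xiA_eq_xi n s R) auto
  ultimately have "at_most_one_sign_change (xi n R s1 s2) {0<..}"
    unfolding at_most_one_sign_change_def by metis
  then have "\<exists>r0\<ge>0. (\<forall>r. 0 < r \<and> r < r0 \<longrightarrow> xi n R s1 s2 r \<le> 0) \<and> (\<forall>r>r0. 0 \<le> xi n R s1 s2 r)"
    by (rule one_sign_change_crossing[OF _ xi_eventually_pos[OF n s R]])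
  then obtain r0 where r0: "0 \<le> r0" and x: "\<forall>r. 0 < r \<and> r < r0 \<longrightarrow> xi n R s1 s2 r \<le> 0" "\<forall>r>r0. 0 \<le> xi n R s1 s2 r"
    by (elim exE conjE)
  have cross: "0 \<le> mean_xi n R s1 s2 \<tau>2" if "0 \<le> \<tau>1" "\<tau>1 \<le> \<tau>2" "0 \<le> mean_xi n R s1 s2 \<tau>1" for \<tau>1 \<tau>2
    unfolding mean_xi_def
  proof (rule single_crossing_chi[OF m s(1) xi_measurable_bounded[OF n s] r0 _ _ that(1,2)])
    show "0 \<le> (\<integral>r. xi n R s1 s2 r \<partial>chi_meas (n + 2) s1 \<tau>1)" using that(3) unfolding mean_xi_def .
  qed (use x in blast)+
  show ?thesis
  \<comment> \<open>Splitting on whether the slope has become nonnegative by \<open>\<rho>\<close>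
    avoids locating its crossing: if it has, the profile increases from \<open>\<rho>\<close> to R;
    if not, it decreases from 0 to \<open>\<rho>\<close> and the endpoint hypothesis
    finishes.\<close>
  proof (cases "\<exists>\<tau>1. 0 < \<tau>1 \<and> \<tau>1 \<le> \<rho> \<and> 0 \<le> mean_xi n R s1 s2 \<tau>1")
    case True
    then obtain \<tau>1 where t1: "0 < \<tau>1" "\<tau>1 \<le> \<rho>" "0 \<le> mean_xi n R s1 s2 \<tau>1" by auto
    show ?thesis
      by (rule radial_secrecy_mono[OF n s R \<rho>]) (rule cross[of \<tau>1], use t1 in auto)
  next
    case False
    have "radial_secrecy n R s1 s2 \<rho> \<le> radial_secrecy n R s1 s2 0"
    proof (rule radial_secrecy_antimono[OF n s R order_refl \<rho>(1)])
      fix \<tau> assume "0 \<le> \<tau>" "\<tau> \<le> \<rho>" "0 < \<tau>"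
      then have "\<not> 0 \<le> mean_xi n R s1 s2 \<tau>" using False by blast
      then show "mean_xi n R s1 s2 \<tau> \<le> 0" by linarith
    qed
    with le show ?thesis by linarith
  qed
qed

text \<open>The score is at most R^2 / (s1^2 n), and the radius condition says that this stays below
  \<open>1 / s1 - 1 / s2\<close>. The score of the second channel enters with a plus sign, so
  \<open>xi\<close> is nonnegative everywhere.\<close>

lemma radial_secrecy_max_small:
  assumes n: "1 \<le> n" and s: "0 < s1" "s1 < s2" and R: "0 \<le> R" 
    and small: "R < s1 * sqrt (real n * (1 / s1 - 1 / s2))" and \<rho>: "0 \<le> \<rho>" "\<rho> \<le> R"
  shows "radial_secrecy n R s1 s2 \<rho> \<le> radial_secrecy n R s1 s2 R"
proof (rule radial_secrecy_mono[OF n s R \<rho>])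
  fix \<tau> :: real
  let ?c = "1 / s1 - 1 / s2"
  have s2: "0 < s2" using s by simp
  have c: "0 < ?c" using s by (simp add: field_simps)
  have "R\<^sup>2 \<le> (s1 * sqrt (real n * ?c))\<^sup>2" using small R by (intro power_mono) auto
  also have "\<dots> = s1\<^sup>2 * real n * ?c" using c by (simp add: power_mult_distrib)
  finally have "R\<^sup>2 / (s1\<^sup>2 * real n) \<le> ?c" using s n by (simp add: pos_divide_le_eq mult.commute)
  then have "score n R s1 r \<le> ?c" for r using score_bounds(2)[OF n s(1), of R r] by simp
  moreover have "0 \<le> (\<integral>v. score n R s2 v \<partial>chi_meas (n + 2) (s2 - s1) r)" for r
    by (intro Bochner_Integration.integral_nonneg score_bounds n s2)
  ultimately have "0 \<le> xi n R s1 s2 r" for r unfolding xi_def by (simp add: add_increasing)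
  then show "0 \<le> mean_xi n R s1 s2 \<tau>" unfolding mean_xi_def by (intro Bochner_Integration.integral_nonneg)
qed

section \<open>Divergences of output densities\<close>

lemma ip_commute: "ip n x y = ip n y x"
  by (simp add: ip_def mult.commute)

lemma gauss_commute: "gauss n s x y = gauss n s y x"
  by (simp add: gauss_alt ip_commute[of n x y])

text \<open>The Gaussian kernel is symmetric in centre and argument, so the polar splitting applies
  with y as the centre and the input on the sphere as the variable.\<close>

lemma out_dens_unif_sphere:
  assumes n: "1 \<le> n" and s: "0 < s" and R: "0 \<le> R"
  shows "out_dens n s (unif_sphere n R) y =
    gconst n s * exp (- ((vnorm n y)\<^sup>2 + R\<^sup>2) / (2 * s)) * sphF n (R * vnorm n y / s)"
proof -
  let ?C = "gconst n s * exp (- (R\<^sup>2 + (vnorm n y)\<^sup>2) / (2 * s))"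
  have m: "(\<lambda>x. gauss n s x y) \<in> borel_measurable (lborel_n n)"
    unfolding gauss_commute[of n s _ y] by (rule gauss_measurable)
  have "out_dens n s (unif_sphere n R) y = (\<integral>u. gauss n s (scaled n R u) y \<partial>usphere n)"
    unfolding out_dens_def unif_sphere_scale[OF n, of R] by (rule integral_distr) (use m in \<open>auto simp: measurable_cong_sets[OF sets_unif_sphere refl]\<close>)
  also have "\<dots> = (\<integral>u. ?C * exp (ip n (\<lambda>i. R / s * y i) u) \<partial>usphere n)"
  proof (rule integral_cong_AE)
    show "(\<lambda>u. gauss n s (scaled n R u) y) \<in> borel_measurable (usphere n)"
      using measurable_compose[OF scale_measurable m] by (simp add: measurable_cong_sets[OF sets_unif_sphere refl])
    show "AE u in usphere n. gauss n s (scaled n R u) y = ?C * exp (ip n (\<lambda>i. R / s * y i) u)"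
    proof (rule eventually_mono[OF AE_unif_sphere[OF n, of 1]])
      fix u assume u: "vnorm n u = 1"
      show "gauss n s (scaled n R u) y = ?C * exp (ip n (\<lambda>i. R / s * y i) u)"
        unfolding gauss_commute[of n s _ y] gauss_polar[OF u] ip_scale_left by simp
    qed simp
  qed measurable
  also have "\<dots> = ?C * sphF n (R / s * vnorm n y)"
    using sphere_mean_exp[OF n, of "\<lambda>i. R / s * y i"] R s unfolding vnorm_scale by simp
  finally show ?thesis by (simp add: add.commute)
qed

text \<open>Integrands of this class are integrable under every Gaussian and every output law. Since
  it contains the logarithms of output densities, relative entropies may be split into differences
  of finite integrals.\<close>

definition quad_bounded :: "nat \<Rightarrow> ((nat \<Rightarrow> real) \<Rightarrow> real) \<Rightarrow> bool" where
  "quad_bounded n \<phi> \<longleftrightarrow> \<phi> \<in> borel_measurable (lborel_n n) \<and> (\<exists>A B. 0 \<le> A \<and> 0 \<le> B \<and> (\<forall>y. \<bar>\<phi> y\<bar> \<le> A + B * (vnorm n y)\<^sup>2))"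

lemma quad_boundedI:
  assumes "\<phi> \<in> borel_measurable (lborel_n n)" "0 \<le> A" "0 \<le> B" "\<And>y. \<bar>\<phi> y\<bar> \<le> A + B * (vnorm n y)\<^sup>2"
  shows "quad_bounded n \<phi>"
  using assms unfolding quad_bounded_def by blast

lemma quad_bounded_measurable: "quad_bounded n \<phi> \<Longrightarrow> \<phi> \<in> borel_measurable (lborel_n n)"
  by (simp add: quad_bounded_def)

lemma quad_bounded_diff:
  assumes "quad_bounded n \<phi>" "quad_bounded n \<psi>"
  shows "quad_bounded n (\<lambda>y. \<phi> y - \<psi> y)"
proof -
  obtain A B where 1: "0 \<le> A" "0 \<le> B" "\<And>y. \<bar>\<phi> y\<bar> \<le> A + B * (vnorm n y)\<^sup>2" using assms(1) by (auto simp: quad_bounded_def)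
  obtain C D where 2: "0 \<le> C" "0 \<le> D" "\<And>y. \<bar>\<psi> y\<bar> \<le> C + D * (vnorm n y)\<^sup>2" using assms(2) by (auto simp: quad_bounded_def)
  note [measurable] = assms[THEN quad_bounded_measurable]
  show ?thesis
  proof (rule quad_boundedI[of _ _ "A + C" "B + D"])
    fix y
    show "\<bar>\<phi> y - \<psi> y\<bar> \<le> (A + C) + (B + D) * (vnorm n y)\<^sup>2"
      using 1(3)[of y] 2(3)[of y] unfolding distrib_right by linarith
  qed (use 1 2 in auto)
qed

lemma quad_bounded_integrable: "0 < s \<Longrightarrow> quad_bounded n \<phi> \<Longrightarrow> integrable (gmeas n s x) \<phi>"
  unfolding quad_bounded_def using integrable_gmeas_quad by blast

text \<open>From (a + b)^2 <= 2 a^2 + 2 b^2. The point is a bound that is uniform over centres in a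
  ball.\<close>

lemma gmeas_second_moment:
  assumes s: "0 < s"
  shows "(\<integral>y. (vnorm n y)\<^sup>2 \<partial>gmeas n s x) \<le> 2 * (vnorm n x)\<^sup>2 + 2 * s * (\<integral>z. (vnorm n z)\<^sup>2 \<partial>std_gauss_n n)"
proof -
  interpret S: prob_space "std_gauss_n n" by (rule prob_space_std_gauss_n)
  let ?T = "\<lambda>z. restrict (\<lambda>i. x i + sqrt s * z i) {..<n}"
  have i: "integrable (std_gauss_n n) (\<lambda>z. (vnorm n z)\<^sup>2)"
    unfolding std_gauss_n_eq by (rule integrable_gmeas_vnorm2) simp
  have iT: "integrable (std_gauss_n n) (\<lambda>z. (vnorm n (?T z))\<^sup>2)"
    by (rule integral_gmeas_affine(2)[OF s, THEN iffD1]) (use integrable_gmeas_vnorm2[OF s] in auto)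
  have "(\<integral>y. (vnorm n y)\<^sup>2 \<partial>gmeas n s x) = (\<integral>z. (vnorm n (?T z))\<^sup>2 \<partial>std_gauss_n n)"
    by (rule integral_gmeas_affine(1)[OF s]) measurable
  also have "\<dots> \<le> (\<integral>z. 2 * (vnorm n x)\<^sup>2 + 2 * s * (vnorm n z)\<^sup>2 \<partial>std_gauss_n n)"
  proof (rule integral_mono[OF iT])
    fix z
    have "(x i + sqrt s * z i)\<^sup>2 \<le> 2 * (x i)\<^sup>2 + 2 * s * (z i)\<^sup>2" for i
    proof -
      have "0 \<le> (x i - sqrt s * z i)\<^sup>2" by simp
      then show ?thesis using s by (simp add: power2_sum power2_diff power_mult_distrib)
    qed
    then have "(\<Sum>i<n. (x i + sqrt s * z i)\<^sup>2) \<le> (\<Sum>i<n. 2 * (x i)\<^sup>2 + 2 * s * (z i)\<^sup>2)" by (intro sum_mono)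
    then show "(vnorm n (?T z))\<^sup>2 \<le> 2 * (vnorm n x)\<^sup>2 + 2 * s * (vnorm n z)\<^sup>2"
      unfolding vnorm_restrict vnorm_power2 by (simp add: sum.distrib sum_distrib_left)
  qed (use i in auto)
  also have "\<dots> = 2 * (vnorm n x)\<^sup>2 + 2 * s * (\<integral>z. (vnorm n z)\<^sup>2 \<partial>std_gauss_n n)"
    using i S.prob_space S.integrable_const[of "2 * (vnorm n x)\<^sup>2"] by (subst Bochner_Integration.integral_add) auto
  finally show ?thesis .
qed

lemma admissibleD:
  assumes "admissible n R Q"
  shows "prob_space Q" "sets Q = sets (lborel_n n)" "space Q = space (lborel_n n)" "AE x in Q. vnorm n x \<le> R"
  using assms sets_eq_imp_space_eq[of Q "lborel_n n"] by (auto simp: admissible_def)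

lemma gauss_pair_measurable:
  assumes "sets Q = sets (lborel_n n)"
  shows "(\<lambda>(x, y). gauss n s x y) \<in> borel_measurable (Q \<Otimes>\<^sub>M lborel_n n)"
proof -
  have e: "sets (Q \<Otimes>\<^sub>M lborel_n n) = sets (lborel_n n \<Otimes>\<^sub>M lborel_n n)"
    by (intro sets_pair_measure_cong assms refl)
  have "(\<lambda>(x, y). gauss n s x y) \<in> borel_measurable (lborel_n n \<Otimes>\<^sub>M lborel_n n)"
    unfolding case_prod_beta by measurable
  then show ?thesis unfolding measurable_cong_sets[OF e refl] .
qed

text \<open>Fubini for the output law as a mixture of Gaussians. The inner absolute means are
  bounded uniformly because the input is almost surely in the ball of radius R.\<close>

lemma out_dens_mixture:
  assumes s: "0 < s" and Q: "admissible n R Q" and \<phi>: "quad_bounded n \<phi>"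
  shows "integrable (lborel_n n) (\<lambda>y. out_dens n s Q y * \<phi> y)"
    and "integrable Q (\<lambda>x. \<integral>y. \<phi> y \<partial>gmeas n s x)"
    and "(\<integral>y. out_dens n s Q y * \<phi> y \<partial>lborel_n n) = (\<integral>x. (\<integral>y. \<phi> y \<partial>gmeas n s x) \<partial>Q)"
proof -
  note A = admissibleD[OF Q]
  interpret Q: prob_space Q by (rule A(1))
  interpret L: sigma_finite_measure "lborel_n n" by (rule sigma_finite_lborel_n)
  interpret P: pair_sigma_finite Q "lborel_n n" ..
  note m [measurable] = quad_bounded_measurable[OF \<phi>]
  note gm [measurable] = gauss_pair_measurable[OF A(2), of s]
  have sQ [measurable_cong]: "sets Q = sets (lborel_n n)" by (rule A(2))
  obtain a b where ab: "0 \<le> a" "0 \<le> b" "\<And>y. \<bar>\<phi> y\<bar> \<le> a + b * (vnorm n y)\<^sup>2" using \<phi> by (auto simp: quad_bounded_def)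
  let ?f = "\<lambda>(x, y). gauss n s x y * \<phi> y"
  have fm: "?f \<in> borel_measurable (Q \<Otimes>\<^sub>M lborel_n n)" by measurable
  have dens: "(\<integral>y. gauss n s x y * \<psi> y \<partial>lborel_n n) = (\<integral>y. \<psi> y \<partial>gmeas n s x)"
    if "\<psi> \<in> borel_measurable (lborel_n n)" for \<psi> :: "(nat \<Rightarrow> real) \<Rightarrow> real" and x
    unfolding gmeas_def using that by (subst integral_density) auto
  have int_x: "integrable (lborel_n n) (\<lambda>y. gauss n s x y * \<phi> y)" for x
    using quad_bounded_integrable[OF s \<phi>, of x] unfolding gmeas_def by (subst (asm) integrable_density) auto
  let ?M = "\<integral>z. (vnorm n z)\<^sup>2 \<partial>std_gauss_n n"
  have norm_eq: "(\<integral>y. norm (?f (x, y)) \<partial>lborel_n n) = (\<integral>y. \<bar>\<phi> y\<bar> \<partial>gmeas n s x)" for x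
    using dens[of "\<lambda>y. \<bar>\<phi> y\<bar>" x] by (simp add: abs_mult)
  have bound: "(\<integral>y. \<bar>\<phi> y\<bar> \<partial>gmeas n s x) \<le> a + b * (2 * R\<^sup>2 + 2 * s * ?M)" if "vnorm n x \<le> R" for x
  proof -
    interpret G: prob_space "gmeas n s x" by (rule prob_space_gmeas[OF s])
    have "(\<integral>y. \<bar>\<phi> y\<bar> \<partial>gmeas n s x) \<le> (\<integral>y. a + b * (vnorm n y)\<^sup>2 \<partial>gmeas n s x)"
      using quad_bounded_integrable[OF s \<phi>, of x] integrable_gmeas_vnorm2[OF s, of n x] ab(3)
      by (intro integral_mono) auto
    also have "\<dots> = a + b * (\<integral>y. (vnorm n y)\<^sup>2 \<partial>gmeas n s x)"
      using integrable_gmeas_vnorm2[OF s, of n x] G.prob_space G.integrable_const[of a]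
      by (subst Bochner_Integration.integral_add) auto
    also have "\<dots> \<le> a + b * (2 * (vnorm n x)\<^sup>2 + 2 * s * ?M)"
      using gmeas_second_moment[OF s, of n x] ab by (intro add_left_mono mult_left_mono) auto
    also have "\<dots> \<le> a + b * (2 * R\<^sup>2 + 2 * s * ?M)"
      using that ab by (intro add_left_mono mult_left_mono add_right_mono power_mono) auto
    finally show ?thesis .
  qed
  have int: "integrable (Q \<Otimes>\<^sub>M lborel_n n) ?f"
  proof (rule P.Fubini_integrable[OF fm])
    have "(\<lambda>x. \<integral>y. norm (?f (x, y)) \<partial>lborel_n n) \<in> borel_measurable Q"
      by (rule L.borel_measurable_lebesgue_integral) (use fm in measurable)
    moreover have "AE x in Q. norm (\<integral>y. norm (?f (x, y)) \<partial>lborel_n n) \<le> a + b * (2 * R\<^sup>2 + 2 * s * ?M)"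
      using A(4)
    proof (rule eventually_mono)
      fix x assume "vnorm n x \<le> R"
      from bound[OF this] show "norm (\<integral>y. norm (?f (x, y)) \<partial>lborel_n n) \<le> a + b * (2 * R\<^sup>2 + 2 * s * ?M)"
        unfolding norm_eq by simp
    qed
    ultimately show "integrable Q (\<lambda>x. \<integral>y. norm (?f (x, y)) \<partial>lborel_n n)"
      by (intro Q.integrable_const_bound)
    show "AE x in Q. integrable (lborel_n n) (\<lambda>y. ?f (x, y))" using int_x by simp
  qed
  have o: "(\<integral>x. gauss n s x y * \<phi> y \<partial>Q) = out_dens n s Q y * \<phi> y" for y
    unfolding out_dens_def by simp
  show "integrable (lborel_n n) (\<lambda>y. out_dens n s Q y * \<phi> y)"
    using P.integrable_snd[OF int] unfolding o .
  show "integrable Q (\<lambda>x. \<integral>y. \<phi> y \<partial>gmeas n s x)"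
    using P.integrable_fst'[OF int] by (simp add: dens[OF m])
  show "(\<integral>y. out_dens n s Q y * \<phi> y \<partial>lborel_n n) = (\<integral>x. (\<integral>y. \<phi> y \<partial>gmeas n s x) \<partial>Q)"
    using P.Fubini_integral[OF int] by (simp only: o dens[OF m])
qed

lemma quad_bounded_const: "quad_bounded n (\<lambda>_. c)"
  by (rule quad_boundedI[of _ _ "\<bar>c\<bar>" 0]) auto

lemma out_dens_integral:
  assumes s: "0 < s" and Q: "admissible n R Q"
  shows "integrable (lborel_n n) (out_dens n s Q)" "(\<integral>y. out_dens n s Q y \<partial>lborel_n n) = 1"
proof -
  interpret Q: prob_space Q by (rule admissibleD(1)[OF Q])
  have g: "(\<integral>y. 1 \<partial>gmeas n s x) = (1::real)" for x
    using prob_space.prob_space[OF prob_space_gmeas[OF s, of n x]] by simp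
  show "integrable (lborel_n n) (out_dens n s Q)" "(\<integral>y. out_dens n s Q y \<partial>lborel_n n) = 1"
    using out_dens_mixture(1,3)[OF s Q quad_bounded_const[of n 1]] Q.prob_space unfolding g by simp_all
qed

lemma gauss_integrable_input:
  assumes s: "0 < s" and Q: "admissible n R Q"
  shows "integrable Q (\<lambda>x. gauss n s x y)"
proof -
  interpret Q: prob_space Q by (rule admissibleD(1)[OF Q])
  have "(\<lambda>x. gauss n s x y) \<in> borel_measurable Q"
    unfolding gauss_commute[of n s _ y] measurable_cong_sets[OF admissibleD(2)[OF Q] refl] by (rule gauss_measurable)
  then show ?thesis using gauss_le[OF s]
    by (intro Q.integrable_const_bound[of _ "gconst n s"]) auto
qed

text \<open>For inputs in the ball, |y - x|^2 <= 2 (|y|^2 + R^2), which gives a Gaussian lower bound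
  uniform in \<open>Q\<close>. Output densities are therefore positive everywhere and their
  logarithms have quadratic growth.\<close>

lemma out_dens_bounds:
  assumes s: "0 < s" and Q: "admissible n R Q"
  shows "gconst n s * exp (- ((vnorm n y)\<^sup>2 + R\<^sup>2) / s) \<le> out_dens n s Q y"
    and "out_dens n s Q y \<le> gconst n s"
proof -
  note A = admissibleD[OF Q]
  interpret Q: prob_space Q by (rule A(1))
  let ?C = "gconst n s"
  note i = gauss_integrable_input[OF s Q, of y]
  have "(\<integral>x. ?C * exp (- ((vnorm n y)\<^sup>2 + R\<^sup>2) / s) \<partial>Q) \<le> (\<integral>x. gauss n s x y \<partial>Q)"
  proof (rule integral_mono_AE[OF _ i])
    show "AE x in Q. ?C * exp (- ((vnorm n y)\<^sup>2 + R\<^sup>2) / s) \<le> gauss n s x y"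
      using A(4)
    proof (rule eventually_mono)
      fix x assume x: "vnorm n x \<le> R"
      have "- ip n x y \<le> vnorm n x * vnorm n y" using ip_bound[of n x y] by (simp add: abs_le_iff)
      moreover have "2 * (vnorm n x * vnorm n y) \<le> (vnorm n x)\<^sup>2 + (vnorm n y)\<^sup>2"
        using sum_squares_bound[of "vnorm n x" "vnorm n y"] by (simp add: mult.assoc)
      moreover have "(vnorm n x)\<^sup>2 \<le> R\<^sup>2" using x by (intro power_mono) auto
      ultimately have "(vnorm n y)\<^sup>2 - 2 * ip n x y + (vnorm n x)\<^sup>2 \<le> 2 * ((vnorm n y)\<^sup>2 + R\<^sup>2)" by argo
      then have "((vnorm n y)\<^sup>2 - 2 * ip n x y + (vnorm n x)\<^sup>2) / (2 * s) \<le> 2 * ((vnorm n y)\<^sup>2 + R\<^sup>2) / (2 * s)"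
        using s by (intro divide_right_mono) auto
      also have "2 * ((vnorm n y)\<^sup>2 + R\<^sup>2) / (2 * s) = ((vnorm n y)\<^sup>2 + R\<^sup>2) / s" by (rule mult_divide_mult_cancel_left) simp
      finally have "- ((vnorm n y)\<^sup>2 + R\<^sup>2) / s \<le> - ((vnorm n y)\<^sup>2 - 2 * ip n x y + (vnorm n x)\<^sup>2) / (2 * s)"
        by (simp only: minus_divide_left[symmetric] neg_le_iff_le)
      then show "?C * exp (- ((vnorm n y)\<^sup>2 + R\<^sup>2) / s) \<le> gauss n s x y"
        unfolding gauss_alt by (intro mult_left_mono exp_le_cancel_iff[THEN iffD2]) auto
    qed
  qed simp
  then show "?C * exp (- ((vnorm n y)\<^sup>2 + R\<^sup>2) / s) \<le> out_dens n s Q y"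
    unfolding out_dens_def using Q.prob_space by simp
  have "(\<integral>x. gauss n s x y \<partial>Q) \<le> (\<integral>x. ?C \<partial>Q)"
    by (rule integral_mono[OF i]) (use gauss_le[OF s] in auto)
  then show "out_dens n s Q y \<le> ?C"
    unfolding out_dens_def using Q.prob_space by simp
qed

lemma out_dens_pos:
  assumes "0 < s" "admissible n R Q"
  shows "0 < out_dens n s Q y"
  by (rule less_le_trans[OF _ out_dens_bounds(1)[OF assms]]) (use assms in simp)

lemma out_dens_measurable:
  assumes Q: "admissible n R Q"
  shows "out_dens n s Q \<in> borel_measurable (lborel_n n)"
proof -
  interpret Q: prob_space Q by (rule admissibleD(1)[OF Q])
  have "(\<lambda>(y, x). gauss n s x y) \<in> borel_measurable (lborel_n n \<Otimes>\<^sub>M Q)"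
  proof -
    have e: "sets (lborel_n n \<Otimes>\<^sub>M Q) = sets (lborel_n n \<Otimes>\<^sub>M lborel_n n)"
      by (intro sets_pair_measure_cong admissibleD[OF Q] refl)
    have "(\<lambda>(y, x). gauss n s x y) \<in> borel_measurable (lborel_n n \<Otimes>\<^sub>M lborel_n n)"
      unfolding case_prod_beta by measurable
    then show ?thesis unfolding measurable_cong_sets[OF e refl] .
  qed
  then show ?thesis unfolding out_dens_def[abs_def] by (rule Q.borel_measurable_lebesgue_integral)
qed

lemma quad_bounded_ln_out_dens:
  assumes s: "0 < s" and Q: "admissible n R Q"
  shows "quad_bounded n (\<lambda>y. ln (out_dens n s Q y))"
proof (rule quad_boundedI)
  let ?C = "gconst n s"
  have C: "0 < ?C" using s by simp
  show "(\<lambda>y. ln (out_dens n s Q y)) \<in> borel_measurable (lborel_n n)"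
    using out_dens_measurable[OF Q] by measurable
  show "0 \<le> \<bar>ln ?C\<bar> + R\<^sup>2 / s" "0 \<le> 1 / s" using s by auto
  fix y
  have "ln (?C * exp (- ((vnorm n y)\<^sup>2 + R\<^sup>2) / s)) \<le> ln (out_dens n s Q y)"
    using out_dens_bounds(1)[OF s Q, of y] out_dens_pos[OF s Q, of y] C by (intro ln_mono) auto
  moreover have "ln (?C * exp (- ((vnorm n y)\<^sup>2 + R\<^sup>2) / s)) = ln ?C + - ((vnorm n y)\<^sup>2 + R\<^sup>2) / s"
    using C by (subst ln_mult_pos) auto
  moreover have "ln (out_dens n s Q y) \<le> ln ?C"
    using out_dens_bounds(2)[OF s Q, of y] out_dens_pos[OF s Q, of y] by (intro ln_mono) auto
  moreover have "- ((vnorm n y)\<^sup>2 + R\<^sup>2) / s = - (R\<^sup>2 / s) - 1 / s * (vnorm n y)\<^sup>2" by (simp add: diff_divide_distrib)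
  moreover have "0 \<le> R\<^sup>2 / s" "0 \<le> 1 / s * (vnorm n y)\<^sup>2" using s by auto
  ultimately show "\<bar>ln (out_dens n s Q y)\<bar> \<le> \<bar>ln ?C\<bar> + R\<^sup>2 / s + 1 / s * (vnorm n y)\<^sup>2" by linarith
qed

text \<open>Minus the differential entropy of the noise, the same for every centre. The second
  moment is left unevaluated because the whole constant cancels in
  \<open>mutual_inf_compensation\<close>.\<close>

lemma ln_gauss_integral:
  assumes s: "0 < s"
  shows "integrable (gmeas n s x) (\<lambda>y. ln (gauss n s x y))"
    and "(\<integral>y. ln (gauss n s x y) \<partial>gmeas n s x) =
      ln (gconst n s) - (\<integral>z. (vnorm n z)\<^sup>2 \<partial>std_gauss_n n) / 2"
proof -
  interpret S: prob_space "std_gauss_n n" by (rule prob_space_std_gauss_n)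
  let ?C = "gconst n s"
  let ?T = "\<lambda>z. restrict (\<lambda>i. x i + sqrt s * z i) {..<n}"
  have m: "(\<lambda>y. ln (gauss n s x y)) \<in> borel_measurable (lborel_n n)" by measurable
  have e: "ln (gauss n s x (?T z)) = ln ?C - (vnorm n z)\<^sup>2 / 2" for z
  proof -
    have "(vnorm n (\<lambda>i. ?T z i - x i))\<^sup>2 = (vnorm n (\<lambda>i. sqrt s * z i))\<^sup>2" by (simp add: vnorm_power2)
    also have "\<dots> = s * (vnorm n z)\<^sup>2" using s by (simp add: vnorm_scale power_mult_distrib)
    finally have "gauss n s x (?T z) = ?C * exp (- (vnorm n z)\<^sup>2 / 2)" unfolding gauss_def using s by simp
    then show ?thesis using s by (simp add: ln_mult_pos)
  qed
  have i: "integrable (std_gauss_n n) (\<lambda>z. (vnorm n z)\<^sup>2)"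
    unfolding std_gauss_n_eq by (rule integrable_gmeas_vnorm2) simp
  show "integrable (gmeas n s x) (\<lambda>y. ln (gauss n s x y))"
    unfolding integral_gmeas_affine(2)[OF s m] e using i S.integrable_const[of "ln ?C"] by auto
  show "(\<integral>y. ln (gauss n s x y) \<partial>gmeas n s x) = ln ?C - (\<integral>z. (vnorm n z)\<^sup>2 \<partial>std_gauss_n n) / 2"
    unfolding integral_gmeas_affine(1)[OF s m] e using i S.integrable_const[of "ln ?C"] S.prob_space
    by (subst Bochner_Integration.integral_diff) auto
qed

lemma rel_ent_gauss:
  assumes s: "0 < s" and g: "\<And>y. 0 < g y" and q: "quad_bounded n (\<lambda>y. ln (g y))"
    and gm [measurable]: "g \<in> borel_measurable (lborel_n n)"
  shows "rel_ent n (gauss n s x) g =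
    (ln (gconst n s) - (\<integral>z. (vnorm n z)\<^sup>2 \<partial>std_gauss_n n) / 2) - (\<integral>y. ln (g y) \<partial>gmeas n s x)"
proof -
  have "rel_ent n (gauss n s x) g = (\<integral>y. ln (gauss n s x y / g y) \<partial>gmeas n s x)"
    unfolding rel_ent_def gmeas_def by (subst integral_density) auto
  also have "\<dots> = (\<integral>y. ln (gauss n s x y) - ln (g y) \<partial>gmeas n s x)"
    using gauss_pos[OF s] g by (simp add: ln_divide_pos)
  also have "\<dots> = (\<integral>y. ln (gauss n s x y) \<partial>gmeas n s x) - (\<integral>y. ln (g y) \<partial>gmeas n s x)"
    by (rule Bochner_Integration.integral_diff[OF ln_gauss_integral(1)[OF s] quad_bounded_integrable[OF s q]])
  finally show ?thesis unfolding ln_gauss_integral(2)[OF s] .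
qed

lemma rel_ent_out_dens:
  assumes s: "0 < s" and P: "admissible n R P" and Q: "admissible n R Q"
  shows "rel_ent n (out_dens n s Q) (out_dens n s P) =
    (\<integral>y. out_dens n s Q y * (ln (out_dens n s Q y) - ln (out_dens n s P y)) \<partial>lborel_n n)"
  unfolding rel_ent_def using out_dens_pos[OF s P] out_dens_pos[OF s Q] by (simp add: ln_divide_pos)

text \<open>The compensation identity: measuring the conditional laws against the output of
  \<open>P\<close> instead of the true output of \<open>Q\<close> overcounts by exactly the
  divergence of the two outputs. The noise entropy is common to both and cancels.\<close>

lemma mutual_inf_compensation:
  assumes s: "0 < s" and P: "admissible n R P" and Q: "admissible n R Q"
  shows "integrable Q (\<lambda>x. rel_ent n (gauss n s x) (out_dens n s P))"
    and "mutual_inf n s Q = (\<integral>x. rel_ent n (gauss n s x) (out_dens n s P) \<partial>Q) - rel_ent n (out_dens n s Q) (out_dens n s P)"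
proof -
  interpret Q: prob_space Q by (rule admissibleD(1)[OF Q])
  let ?k = "ln (gconst n s) - (\<integral>z. (vnorm n z)\<^sup>2 \<partial>std_gauss_n n) / 2"
  have r: "rel_ent n (gauss n s x) (out_dens n s P') = ?k - (\<integral>y. ln (out_dens n s P' y) \<partial>gmeas n s x)"
    if "admissible n R P'" for P' x
    by (rule rel_ent_gauss[OF s out_dens_pos[OF s that] quad_bounded_ln_out_dens[OF s that] out_dens_measurable[OF that]])
  let ?p = "\<lambda>y. ln (out_dens n s P y)" and ?q = "\<lambda>y. ln (out_dens n s Q y)"
  have qp: "quad_bounded n ?p" "quad_bounded n ?q"
    using quad_bounded_ln_out_dens[OF s P] quad_bounded_ln_out_dens[OF s Q] by auto
  have i: "integrable Q (\<lambda>x. \<integral>y. ?p y \<partial>gmeas n s x)" "integrable Q (\<lambda>x. \<integral>y. ?q y \<partial>gmeas n s x)"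
    by (rule out_dens_mixture(2)[OF s Q qp(1)], rule out_dens_mixture(2)[OF s Q qp(2)])
  show I: "integrable Q (\<lambda>x. rel_ent n (gauss n s x) (out_dens n s P))"
    unfolding r[OF P] by (rule Bochner_Integration.integrable_diff[OF Q.integrable_const i(1)])
  have I': "integrable Q (\<lambda>x. rel_ent n (gauss n s x) (out_dens n s Q))"
    unfolding r[OF Q] by (rule Bochner_Integration.integrable_diff[OF Q.integrable_const i(2)])
  have "rel_ent n (out_dens n s Q) (out_dens n s P) = (\<integral>x. (\<integral>y. ?q y - ?p y \<partial>gmeas n s x) \<partial>Q)"
    unfolding rel_ent_out_dens[OF s P Q] by (rule out_dens_mixture(3)[OF s Q quad_bounded_diff[OF qp(2,1)]])
  also have "\<dots> = (\<integral>x. rel_ent n (gauss n s x) (out_dens n s P) - rel_ent n (gauss n s x) (out_dens n s Q) \<partial>Q)"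
    unfolding r[OF P] r[OF Q] using quad_bounded_integrable[OF s qp(1)] quad_bounded_integrable[OF s qp(2)] by simp
  also have "\<dots> = (\<integral>x. rel_ent n (gauss n s x) (out_dens n s P) \<partial>Q) - mutual_inf n s Q"
    unfolding mutual_inf_def by (rule Bochner_Integration.integral_diff[OF I I'])
  finally show "mutual_inf n s Q = (\<integral>x. rel_ent n (gauss n s x) (out_dens n s P) \<partial>Q) - rel_ent n (out_dens n s Q) (out_dens n s P)"
    by simp
qed

text \<open>A tangent bound that is linear in (a, b) for fixed v, with equality when v = ln (a / b).
  Linearity lets it be integrated against a kernel, which replaces the log-sum inequality.\<close>

lemma log_tangent:
  fixes a b v :: real
  assumes "0 < a" "0 < b"
  shows "a * (1 + v) - exp v * b \<le> a * (ln a - ln b)"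
proof -
  have "ln (exp v * b / a) \<le> exp v * b / a - 1" using assms by (intro ln_le_minus_one) auto
  moreover have "ln (exp v * b / a) = v + ln b - ln a" using assms by (simp add: ln_div ln_mult_pos)
  ultimately have "a * (v + ln b - ln a) \<le> a * (exp v * b / a - 1)" using assms by (intro mult_left_mono) auto
  also have "\<dots> = exp v * b - a" using assms by (simp add: right_diff_distrib)
  finally show ?thesis by (simp add: algebra_simps)
qed

lemma rel_ent_out_dens_nonneg:
  assumes s: "0 < s" and P: "admissible n R P" and Q: "admissible n R Q"
  shows "0 \<le> rel_ent n (out_dens n s Q) (out_dens n s P)"
proof -
  let ?p = "out_dens n s P" and ?q = "out_dens n s Q"
  have "(\<integral>y. ?q y - ?p y \<partial>lborel_n n) \<le> (\<integral>y. ?q y * (ln (?q y) - ln (?p y)) \<partial>lborel_n n)"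
  proof (rule integral_mono)
    show "integrable (lborel_n n) (\<lambda>y. ?q y - ?p y)"
      using out_dens_integral(1)[OF s P] out_dens_integral(1)[OF s Q] by simp
    show "integrable (lborel_n n) (\<lambda>y. ?q y * (ln (?q y) - ln (?p y)))"
      by (rule out_dens_mixture(1)[OF s Q quad_bounded_diff[OF quad_bounded_ln_out_dens[OF s Q] quad_bounded_ln_out_dens[OF s P]]])
    fix y show "?q y - ?p y \<le> ?q y * (ln (?q y) - ln (?p y))"
      using log_tangent[OF out_dens_pos[OF s Q] out_dens_pos[OF s P], of y 0 y] by simp
  qed
  moreover have "(\<integral>y. ?q y - ?p y \<partial>lborel_n n) = 0"
    using out_dens_integral[OF s P] out_dens_integral[OF s Q] by simp
  ultimately show ?thesis unfolding rel_ent_out_dens[OF s P Q] by simp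
qed

lemma out_dens_convolution:
  assumes s: "0 < s" and t: "0 < t" and Q: "admissible n R Q"
  shows "integrable (lborel_n n) (\<lambda>z. out_dens n s Q z * gauss n t z y)"
    and "(\<integral>z. out_dens n s Q z * gauss n t z y \<partial>lborel_n n) = out_dens n (s + t) Q y"
proof -
  have m: "(\<lambda>z. gauss n t z y) \<in> borel_measurable (lborel_n n)"
    unfolding gauss_commute[of n t _ y] by (rule gauss_measurable)
  have q: "quad_bounded n (\<lambda>z. gauss n t z y)"
    by (rule quad_boundedI[OF m, of "gconst n t" 0]) (use gauss_le[OF t] in auto)
  show "integrable (lborel_n n) (\<lambda>z. out_dens n s Q z * gauss n t z y)"
    by (rule out_dens_mixture(1)[OF s Q q])
  have "(\<integral>z. gauss n t z y \<partial>gmeas n s x) = gauss n (s + t) x y" for x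
  proof -
    have "(\<integral>z. gauss n t z y \<partial>gmeas n s x) = (\<integral>z. gauss n s x z * gauss n t z y \<partial>lborel_n n)"
      unfolding gmeas_def using m by (subst integral_density) auto
    also have "\<dots> = gauss n (s + t) x y"
      using gauss_convolution[OF s t, of n x y] m by (subst integral_eq_nn_integral) auto
    finally show ?thesis .
  qed
  then show "(\<integral>z. out_dens n s Q z * gauss n t z y \<partial>lborel_n n) = out_dens n (s + t) Q y"
    using out_dens_mixture(3)[OF s Q q] by (simp add: out_dens_def)
qed

text \<open>For each y, the tangent bound with the log-ratio of the degraded densities at y is
  averaged over z against the noise kernel. Integrating over y then uses that the kernel has mass 1
  in y.\<close>

lemma data_processing:
  assumes s: "0 < s" and t: "0 < t" and P: "admissible n R P" and Q: "admissible n R Q"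
  shows "rel_ent n (out_dens n (s + t) Q) (out_dens n (s + t) P) \<le> rel_ent n (out_dens n s Q) (out_dens n s P)"
proof -
  interpret L: sigma_finite_measure "lborel_n n" by (rule sigma_finite_lborel_n)
  interpret PP: pair_sigma_finite "lborel_n n" "lborel_n n" ..
  have st: "0 < s + t" using s t by simp
  let ?p = "out_dens n s P" and ?q = "out_dens n s Q" and ?p2 = "out_dens n (s + t) P" and ?q2 = "out_dens n (s + t) Q"
  let ?u = "\<lambda>z. ?q z * (ln (?q z) - ln (?p z))"
  let ?f = "\<lambda>(z, y). ?u z * gauss n t z y"
  have u: "integrable (lborel_n n) ?u"
    by (rule out_dens_mixture(1)[OF s Q quad_bounded_diff[OF quad_bounded_ln_out_dens[OF s Q] quad_bounded_ln_out_dens[OF s P]]])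
  have um [measurable]: "?u \<in> borel_measurable (lborel_n n)" using u by auto
  note gm [measurable] = gauss_pair_measurable[OF refl, of n t]
  have gi: "integrable (lborel_n n) (\<lambda>y. gauss n t z y)" "(\<integral>y. gauss n t z y \<partial>lborel_n n) = 1" for z
    using nn_integral_gauss[OF t, of n z] by (auto intro!: integrableI_nonneg simp: integral_eq_nn_integral)
  have int: "integrable (lborel_n n \<Otimes>\<^sub>M lborel_n n) ?f"
  proof (rule PP.Fubini_integrable)
    show "?f \<in> borel_measurable (lborel_n n \<Otimes>\<^sub>M lborel_n n)" by measurable
    have "(\<integral>y. norm (?f (z, y)) \<partial>lborel_n n) = \<bar>?u z\<bar>" for z
      by (simp add: abs_mult gi)
    then show "integrable (lborel_n n) (\<lambda>z. \<integral>y. norm (?f (z, y)) \<partial>lborel_n n)"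
      using u by simp
    show "AE z in lborel_n n. integrable (lborel_n n) (\<lambda>y. ?f (z, y))" using gi by simp
  qed
  have pt: "?q2 y * (ln (?q2 y) - ln (?p2 y)) \<le> (\<integral>z. ?u z * gauss n t z y \<partial>lborel_n n)"
    if "integrable (lborel_n n) (\<lambda>z. ?u z * gauss n t z y)" for y
  proof -
    \<comment> \<open>With this slope the averaged tangent is q2 (1 + v) - q2 = q2 v, exactly the
      integrand of the degraded divergence at y.\<close>
    let ?v = "ln (?q2 y) - ln (?p2 y)"
    have ev: "exp ?v * ?p2 y = ?q2 y"
      using out_dens_pos[OF st P, of y] out_dens_pos[OF st Q, of y] by (simp add: exp_diff)
    have "(\<integral>z. (1 + ?v) * (?q z * gauss n t z y) - exp ?v * (?p z * gauss n t z y) \<partial>lborel_n n)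
      \<le> (\<integral>z. ?u z * gauss n t z y \<partial>lborel_n n)"
    proof (rule integral_mono[OF _ that])
      show "integrable (lborel_n n) (\<lambda>z. (1 + ?v) * (?q z * gauss n t z y) - exp ?v * (?p z * gauss n t z y))"
        using out_dens_convolution(1)[OF s t P] out_dens_convolution(1)[OF s t Q] by auto
      fix z
      have "(?q z * (1 + ?v) - exp ?v * ?p z) * gauss n t z y \<le> ?u z * gauss n t z y"
        by (rule mult_right_mono[OF log_tangent[OF out_dens_pos[OF s Q] out_dens_pos[OF s P]]]) simp
      then show "(1 + ?v) * (?q z * gauss n t z y) - exp ?v * (?p z * gauss n t z y) \<le> ?u z * gauss n t z y"
      proof -
        have "(a * b - c * d) * g = b * (a * g) - c * (d * g)" for a b c d g :: real by (simp add: algebra_simps)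
        then show ?thesis using \<open>_ \<le> ?u z * gauss n t z y\<close> by metis
      qed
    qed
    also have "(\<integral>z. (1 + ?v) * (?q z * gauss n t z y) - exp ?v * (?p z * gauss n t z y) \<partial>lborel_n n)
      = (1 + ?v) * ?q2 y - exp ?v * ?p2 y"
      using out_dens_convolution[OF s t P] out_dens_convolution[OF s t Q] by (subst Bochner_Integration.integral_diff) auto
    finally show ?thesis unfolding ev by (simp add: algebra_simps)
  qed
  have "rel_ent n ?q2 ?p2 = (\<integral>y. ?q2 y * (ln (?q2 y) - ln (?p2 y)) \<partial>lborel_n n)"
    by (rule rel_ent_out_dens[OF st P Q])
  also have "\<dots> \<le> (\<integral>y. (\<integral>z. ?u z * gauss n t z y \<partial>lborel_n n) \<partial>lborel_n n)"
  proof (rule integral_mono_AE)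
    show "integrable (lborel_n n) (\<lambda>y. ?q2 y * (ln (?q2 y) - ln (?p2 y)))"
      by (rule out_dens_mixture(1)[OF st Q quad_bounded_diff[OF quad_bounded_ln_out_dens[OF st Q] quad_bounded_ln_out_dens[OF st P]]])
    show "integrable (lborel_n n) (\<lambda>y. \<integral>z. ?u z * gauss n t z y \<partial>lborel_n n)"
      by (rule PP.integrable_snd[OF int])
    show "AE y in lborel_n n. ?q2 y * (ln (?q2 y) - ln (?p2 y)) \<le> (\<integral>z. ?u z * gauss n t z y \<partial>lborel_n n)"
      using PP.AE_integrable_snd[OF int] by (rule eventually_mono) (rule pt)
  qed
  also have "\<dots> = (\<integral>z. (\<integral>y. ?u z * gauss n t z y \<partial>lborel_n n) \<partial>lborel_n n)"
    by (rule PP.Fubini_integral[OF int])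
  also have "\<dots> = (\<integral>z. ?u z \<partial>lborel_n n)" by (simp add: gi)
  also have "\<dots> = rel_ent n ?q ?p" by (rule rel_ent_out_dens[OF s P Q, symmetric])
  finally show ?thesis .
qed

section \<open>Optimality of the spherical input\<close>

lemma admissible_unif_sphere:
  assumes "1 \<le> n" "0 \<le> R"
  shows "admissible n R (unif_sphere n R)"
  unfolding admissible_def using prob_space_unif_sphere[OF assms(1)]
  by (auto intro!: eventually_mono[OF AE_unif_sphere[OF assms]])

text \<open>In the log-ratio the |y|^2 terms cancel. What remains is linear in y, with a known mean,
  a constant, and \<open>logF\<close> of the norm, so the result depends on x through its norm
  only.\<close>

lemma rel_ent_gauss_sphere:
  assumes n: "1 \<le> n" and s: "0 < s" and R: "0 \<le> R"
  shows "rel_ent n (gauss n s x) (out_dens n s (unif_sphere n R)) = ((vnorm n x)\<^sup>2 + R\<^sup>2) / (2 * s) - mean_logF n R s (vnorm n x)"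
proof -
  interpret G: prob_space "gmeas n s x" by (rule prob_space_gmeas[OF s])
  let ?c = "(R\<^sup>2 - (vnorm n x)\<^sup>2) / (2 * s)"
  have om [measurable]: "out_dens n s (unif_sphere n R) \<in> borel_measurable (lborel_n n)"
    by (rule out_dens_measurable[OF admissible_unif_sphere[OF n R]])
  have l: "ln (gauss n s x y / out_dens n s (unif_sphere n R) y) = ip n x y / s + ?c - logF n R s (vnorm n y)" for y
  proof -
    have F: "0 < sphF n (R * vnorm n y / s)" by (rule sphF_pos[OF n])
    have "gauss n s x y / out_dens n s (unif_sphere n R) y
      = exp (- ((vnorm n y)\<^sup>2 - 2 * ip n x y + (vnorm n x)\<^sup>2) / (2 * s)) / exp (- ((vnorm n y)\<^sup>2 + R\<^sup>2) / (2 * s)) / sphF n (R * vnorm n y / s)"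
      unfolding gauss_alt out_dens_unif_sphere[OF n s R] using s by simp
    also have "\<dots> = exp (- ((vnorm n y)\<^sup>2 - 2 * ip n x y + (vnorm n x)\<^sup>2) / (2 * s) - - ((vnorm n y)\<^sup>2 + R\<^sup>2) / (2 * s)) / sphF n (R * vnorm n y / s)"
      by (simp only: exp_diff)
    also have "- ((vnorm n y)\<^sup>2 - 2 * ip n x y + (vnorm n x)\<^sup>2) / (2 * s) - - ((vnorm n y)\<^sup>2 + R\<^sup>2) / (2 * s) = ip n x y / s + ?c"
      using s by (simp add: field_simps)
    finally show ?thesis using F by (simp add: ln_divide_pos logF_def)
  qed
  have i: "integrable (gmeas n s x) (\<lambda>y. ip n x y / s)" "integrable (gmeas n s x) (\<lambda>y. logF n R s (vnorm n y))"
    using gmeas_ip_mean(1)[OF s, of n x x] logF_gmeas_integrable[OF n s R s] by auto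
  have "rel_ent n (gauss n s x) (out_dens n s (unif_sphere n R)) = (\<integral>y. ln (gauss n s x y / out_dens n s (unif_sphere n R) y) \<partial>gmeas n s x)"
    unfolding rel_ent_def gmeas_def by (subst integral_density) auto
  also have "\<dots> = (\<integral>y. ip n x y / s + ?c - logF n R s (vnorm n y) \<partial>gmeas n s x)" unfolding l ..
  also have "\<dots> = (\<integral>y. ip n x y / s + ?c \<partial>gmeas n s x) - (\<integral>y. logF n R s (vnorm n y) \<partial>gmeas n s x)"
    by (rule Bochner_Integration.integral_diff[OF Bochner_Integration.integrable_add[OF i(1) G.integrable_const] i(2)])
  also have "(\<integral>y. ip n x y / s + ?c \<partial>gmeas n s x) = (\<integral>y. ip n x y / s \<partial>gmeas n s x) + (\<integral>y. ?c \<partial>gmeas n s x)"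
    by (rule Bochner_Integration.integral_add[OF i(1) G.integrable_const])
  also have "(\<integral>y. ip n x y / s \<partial>gmeas n s x) = (vnorm n x)\<^sup>2 / s"
  proof -
    have "ip n x x = (vnorm n x)\<^sup>2" unfolding ip_def vnorm_power2 by (simp add: power2_eq_square)
    then show ?thesis using gmeas_ip_mean(2)[OF s, of n x x] by simp
  qed
  also have "(\<integral>y. ?c \<partial>gmeas n s x) = ?c" using G.prob_space by simp
  also have "(\<integral>y. logF n R s (vnorm n y) \<partial>gmeas n s x) = mean_logF n R s (vnorm n x)"
    unfolding mean_logF_def by (rule norm_law_integral(1)[OF n s borel_measurable_logF[OF n]])
  finally show ?thesis using s by (simp add: field_simps)
qed

lemma secrecy_density_sphere:
  assumes "1 \<le> n" "0 < s1" "s1 < s2" "0 \<le> R"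
  shows "secrecy_density n s1 s2 (unif_sphere n R) x = radial_secrecy n R s1 s2 (vnorm n x)"
  unfolding secrecy_density_def radial_secrecy_def using assms by (simp add: rel_ent_gauss_sphere)

lemma secrecy_rate_decomposition:
  assumes s: "0 < s1" "s1 < s2" and P: "admissible n R P" and Q: "admissible n R Q"
  shows "integrable Q (secrecy_density n s1 s2 P)"
    and "secrecy_rate n s1 s2 Q = (\<integral>x. secrecy_density n s1 s2 P x \<partial>Q)
      - (rel_ent n (out_dens n s1 Q) (out_dens n s1 P) - rel_ent n (out_dens n s2 Q) (out_dens n s2 P))"
proof -
  have s2: "0 < s2" using s by simp
  note c1 = mutual_inf_compensation[OF s(1) P Q] and c2 = mutual_inf_compensation[OF s2 P Q]
  show "integrable Q (secrecy_density n s1 s2 P)"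
    unfolding secrecy_density_def[abs_def] by (rule Bochner_Integration.integrable_diff[OF c1(1) c2(1)])
  have "(\<integral>x. secrecy_density n s1 s2 P x \<partial>Q) = (\<integral>x. rel_ent n (gauss n s1 x) (out_dens n s1 P) \<partial>Q) - (\<integral>x. rel_ent n (gauss n s2 x) (out_dens n s2 P) \<partial>Q)"
    unfolding secrecy_density_def by (rule Bochner_Integration.integral_diff[OF c1(1) c2(1)])
  then show "secrecy_rate n s1 s2 Q = (\<integral>x. secrecy_density n s1 s2 P x \<partial>Q)
      - (rel_ent n (out_dens n s1 Q) (out_dens n s1 P) - rel_ent n (out_dens n s2 Q) (out_dens n s2 P))"
    unfolding secrecy_rate_def c1(2) c2(2) by simp
qed

text \<open>Writing s2 = s1 + (s2 - s1) exhibits the second output as a degraded first one, so the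
  divergence difference in the decomposition is nonnegative.\<close>

lemma secrecy_rate_le:
  assumes s: "0 < s1" "s1 < s2" and P: "admissible n R P" and Q: "admissible n R Q"
  shows "secrecy_rate n s1 s2 Q \<le> (\<integral>x. secrecy_density n s1 s2 P x \<partial>Q)"
  using secrecy_rate_decomposition(2)[OF s P Q] data_processing[OF s(1) _ P Q, of "s2 - s1"] s by simp

lemma secrecy_rate_self:
  assumes s: "0 < s1" "s1 < s2" and P: "admissible n R P"
  shows "secrecy_rate n s1 s2 P = (\<integral>x. secrecy_density n s1 s2 P x \<partial>P)"
  using secrecy_rate_decomposition(2)[OF s P P] rel_ent_out_dens[OF s(1) P P] rel_ent_out_dens[OF less_trans[OF s] P P] by simp

lemma integral_secrecy_density_sphere:
  assumes n: "1 \<le> n" and s: "0 < s1" "s1 < s2" and R: "0 \<le> R"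
  shows "(\<integral>x. secrecy_density n s1 s2 (unif_sphere n R) x \<partial>unif_sphere n R) = radial_secrecy n R s1 s2 R"
proof -
  interpret P: prob_space "unif_sphere n R" by (rule prob_space_unif_sphere[OF n])
  note a = admissible_unif_sphere[OF n R]
  have "(\<integral>x. secrecy_density n s1 s2 (unif_sphere n R) x \<partial>unif_sphere n R) = (\<integral>x. radial_secrecy n R s1 s2 R \<partial>unif_sphere n R)"
  proof (rule integral_cong_AE)
    show "secrecy_density n s1 s2 (unif_sphere n R) \<in> borel_measurable (unif_sphere n R)"
      using secrecy_rate_decomposition(1)[OF s a a] by auto
    show "AE x in unif_sphere n R. secrecy_density n s1 s2 (unif_sphere n R) x = radial_secrecy n R s1 s2 R"
      using AE_unif_sphere[OF n R] by (rule eventually_mono) (simp add: secrecy_density_sphere[OF n s R])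
  qed simp
  then show ?thesis using P.prob_space by simp
qed

lemma unif_sphere_optimal:
  assumes n: "1 \<le> n" and s: "0 < s1" "s1 < s2" and R: "0 \<le> R"
    and max: "\<And>\<rho>. 0 \<le> \<rho> \<Longrightarrow> \<rho> \<le> R \<Longrightarrow> radial_secrecy n R s1 s2 \<rho> \<le> radial_secrecy n R s1 s2 R"
  shows "optimal n s1 s2 R (unif_sphere n R)"
  unfolding optimal_def
proof (intro conjI allI impI)
  show P: "admissible n R (unif_sphere n R)" by (rule admissible_unif_sphere[OF n R])
  fix Q assume Q: "admissible n R Q"
  interpret Q: prob_space Q by (rule admissibleD(1)[OF Q])
  have "secrecy_rate n s1 s2 Q \<le> (\<integral>x. secrecy_density n s1 s2 (unif_sphere n R) x \<partial>Q)"
    by (rule secrecy_rate_le[OF s P Q])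
  also have "\<dots> \<le> (\<integral>x. radial_secrecy n R s1 s2 R \<partial>Q)"
  proof (rule integral_mono_AE[OF secrecy_rate_decomposition(1)[OF s P Q]])
    show "AE x in Q. secrecy_density n s1 s2 (unif_sphere n R) x \<le> radial_secrecy n R s1 s2 R"
      using admissibleD(4)[OF Q] by (rule eventually_mono) (simp add: secrecy_density_sphere[OF n s R] max)
  qed simp
  also have "\<dots> = secrecy_rate n s1 s2 (unif_sphere n R)"
    unfolding secrecy_rate_self[OF s P] integral_secrecy_density_sphere[OF n s R] using Q.prob_space by simp
  finally show "secrecy_rate n s1 s2 Q \<le> secrecy_rate n s1 s2 (unif_sphere n R)" .
qed

text \<open>The mixture (1 - t) P + t delta_0, realised as a Bernoulli choice between the origin and
  a draw from \<open>P\<close>; integrals and supports then come from a product measure.\<close>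

definition origin_mixture :: "nat \<Rightarrow> real \<Rightarrow> (nat \<Rightarrow> real) measure \<Rightarrow> (nat \<Rightarrow> real) measure" where
  "origin_mixture n t P = distr (measure_pmf (bernoulli_pmf t) \<Otimes>\<^sub>M P) (lborel_n n)
     (\<lambda>(b, x). if b then restrict (\<lambda>_. 0) {..<n} else x)"

lemma origin_mixture_map_measurable:
  assumes "sets P = sets (lborel_n n)"
  shows "(\<lambda>(b, x). if b then restrict (\<lambda>_. 0) {..<n} else x) \<in> measurable (measure_pmf (bernoulli_pmf t) \<Otimes>\<^sub>M P) (lborel_n n)"
proof -
  have [measurable_cong]: "sets P = sets (lborel_n n)" by (rule assms)
  have [measurable]: "restrict (\<lambda>_. 0::real) {..<n} \<in> space (lborel_n n)" by (simp add: space_lborel_n)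
  have [measurable]: "Measurable.pred (measure_pmf (bernoulli_pmf t)) (\<lambda>b. b)" by simp
  show ?thesis unfolding case_prod_beta by measurable
qed

lemma integral_origin_mixture:
  fixes f :: "(nat \<Rightarrow> real) \<Rightarrow> real"
  assumes P: "admissible n R P" and t: "0 \<le> t" "t \<le> 1" and [measurable]: "f \<in> borel_measurable (lborel_n n)" and i: "integrable P f"
  shows "(\<integral>x. f x \<partial>origin_mixture n t P) = t * f (restrict (\<lambda>_. 0) {..<n}) + (1 - t) * (\<integral>x. f x \<partial>P)"
proof -
  interpret P: prob_space P by (rule admissibleD(1)[OF P])
  interpret B: prob_space "measure_pmf (bernoulli_pmf t)" by (rule measure_pmf.prob_space_axioms)
  interpret BP: pair_prob_space "measure_pmf (bernoulli_pmf t)" P ..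
  let ?T = "\<lambda>(b, x). if b then restrict (\<lambda>_. 0) {..<n} else x"
  let ?B = "measure_pmf (bernoulli_pmf t)"
  note T [measurable] = origin_mixture_map_measurable[OF admissibleD(2)[OF P], of t]
  have fm: "(\<lambda>p. f (?T p)) \<in> borel_measurable (?B \<Otimes>\<^sub>M P)" by measurable
  have ib: "integrable P (\<lambda>x. f (?T (b, x)))" for b using i by (cases b) auto
  have int: "integrable (?B \<Otimes>\<^sub>M P) (\<lambda>p. f (?T p))"
  proof (rule BP.Fubini_integrable[OF fm])
    show "integrable ?B (\<lambda>b. \<integral>x. norm (f (?T (b, x))) \<partial>P)"
      by (rule integrable_measure_pmf_finite) (rule finite_subset[OF subset_UNIV], simp)
    show "AE b in ?B. integrable P (\<lambda>x. f (?T (b, x)))" using ib by simp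
  qed
  have "(\<integral>x. f x \<partial>origin_mixture n t P) = (\<integral>p. f (?T p) \<partial>(?B \<Otimes>\<^sub>M P))"
    unfolding origin_mixture_def by (rule integral_distr[OF T]) measurable
  also have "\<dots> = (\<integral>b. (\<integral>x. f (?T (b, x)) \<partial>P) \<partial>?B)" by (rule BP.integral_fst'[OF int, symmetric])
  also have "\<dots> = t * f (restrict (\<lambda>_. 0) {..<n}) + (1 - t) * (\<integral>x. f x \<partial>P)"
    using t P.prob_space by (simp add: integral_measure_pmf_real[where A=UNIV] UNIV_bool)
  finally show ?thesis .
qed

lemma admissible_origin_mixture:
  assumes P: "admissible n R P" and R: "0 \<le> R"
  shows "admissible n R (origin_mixture n t P)"
proof -
  interpret P: prob_space P by (rule admissibleD(1)[OF P])
  interpret B: prob_space "measure_pmf (bernoulli_pmf t)" by (rule measure_pmf.prob_space_axioms)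
  interpret BP: pair_prob_space "measure_pmf (bernoulli_pmf t)" P ..
  let ?B = "measure_pmf (bernoulli_pmf t)"
  note T [measurable] = origin_mixture_map_measurable[OF admissibleD(2)[OF P], of t]
  have [measurable_cong]: "sets P = sets (lborel_n n)" by (rule admissibleD(2)[OF P])
  have "AE p in ?B \<Otimes>\<^sub>M P. vnorm n (case p of (b, x) \<Rightarrow> if b then restrict (\<lambda>_. 0) {..<n} else x) \<le> R"
  proof (rule BP.AE_pair_measure)
    show "{p \<in> space (?B \<Otimes>\<^sub>M P). vnorm n (case p of (b, x) \<Rightarrow> if b then restrict (\<lambda>_. 0) {..<n} else x) \<le> R} \<in> sets (?B \<Otimes>\<^sub>M P)"
      by measurable
    show "AE b in ?B. AE x in P. vnorm n (case (b, x) of (b, x) \<Rightarrow> if b then restrict (\<lambda>_. 0) {..<n} else x) \<le> R"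
    proof (rule AE_I2)
      fix b show "AE x in P. vnorm n (case (b, x) of (b, x) \<Rightarrow> if b then restrict (\<lambda>_. 0) {..<n} else x) \<le> R"
        using admissibleD(4)[OF P] R by (cases b) auto
    qed
  qed
  then have "AE x in origin_mixture n t P. vnorm n x \<le> R"
    unfolding origin_mixture_def by (subst AE_distr_iff) auto
  moreover have "prob_space (origin_mixture n t P)"
    unfolding origin_mixture_def by (rule BP.prob_space_distr[OF T])
  moreover have "sets (origin_mixture n t P) = sets (lborel_n n)" by (simp add: origin_mixture_def)
  ultimately show ?thesis by (simp add: admissible_def)
qed

text \<open>Bounding ln u by u - 1 replaces the divergence by a chi-square distance, which is
  quadratic in t. It is finite because the centred Gaussian is at most exp(R^2 / (2 s)) times the
  spherical output density, as \<open>sphF\<close> is at least 1.\<close>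

lemma rel_ent_origin_mixture_le:
  assumes n: "1 \<le> n" and s: "0 < s" and R: "0 \<le> R" and t: "0 \<le> t" "t \<le> 1"
  defines "P \<equiv> unif_sphere n R"
  shows "rel_ent n (out_dens n s (origin_mixture n t P)) (out_dens n s P) \<le> t\<^sup>2 * (exp (R\<^sup>2 / (2 * s)) - 1)"
proof -
  have a: "admissible n R P" unfolding P_def by (rule admissible_unif_sphere[OF n R])
  let ?Q = "origin_mixture n t P"
  have q: "admissible n R ?Q" by (rule admissible_origin_mixture[OF a R])
  let ?\<phi> = "gauss n s (\<lambda>_. 0)"
  let ?p = "out_dens n s P" and ?q = "out_dens n s ?Q"
  let ?\<kappa> = "exp (R\<^sup>2 / (2 * s))"
  have mix: "?q y = t * ?\<phi> y + (1 - t) * ?p y" for y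
  proof -
    have "(\<lambda>x. gauss n s x y) \<in> borel_measurable (lborel_n n)"
      unfolding gauss_commute[of n s _ y] by (rule gauss_measurable)
    from integral_origin_mixture[OF a t this gauss_integrable_input[OF s a]]
    show ?thesis unfolding out_dens_def by (simp add: gauss_alt)
  qed
  have ratio: "?\<phi> y \<le> ?\<kappa> * ?p y" for y
  proof -
    have e: "exp (R\<^sup>2 / (2 * s)) * exp (- ((vnorm n y)\<^sup>2 + R\<^sup>2) / (2 * s)) = exp (- (vnorm n y)\<^sup>2 / (2 * s))"
      unfolding exp_add[symmetric] add_divide_distrib[symmetric] by simp
    let ?C = "gconst n s"
    have "?\<phi> y = ?C * exp (- (vnorm n y)\<^sup>2 / (2 * s)) * 1" by (simp add: gauss_alt)
    also have "\<dots> \<le> ?C * exp (- (vnorm n y)\<^sup>2 / (2 * s)) * sphF n (R * vnorm n y / s)"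
      by (intro mult_left_mono sphF_ge_1 n) simp
    also have "\<dots> = ?\<kappa> * ?p y" unfolding P_def out_dens_unif_sphere[OF n s R] e[symmetric] by simp
    finally show ?thesis .
  qed
  have \<phi>i: "integrable (lborel_n n) ?\<phi>" "(\<integral>y. ?\<phi> y \<partial>lborel_n n) = 1"
    using nn_integral_gauss[OF s, of n "\<lambda>_. 0"] by (auto intro!: integrableI_nonneg simp: integral_eq_nn_integral)
  have "rel_ent n ?q ?p = (\<integral>y. ?q y * (ln (?q y) - ln (?p y)) \<partial>lborel_n n)"
    by (rule rel_ent_out_dens[OF s a q])
  also have "\<dots> \<le> (\<integral>y. t * (1 - t) * (?\<phi> y - ?p y) + t\<^sup>2 * (?\<kappa> - 1) * ?\<phi> y \<partial>lborel_n n)"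
  proof (rule integral_mono)
    show "integrable (lborel_n n) (\<lambda>y. ?q y * (ln (?q y) - ln (?p y)))"
      by (rule out_dens_mixture(1)[OF s q quad_bounded_diff[OF quad_bounded_ln_out_dens[OF s q] quad_bounded_ln_out_dens[OF s a]]])
    show "integrable (lborel_n n) (\<lambda>y. t * (1 - t) * (?\<phi> y - ?p y) + t\<^sup>2 * (?\<kappa> - 1) * ?\<phi> y)"
      using \<phi>i out_dens_integral(1)[OF s a] by auto
    fix y
    have p: "0 < ?p y" and qp: "0 < ?q y" by (rule out_dens_pos[OF s a], rule out_dens_pos[OF s q])
    define f p' where "f = ?\<phi> y" and "p' = ?p y"
    have f0: "0 \<le> f" and p0: "0 < p'" using p by (simp_all add: f_def p'_def)
    have "ln (?q y) - ln (?p y) \<le> ?q y / ?p y - 1"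
      using ln_le_minus_one[of "?q y / ?p y"] p qp by (simp add: ln_divide_pos)
    then have "?q y * (ln (?q y) - ln (?p y)) \<le> ?q y * (?q y / ?p y - 1)"
      using qp by (intro mult_left_mono) auto
    \<comment> \<open>The term of first order in t is a multiple of the difference of two
      probability densities and integrates to 0; the rest carries the factor t^2.\<close>
    also have "\<dots> = t * (1 - t) * (f - p') + t\<^sup>2 * (f * (f / p' - 1))"
      unfolding mix f_def[symmetric] p'_def[symmetric] using p0 by (simp add: field_simps power2_eq_square)
    also have "\<dots> \<le> t * (1 - t) * (f - p') + t\<^sup>2 * (f * (?\<kappa> - 1))"
    proof (intro add_left_mono mult_left_mono f0)
      show "f / p' - 1 \<le> ?\<kappa> - 1" using ratio[of y] p0 by (simp add: f_def p'_def pos_divide_le_eq)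
    qed simp
    finally show "?q y * (ln (?q y) - ln (?p y)) \<le> t * (1 - t) * (?\<phi> y - ?p y) + t\<^sup>2 * (?\<kappa> - 1) * ?\<phi> y"
      unfolding f_def p'_def by (simp add: mult_ac)
  qed
  also have "\<dots> = t * (1 - t) * ((\<integral>y. ?\<phi> y \<partial>lborel_n n) - (\<integral>y. ?p y \<partial>lborel_n n)) + t\<^sup>2 * (?\<kappa> - 1) * (\<integral>y. ?\<phi> y \<partial>lborel_n n)"
    using \<phi>i(1) out_dens_integral(1)[OF s a] by simp
  also have "\<dots> = t\<^sup>2 * (?\<kappa> - 1)" unfolding \<phi>i(2) out_dens_integral(2)[OF s a] by simp
  finally show ?thesis .
qed

text \<open>Moving mass \<open>t\<close> to the origin changes the rate by \<open>t (\<Xi>(0) - \<Xi>(R)) - O(t\<^sup>2)\<close>.\<close>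

lemma optimal_imp_origin_le:
  assumes n: "1 \<le> n" and s: "0 < s1" "s1 < s2" and R: "0 \<le> R" and opt: "optimal n s1 s2 R (unif_sphere n R)"
  shows "radial_secrecy n R s1 s2 0 \<le> radial_secrecy n R s1 s2 R"
proof -
  let ?P = "unif_sphere n R" and ?X = "radial_secrecy n R s1 s2" and ?\<kappa> = "exp (R\<^sup>2 / (2 * s1)) - 1"
  have s2: "0 < s2" using s by simp
  have P: "admissible n R ?P" by (rule admissible_unif_sphere[OF n R])
  have main: "?X 0 - ?X R \<le> t * ?\<kappa>" if t: "0 < t" "t \<le> 1" for t
  proof -
    let ?Q = "origin_mixture n t ?P"
    have t0: "0 \<le> t" using t by simp
    have Q: "admissible n R ?Q" by (rule admissible_origin_mixture[OF P R])
    have i: "integrable ?P (secrecy_density n s1 s2 ?P)" by (rule secrecy_rate_decomposition(1)[OF s P P])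
    have m: "secrecy_density n s1 s2 ?P \<in> borel_measurable (lborel_n n)"
      using borel_measurable_integrable[OF i] by (simp add: measurable_cong_sets[OF sets_unif_sphere refl])
    have "(\<integral>x. secrecy_density n s1 s2 ?P x \<partial>?Q) = t * ?X 0 + (1 - t) * ?X R"
      unfolding integral_origin_mixture[OF P t0 t(2) m i] integral_secrecy_density_sphere[OF n s R]
      by (simp add: secrecy_density_sphere[OF n s R])
    moreover have "secrecy_rate n s1 s2 ?Q \<le> secrecy_rate n s1 s2 ?P"
      using opt Q by (simp add: optimal_def)
    moreover have "secrecy_rate n s1 s2 ?P = ?X R"
      unfolding secrecy_rate_self[OF s P] by (rule integral_secrecy_density_sphere[OF n s R])
    \<comment> \<open>In the rate of the mixture the second divergence has a plus sign, so its
      nonnegativity is enough; the t^2 bound is used for the first divergence.\<close>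
    ultimately have "t * ?X 0 + (1 - t) * ?X R - t\<^sup>2 * ?\<kappa> \<le> ?X R"
      using secrecy_rate_decomposition(2)[OF s P Q] rel_ent_origin_mixture_le[OF n s(1) R t0 t(2)]
        rel_ent_out_dens_nonneg[OF s2 P Q] by linarith
    then have "t * (?X 0 - ?X R) \<le> t * (t * ?\<kappa>)" by (simp add: algebra_simps power2_eq_square)
    then show ?thesis using t by simp
  qed
  have "((\<lambda>t. t * ?\<kappa>) \<longlongrightarrow> 0) (at_right 0)" by (auto intro!: tendsto_eq_intros)
  moreover have "\<forall>\<^sub>F t in at_right 0. ?X 0 - ?X R \<le> t * ?\<kappa>"
    by (rule eventually_mono[OF eventually_at_right_real[of 0 "1::real"]]) (auto intro!: main)
  ultimately have "?X 0 - ?X R \<le> 0" by (intro tendsto_lowerbound) auto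
  then show ?thesis by simp
qed

theorem theorem8:
  fixes n :: nat and s1 s2 R :: real
  assumes "1 \<le> n" and "0 < s1" and "s1 < s2" and "0 \<le> R"
  shows "(assumptionA \<longrightarrow>
           (optimal n s1 s2 R (unif_sphere n R) \<longleftrightarrow>
             (\<forall>x\<in>space (lborel_n n). vnorm n x = R \<longrightarrow>
                secrecy_density n s1 s2 (unif_sphere n R) (\<lambda>_. 0)
                  \<le> secrecy_density n s1 s2 (unif_sphere n R) x)))
       \<and> (R < s1 * sqrt (real n * (1 / s1 - 1 / s2)) \<longrightarrow> optimal n s1 s2 R (unif_sphere n R))"
proof -
  let ?X = "radial_secrecy n R s1 s2"
  \<comment> \<open>The point R e_1 shows that the sphere is nonempty, so the condition over all its
    points is equivalent to the single inequality between radial values.\<close>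
  have "restrict (e0 R) {..<n} \<in> space (lborel_n n)" "vnorm n (restrict (e0 R) {..<n}) = R"
    using assms by (simp_all add: space_lborel_n vnorm_e0)
  then have "(\<forall>x\<in>space (lborel_n n). vnorm n x = R \<longrightarrow> secrecy_density n s1 s2 (unif_sphere n R) (\<lambda>_. 0)
      \<le> secrecy_density n s1 s2 (unif_sphere n R) x) \<longleftrightarrow> ?X 0 \<le> ?X R"
    unfolding secrecy_density_sphere[OF assms] by (metis vnorm_zero)
  moreover have "optimal n s1 s2 R (unif_sphere n R) \<longleftrightarrow> ?X 0 \<le> ?X R" if assumptionA
    using optimal_imp_origin_le[OF assms] unif_sphere_optimal[OF assms] radial_secrecy_max_A[OF assms that] by blast
  moreover have "optimal n s1 s2 R (unif_sphere n R)" if "R < s1 * sqrt (real n * (1 / s1 - 1 / s2))"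
    using unif_sphere_optimal[OF assms] radial_secrecy_max_small[OF assms that] by blast
  ultimately show ?thesis by blast
qed

end
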